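(* Let $d$ be a positive integer and let $\chi_1(t)=|t|^{s_1}\mathrm{sgn}(t)^{m_1}$, $\chi_2(t)=|t|^{s_2}\mathrm{sgn}(t)^{m_2}$ be characters of $\mathbb{R}^*$ with $s_1,s_2\in\mathbb{C}$, $m_1,m_2\in\{0,1\}$, such that $|t|^{s_1-s_2}\mathrm{sgn}(t)^{m_1-m_2}=t^d\,\mathrm{sgn}(t)$ for all $t\in\mathbb{R}^*$. Then the representation $R_{\chi_1,\chi_2}$ of $GL(2,\mathbb{R})$ on $L^2(\mathbb{R},dx/|x|)$ is strongly continuous and irreducible. It is unitary if the central character $\omega=\chi_1\chi_2$ is unitary.
   Context: Here $\omega=\chi_1\chi_2$, i.e. $\omega(b)=|b|^{s_1+s_2}\mathrm{sgn}(b)^{m_1+m_2}$. Let $\mathcal{K}_d$ be the space of smooth functions $f:\mathbb{R}\setminus\{0\}\to\mathbb{C}$ such that $f$ and all its derivatives are rapidly decreasing at $\pm\infty$ and $|x|^{-(d+1)/2}f(x)$ extends smoothly from $(0,\infty)$ to $[0,\infty)$ and from $(-\infty,0)$ to $(-\infty,0]$. The representation $R=R_{\chi_1,\chi_2}$ of $GL(2,\mathbb{R})$ on $L^2(\mathbb{R},dx/|x|)$ is given by the formulas $\left(R\begin{pmatrix}1&y\\0&1\end{pmatrix}f\right)(x)=e^{iyx}f(x)$ for $y\in\mathbb{R}$; $\left(R\begin{pmatrix}a&0\\0&1\end{pmatrix}f\right)(x)=\omega(|a|^{1/2})f(ax)$ for $a\in\mathbb{R}^*$; $\left(R\begin{pmatrix}b&0\\0&b\end{pmatrix}f\right)(x)=\omega(b)f(x)$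 for $b\in\mathbb{R}^*$; and $$\left(R\begin{pmatrix}0&-1\\1&0\end{pmatrix}f\right)(y)=\mathrm{sgn}(y)^{m_2+d+1}\int_{-\infty}^{\infty}f(x)j_d(xy)\frac{dx}{|x|},$$ where $j_d(x)=i^{-(d+1)}\sqrt{x}\,J_d(2\sqrt{x})$ for $x>0$, $j_d(x)=0$ for $x<0$, and $J_d$ is the classical $J$-Bessel function of order $d$; the integral is defined as the $L^2$ extension of a unitary operator on the space $\mathcal{K}_d$. Strongly continuous means $g\mapsto R(g)f$ is continuous for every $f$; irreducible means there is no closed invariant subspace other than $0$ and the whole space.
   Formalization: For m_2=1 the sign sgn(y)^{m_2+d+1} in the Weyl element formula is incompatible with the other formulas, so no such representation exists; existence is proved with sgn(y)^{d+1} instead, which agrees with the stated formula when m_2=0. *)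

theory Defs
  imports "HOL-Analysis.Analysis"
begin

subsection \<open>The Hilbert space \<open>L\<^sup>2(\<real>, dx/|x|)\<close>\<close>

text \<open>The value \<open>1 / 0 = 0\<close> of the density at the origin is harmless, a point being a null set.\<close>

definition mult_haar :: "real measure" where
  "mult_haar = density lborel (\<lambda>x. ennreal (1 / \<bar>x\<bar>))"

lemma sets_mult_haar [measurable_cong, simp]: "sets mult_haar = sets borel"
  by (simp add: mult_haar_def)

lemma space_mult_haar [simp]: "space mult_haar = UNIV"
  by (simp add: mult_haar_def)

definition sq_integrable :: "(real \<Rightarrow> complex) \<Rightarrow> bool" where
  "sq_integrable f \<longleftrightarrow>
     f \<in> borel_measurable mult_haar \<and> integrable mult_haar (\<lambda>x. (cmod (f x))\<^sup>2)"

lemma sq_integrable_measurable [measurable_dest]: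
  "sq_integrable f \<Longrightarrow> f \<in> borel_measurable mult_haar"
  by (simp add: sq_integrable_def)

lemma sq_integrable_zero: "sq_integrable (\<lambda>_. 0)"
  by (simp add: sq_integrable_def)

lemma sq_integrable_mult_cnj:
  assumes "sq_integrable f" "sq_integrable g"
  shows "integrable mult_haar (\<lambda>x. f x * cnj (g x))"
proof (rule Bochner_Integration.integrable_bound)
  show "integrable mult_haar (\<lambda>x. (cmod (f x))\<^sup>2 + (cmod (g x))\<^sup>2)"
    using assms by (simp add: sq_integrable_def)
  have [measurable]: "f \<in> borel_measurable borel" "g \<in> borel_measurable borel"
    using assms by (auto simp: sq_integrable_def cong: measurable_cong_sets)
  have "cnj \<in> borel_measurable borel"
    by (intro borel_measurable_continuous_onI continuous_intros)
  then have [measurable]: "(\<lambda>x. cnj (g x)) \<in> borel_measurable borel"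
    by (rule measurable_compose[rotated]) fact
  have "(\<lambda>x. f x * cnj (g x)) \<in> borel_measurable borel"
    by measurable
  then show "(\<lambda>x. f x * cnj (g x)) \<in> borel_measurable mult_haar"
    by (simp cong: measurable_cong_sets)
  have "a * b \<le> a\<^sup>2 + b\<^sup>2" if "a \<ge> 0" "b \<ge> 0" for a b :: real
    using sum_squares_bound[of a b] that mult_nonneg_nonneg[OF that] by linarith
  then show "AE x in mult_haar. norm (f x * cnj (g x)) \<le> norm ((cmod (f x))\<^sup>2 + (cmod (g x))\<^sup>2)"
    by (intro AE_I2) (simp add: norm_mult)
qed

lemma sq_integrable_add:
  assumes "sq_integrable f" "sq_integrable g"
  shows "sq_integrable (\<lambda>x. f x + g x)"
  unfolding sq_integrable_def
proof
  show meas: "(\<lambda>x. f x + g x) \<in> borel_measurable mult_haar"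
    using assms by (auto simp: sq_integrable_def)
  show "integrable mult_haar (\<lambda>x. (cmod (f x + g x))\<^sup>2)"
  proof (rule Bochner_Integration.integrable_bound)
    show "integrable mult_haar (\<lambda>x. 2 * (cmod (f x))\<^sup>2 + 2 * (cmod (g x))\<^sup>2)"
      using assms by (simp add: sq_integrable_def)
    show "(\<lambda>x. (cmod (f x + g x))\<^sup>2) \<in> borel_measurable mult_haar"
      using meas by measurable
    have "(cmod (a + b))\<^sup>2 \<le> 2 * (cmod a)\<^sup>2 + 2 * (cmod b)\<^sup>2" for a b
    proof -
      have "(cmod (a + b))\<^sup>2 \<le> (cmod a + cmod b)\<^sup>2"
        by (intro power_mono norm_triangle_ineq) auto
      also have "\<dots> \<le> 2 * (cmod a)\<^sup>2 + 2 * (cmod b)\<^sup>2"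
        using sum_squares_bound[of "cmod a" "cmod b"] by (simp add: power2_sum)
      finally show ?thesis .
    qed
    then show "AE x in mult_haar. norm ((cmod (f x + g x))\<^sup>2)
        \<le> norm (2 * (cmod (f x))\<^sup>2 + 2 * (cmod (g x))\<^sup>2)"
      by simp
  qed
qed

lemma sq_integrable_mult: "sq_integrable f \<Longrightarrow> sq_integrable (\<lambda>x. c * f x)"
  by (auto simp: sq_integrable_def norm_mult power_mult_distrib)

quotient_type L2 = "real \<Rightarrow> complex" / partial:
  "\<lambda>f g. sq_integrable f \<and> sq_integrable g \<and> (AE x in mult_haar. f x = g x)"
  morphisms rep_L2 class_L2
proof (rule part_equivpI)
  show "\<exists>f. sq_integrable f \<and> sq_integrable f \<and> (AE x in mult_haar. f x = f x)"
    using sq_integrable_zero by auto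
  show "symp (\<lambda>f g. sq_integrable f \<and> sq_integrable g \<and> (AE x in mult_haar. f x = g x))"
    by (auto simp: symp_def eq_commute)
  show "transp (\<lambda>f g. sq_integrable f \<and> sq_integrable g \<and> (AE x in mult_haar. f x = g x))"
  proof (intro transpI conjI)
    fix f g h :: "real \<Rightarrow> complex"
    assume *: "sq_integrable f \<and> sq_integrable g \<and> (AE x in mult_haar. f x = g x)"
      "sq_integrable g \<and> sq_integrable h \<and> (AE x in mult_haar. g x = h x)"
    then show "sq_integrable f" "sq_integrable h" by auto
    from * have "AE x in mult_haar. f x = g x" "AE x in mult_haar. g x = h x" by auto
    then show "AE x in mult_haar. f x = h x" by eventually_elim simp
  qed
qed

text \<open>\<open>f\<close> is a function in the class \<open>F\<close>. (\<^const>\<open>class_L2\<close> is meaningful on square-integrable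
  functions only.)\<close>

definition represents :: "L2 \<Rightarrow> (real \<Rightarrow> complex) \<Rightarrow> bool" where
  "represents F f \<longleftrightarrow> sq_integrable f \<and> F = class_L2 f"

lift_definition scaleC :: "complex \<Rightarrow> L2 \<Rightarrow> L2" is "\<lambda>c f x. c * f x"
proof -
  fix c :: complex and f f' :: "real \<Rightarrow> complex"
  assume A: "sq_integrable f \<and> sq_integrable f' \<and> (AE x in mult_haar. f x = f' x)"
  then have "AE x in mult_haar. f x = f' x" by simp
  then have "AE x in mult_haar. c * f x = c * f' x" by eventually_elim simp
  with A show "sq_integrable (\<lambda>x. c * f x) \<and> sq_integrable (\<lambda>x. c * f' x) \<and>
      (AE x in mult_haar. c * f x = c * f' x)"
    by (simp add: sq_integrable_mult)
qed

lift_definition cinner :: "L2 \<Rightarrow> L2 \<Rightarrow> complex" is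
  "\<lambda>f g. \<integral>x. f x * cnj (g x) \<partial>mult_haar"
proof -
  fix f f' g g' :: "real \<Rightarrow> complex"
  assume A: "sq_integrable f \<and> sq_integrable f' \<and> (AE x in mult_haar. f x = f' x)"
    and B: "sq_integrable g \<and> sq_integrable g' \<and> (AE x in mult_haar. g x = g' x)"
  have *: "AE x in mult_haar. f x = f' x" "AE x in mult_haar. g x = g' x"
    using A B by auto
  show "(\<integral>x. f x * cnj (g x) \<partial>mult_haar) = (\<integral>x. f' x * cnj (g' x) \<partial>mult_haar)"
  proof (rule integral_cong_AE)
    show "AE x in mult_haar. f x * cnj (g x) = f' x * cnj (g' x)"
      using * by eventually_elim simp
    show "(\<lambda>x. f x * cnj (g x)) \<in> borel_measurable mult_haar"
         "(\<lambda>x. f' x * cnj (g' x)) \<in> borel_measurable mult_haar"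
      using sq_integrable_mult_cnj[of f g] sq_integrable_mult_cnj[of f' g'] A B by auto
  qed
qed

text \<open>The norm and topology of the complex Hilbert space are those of the underlying real inner
  product space, whose inner product is the real part of \<^const>\<open>cinner\<close>.\<close>

instantiation L2 :: real_inner
begin

lift_definition zero_L2 :: L2 is "\<lambda>_. 0" by (simp add: sq_integrable_zero)

lift_definition plus_L2 :: "L2 \<Rightarrow> L2 \<Rightarrow> L2" is "\<lambda>f g x. f x + g x"
proof -
  fix f f' g g' :: "real \<Rightarrow> complex"
  assume A: "sq_integrable f \<and> sq_integrable f' \<and> (AE x in mult_haar. f x = f' x)"
    and B: "sq_integrable g \<and> sq_integrable g' \<and> (AE x in mult_haar. g x = g' x)"
  have "AE x in mult_haar. f x = f' x" "AE x in mult_haar. g x = g' x"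
    using A B by auto
  then have "AE x in mult_haar. f x + g x = f' x + g' x"
    by eventually_elim simp
  with A B show "sq_integrable (\<lambda>x. f x + g x) \<and> sq_integrable (\<lambda>x. f' x + g' x) \<and>
      (AE x in mult_haar. f x + g x = f' x + g' x)"
    by (simp add: sq_integrable_add)
qed

definition uminus_L2 :: "L2 \<Rightarrow> L2" where "- F = scaleC (-1) F"

definition minus_L2 :: "L2 \<Rightarrow> L2 \<Rightarrow> L2" where "F - G = F + - (G :: L2)"

definition scaleR_L2 :: "real \<Rightarrow> L2 \<Rightarrow> L2" where "r *\<^sub>R F = scaleC (of_real r) F"

definition inner_L2 :: "L2 \<Rightarrow> L2 \<Rightarrow> real" where "F \<bullet> G = Re (cinner F G)"

definition norm_L2 :: "L2 \<Rightarrow> real" where "norm F = sqrt (F \<bullet> (F :: L2))"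

definition sgn_L2 :: "L2 \<Rightarrow> L2" where "sgn F = inverse (norm F) *\<^sub>R (F :: L2)"

definition dist_L2 :: "L2 \<Rightarrow> L2 \<Rightarrow> real" where "dist F G = norm (F - G :: L2)"

definition uniformity_L2 :: "(L2 \<times> L2) filter" where
  "uniformity_L2 = (INF e\<in>{0 <..}. principal {(F, G). dist F G < e})"

definition open_L2 :: "L2 set \<Rightarrow> bool" where
  "open_L2 U \<longleftrightarrow> (\<forall>F\<in>U. eventually (\<lambda>(F', G). F' = F \<longrightarrow> G \<in> U) uniformity)"

instance
proof
  fix F G H :: L2 and r q :: real
  show "F + G + H = F + (G + H)"
    by transfer (simp add: sq_integrable_add add.assoc)
  show "F + G = G + F"
    by transfer (simp add: sq_integrable_add add.commute)
  show "0 + F = F"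
    by transfer simp
  show "- F + F = 0"
    unfolding uminus_L2_def by transfer (simp add: sq_integrable_zero)
  show "F - G = F + - G"
    by (rule minus_L2_def)
  show "r *\<^sub>R (F + G) = r *\<^sub>R F + r *\<^sub>R G"
    unfolding scaleR_L2_def
    by transfer (simp add: sq_integrable_add sq_integrable_mult distrib_left)
  show "(r + q) *\<^sub>R F = r *\<^sub>R F + q *\<^sub>R F"
    unfolding scaleR_L2_def
  proof transfer
    fix r q :: real and f :: "real \<Rightarrow> complex"
    assume "sq_integrable f \<and> sq_integrable f \<and> (AE x in mult_haar. f x = f x)"
    then show "sq_integrable (\<lambda>x. of_real (r + q) * f x) \<and>
        sq_integrable (\<lambda>x. of_real r * f x + of_real q * f x) \<and>
        (AE x in mult_haar. of_real (r + q) * f x = of_real r * f x + of_real q * f x)"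
      using sq_integrable_mult[of f "of_real (r + q)"]
      by (simp add: distrib_right)
  qed
  show "r *\<^sub>R q *\<^sub>R F = (r * q) *\<^sub>R F"
    unfolding scaleR_L2_def
  proof transfer
    fix r q :: real and f :: "real \<Rightarrow> complex"
    assume "sq_integrable f \<and> sq_integrable f \<and> (AE x in mult_haar. f x = f x)"
    then show "sq_integrable (\<lambda>x. of_real r * (of_real q * f x)) \<and>
        sq_integrable (\<lambda>x. of_real (r * q) * f x) \<and>
        (AE x in mult_haar. of_real r * (of_real q * f x) = of_real (r * q) * f x)"
      using sq_integrable_mult[of f "of_real (r * q)"] by (simp add: mult.assoc)
  qed
  show "1 *\<^sub>R F = F"
    unfolding scaleR_L2_def by transfer simp
  show "F \<bullet> G = G \<bullet> F"
    unfolding inner_L2_def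
  proof transfer
    fix f g :: "real \<Rightarrow> complex"
    have "(\<integral>x. g x * cnj (f x) \<partial>mult_haar) = (\<integral>x. cnj (f x * cnj (g x)) \<partial>mult_haar)"
      by (simp add: mult.commute)
    also have "\<dots> = cnj (\<integral>x. f x * cnj (g x) \<partial>mult_haar)"
      by (rule Bochner_Integration.integral_cnj)
    finally show "Re (\<integral>x. f x * cnj (g x) \<partial>mult_haar) = Re (\<integral>x. g x * cnj (f x) \<partial>mult_haar)"
      by simp
  qed
  show "(F + G) \<bullet> H = F \<bullet> H + G \<bullet> H"
    unfolding inner_L2_def
    by transfer (simp add: distrib_right sq_integrable_mult_cnj)
  show "(r *\<^sub>R F) \<bullet> G = r * (F \<bullet> G)"
    unfolding inner_L2_def scaleR_L2_def
    by transfer (simp add: mult.assoc)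
  have sq: "f x * cnj (f x) = of_real ((cmod (f x))\<^sup>2)" for f :: "real \<Rightarrow> complex" and x
    using complex_norm_square[of "f x"] by simp
  show "0 \<le> F \<bullet> F"
    unfolding inner_L2_def by transfer (simp add: sq del: of_real_power)
  show "F \<bullet> F = 0 \<longleftrightarrow> F = 0"
    unfolding inner_L2_def
    by transfer
       (auto simp: sq sq_integrable_def integral_nonneg_eq_0_iff_AE simp del: of_real_power)
  show "norm F = sqrt (F \<bullet> F)"
    by (rule norm_L2_def)
  show "sgn F = inverse (norm F) *\<^sub>R F"
    by (rule sgn_L2_def)
  show "dist F G = norm (F - G)"
    by (rule dist_L2_def)
  show "uniformity = (INF e\<in>{0 <..}. principal {(F :: L2, G). dist F G < e})"
    by (rule uniformity_L2_def)
  show "open U \<longleftrightarrow> (\<forall>F\<in>U. \<forall>\<^sub>F (F', G) in uniformity. F' = F \<longrightarrow> G \<in> U)" for U :: "L2 set"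
    by (rule open_L2_def)
qed

end


subsection \<open>Representations of \<open>GL(2,\<real>)\<close> on this space\<close>

definition GL2 :: "(real^2^2) set" where "GL2 = {g. invertible g}"

definition mat2 :: "real \<Rightarrow> real \<Rightarrow> real \<Rightarrow> real \<Rightarrow> real^2^2" where
  "mat2 a b c d = vector [vector [a, b], vector [c, d]]"

text \<open>\<open>R\<close> is constrained on \<^const>\<open>GL2\<close> only. With \<^const>\<open>bounded_linear\<close> giving real linearity,
  the third clause makes each operator complex linear.\<close>

definition GL2_rep :: "(real^2^2 \<Rightarrow> L2 \<Rightarrow> L2) \<Rightarrow> bool" where
  "GL2_rep R \<longleftrightarrow>
     R (mat 1) = id \<and>
     (\<forall>g\<in>GL2. \<forall>h\<in>GL2. R (g ** h) = R g \<circ> R h) \<and>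
     (\<forall>g\<in>GL2. bounded_linear (R g) \<and> (\<forall>c F. R g (scaleC c F) = scaleC c (R g F)))"

definition strongly_continuous :: "(real^2^2 \<Rightarrow> L2 \<Rightarrow> L2) \<Rightarrow> bool" where
  "strongly_continuous R \<longleftrightarrow> (\<forall>F. continuous_on GL2 (\<lambda>g. R g F))"

definition complex_subspace :: "L2 set \<Rightarrow> bool" where
  "complex_subspace V \<longleftrightarrow>
     0 \<in> V \<and> (\<forall>F\<in>V. \<forall>G\<in>V. F + G \<in> V) \<and> (\<forall>c. \<forall>F\<in>V. scaleC c F \<in> V)"

definition irreducible_rep :: "(real^2^2 \<Rightarrow> L2 \<Rightarrow> L2) \<Rightarrow> bool" where
  "irreducible_rep R \<longleftrightarrow>
     (\<forall>V. complex_subspace V \<and> closed V \<and> (\<forall>g\<in>GL2. R g ` V \<subseteq> V) \<longrightarrow> V = {0} \<or> V = UNIV)"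

definition unitary_rep :: "(real^2^2 \<Rightarrow> L2 \<Rightarrow> L2) \<Rightarrow> bool" where
  "unitary_rep R \<longleftrightarrow>
     (\<forall>g\<in>GL2. surj (R g) \<and> (\<forall>F G. cinner (R g F) (R g G) = cinner F G))"


subsection \<open>The space \<open>\<K>\<^sub>d\<close> and the Bessel kernel\<close>

text \<open>\<open>D n\<close> is an \<open>n\<close>-th derivative of \<open>f\<close> on \<open>S\<close>, one-sided at boundary points of \<open>S\<close>.\<close>

definition iterated_derivs :: "real set \<Rightarrow> (real \<Rightarrow> complex) \<Rightarrow> (nat \<Rightarrow> real \<Rightarrow> complex) \<Rightarrow> bool" where
  "iterated_derivs S f D \<longleftrightarrow>
     (\<forall>x\<in>S. D 0 x = f x) \<and>
     (\<forall>n. \<forall>x\<in>S. (D n has_vector_derivative D (Suc n) x) (at x within S))"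

definition smooth_on :: "real set \<Rightarrow> (real \<Rightarrow> complex) \<Rightarrow> bool" where
  "smooth_on S f \<longleftrightarrow> (\<exists>D. iterated_derivs S f D)"

definition rapidly_decreasing :: "(real \<Rightarrow> complex) \<Rightarrow> bool" where
  "rapidly_decreasing f \<longleftrightarrow> (\<forall>N. ((\<lambda>x. of_real (x ^ N) * f x) \<longlongrightarrow> 0) at_infinity)"

text \<open>Elements of \<open>\<K>\<^sub>d\<close> are functions on \<open>\<real> - {0}\<close>; the value at \<open>0\<close> is unconstrained.\<close>

definition K_space :: "nat \<Rightarrow> (real \<Rightarrow> complex) set" where
  "K_space d = {f.
     (\<exists>D. iterated_derivs (- {0}) f D \<and> (\<forall>n. rapidly_decreasing (D n))) \<and>
     (\<exists>h. smooth_on {0..} h \<and>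
        (\<forall>x>0. h x = of_real (\<bar>x\<bar> powr (- (real d + 1) / 2)) * f x)) \<and>
     (\<exists>h. smooth_on {..0} h \<and>
        (\<forall>x<0. h x = of_real (\<bar>x\<bar> powr (- (real d + 1) / 2)) * f x))}"

definition Bessel_J :: "nat \<Rightarrow> real \<Rightarrow> real" where
  "Bessel_J d z = (\<Sum>k. (-1) ^ k / (fact k * fact (k + d)) * (z / 2) ^ (2 * k + d))"

definition j_kernel :: "nat \<Rightarrow> real \<Rightarrow> complex" where
  "j_kernel d x =
     (if x > 0 then \<i> powi (- (int d + 1)) * of_real (sqrt x * Bessel_J d (2 * sqrt x)) else 0)"


subsection \<open>The representation \<open>R\<close>\<close>

definition quasichar :: "complex \<Rightarrow> nat \<Rightarrow> real \<Rightarrow> complex" where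
  "quasichar s m t = of_real \<bar>t\<bar> powr s * of_real (sgn t ^ m)"

text \<open>\<open>\<omega>\<close> is the central character and \<open>e\<close> the exponent of the sign in the action of the Weyl
  element. As \<^term>\<open>R (mat2 0 (-1) 1 0)\<close> is bounded, prescribing it on \<open>\<K>\<^sub>d\<close>, which is dense,
  says that it is the extension to \<open>L\<^sup>2\<close> of the operator given by the integral.

  The customary exponent is \<open>e = m\<^sub>2 + d + 1\<close>. Writing \<open>w\<close> for the Weyl element, the relation
  \<open>w diag(-1,1) = (-I) diag(-1,1) w\<close> forces \<open>(-1)^e = \<omega>(-1) = (-1)^(d+1)\<close>, so this \<open>e\<close> is consistent
  only for even \<open>m\<^sub>2\<close>. The exponent \<open>e = d + 1\<close>, which is the same for \<open>m\<^sub>2 = 0\<close>, is consistent for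
  both parities; it gives the representation with \<open>m\<^sub>1, m\<^sub>2\<close> both shifted by one, which leaves
  \<open>\<omega>\<close> unchanged.\<close>

definition Bessel_rep ::
    "nat \<Rightarrow> (real \<Rightarrow> complex) \<Rightarrow> nat \<Rightarrow> (real^2^2 \<Rightarrow> L2 \<Rightarrow> L2) \<Rightarrow> bool" where
  "Bessel_rep d \<omega> e R \<longleftrightarrow>
     GL2_rep R \<and>
     (\<forall>F f. represents F f \<longrightarrow>
        (\<forall>y. represents (R (mat2 1 y 0 1) F) (\<lambda>x. exp (\<i> * of_real (y * x)) * f x)) \<and>
        (\<forall>a. a \<noteq> 0 \<longrightarrow>
           represents (R (mat2 a 0 0 1) F) (\<lambda>x. \<omega> (\<bar>a\<bar> powr (1 / 2)) * f (a * x))) \<and>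
        (\<forall>b. b \<noteq> 0 \<longrightarrow> represents (R (mat2 b 0 0 b) F) (\<lambda>x. \<omega> b * f x)) \<and>
        (f \<in> K_space d \<longrightarrow>
           represents (R (mat2 0 (-1) 1 0) F)
             (\<lambda>y. of_real (sgn y ^ e) * (\<integral>x. f x * j_kernel d (x * y) \<partial>mult_haar))))"

end

theory Submission
  imports Defs "HOL-Probability.Levy"
begin

text \<open>Put \<open>\<phi>\<^sub>z(x) = |x|\<^bsup>(d+1)/2\<^esup> e\<^bsup>izx\<^esup>\<close> on the half-line where this decays, for
  non-real \<open>z\<close>. On these coherent states the group acts by
  \<open>g \<phi>\<^sub>z = |det g|\<^bsup>(d+1)/2\<^esup> (cz + e)\<^bsup>-(d+1)\<^esup> \<phi>\<^bsub>gz\<^esub>\<close>, up to a factor given by the central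
  character; for the Weyl element this is the Laplace transform of the Bessel function. The inner products
  \<open>d! (\<mp>i(z - w*))\<^bsup>-(d+1)\<^esup>\<close> of coherent states, \<open>w*\<close> being the complex conjugate of \<open>w\<close>, are
  preserved, and coherent states are total because
  pairing with them is a Fourier transform. Hence the formula extends to isometries of the whole
  space; the group law is the cocycle identity, and strong continuity is continuity of the inner
  products. The operators on \<open>\<K>\<^sub>d\<close> are identified by pairing with coherent states. Irreducibility
  only uses the upper triangular matrices: if \<open>F\<close> lies in an invariant subspace orthogonal to \<open>G\<close>, then
  \<open>F(ax) G(x) = 0\<close> almost everywhere for all \<open>a\<close>.\<close>

subsection \<open>The Hilbert space\<close>

text \<open>Verifying the group relations or the unitarity of the Bessel integral on functions would
  amount to a Hankel inversion formula for an oscillating kernel. On coherent states both become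
  identities between rational functions: the factor in the transformation law is an automorphy
  factor of weight \<open>d + 1\<close>, and the inner products are the reproducing kernels of that
  weight on the two half-planes. The power \<open>(d + 1) / 2\<close> is the one prescribed at the
  origin in \<open>K_space\<close>, so coherent states belong to the domain on which the Weyl
  element is given, and their totality makes that prescription binding.

  The isometric action is independent of the characters; in it \<open>-1\<close> acts by
  \<open>(-1) ^ (d + 1)\<close>. The relation between the two characters says that
  \<open>\<omega>\<close> has just this parity, so the scalar factor
  \<open>\<omega> (sqrt \<bar>det g\<bar>)\<close> produces the required central character. The
  theorem speaks of all \<open>R\<close> that satisfy the formulas, not of one model. Its three
  properties are therefore transported from the model by a uniqueness argument, which rests on the
  Bruhat decomposition of the group.\<close>

lemma represents_class_L2: "sq_integrable f \<Longrightarrow> represents (class_L2 f) f"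
  by (simp add: represents_def)

lemma represents_sq_integrable: "represents F f \<Longrightarrow> sq_integrable f"
  by (simp add: represents_def)

lemma represents_ex: "\<exists>f. represents F f"
proof -
  have "sq_integrable (rep_L2 F)" "class_L2 (rep_L2 F) = F"
    using Quotient_rep_reflp[OF Quotient_L2, of F] Quotient_abs_rep[OF Quotient_L2, of F] by auto
  then show ?thesis by (auto simp: represents_def)
qed

lemma represents_eq_iff:
  assumes "represents F f" "represents G g"
  shows "F = G \<longleftrightarrow> (AE x in mult_haar. f x = g x)"
  using assms Quotient_rel[OF Quotient_L2, of f g] by (auto simp: represents_def)

text \<open>Square integrability of \<open>g\<close> is part of the conclusion, so a candidate for
  the value of an operator only has to be measurable and agree almost everywhere with some
  representative.\<close>

lemma represents_cong_AE:
  assumes "represents F f" "g \<in> borel_measurable borel" "AE x in mult_haar. f x = g x"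
  shows "represents F g"
proof -
  have "sq_integrable g"
    unfolding sq_integrable_def
  proof
    show "g \<in> borel_measurable mult_haar" using assms(2) by (simp cong: measurable_cong_sets)
    have "integrable mult_haar (\<lambda>x. (cmod (f x))\<^sup>2)" "f \<in> borel_measurable mult_haar"
      using assms(1) by (auto simp: represents_def sq_integrable_def)
    then show "integrable mult_haar (\<lambda>x. (cmod (g x))\<^sup>2)"
      using assms(3) \<open>g \<in> borel_measurable mult_haar\<close>
      by (subst integrable_cong_AE[where g = "\<lambda>x. (cmod (f x))\<^sup>2"]) auto
  qed
  then have "represents (class_L2 g) g" by (rule represents_class_L2)
  then show ?thesis using represents_eq_iff[OF assms(1)] assms(3) by metis
qed

lemma represents_zero: "represents 0 (\<lambda>_. 0)"
  using sq_integrable_zero by (simp add: represents_def zero_L2.abs_eq)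

lemma represents_add:
  "represents F f \<Longrightarrow> represents G g \<Longrightarrow> represents (F + G) (\<lambda>x. f x + g x)"
  by (auto simp: represents_def sq_integrable_add plus_L2.abs_eq)

lemma represents_scaleC: "represents F f \<Longrightarrow> represents (scaleC c F) (\<lambda>x. c * f x)"
  by (auto simp: represents_def sq_integrable_mult scaleC.abs_eq)

lemma represents_diff:
  "represents F f \<Longrightarrow> represents G g \<Longrightarrow> represents (F - G) (\<lambda>x. f x - g x)"
  using represents_add[of F f "scaleC (-1) G" "\<lambda>x. -1 * g x"] represents_scaleC[of G g "-1"]
  by (simp add: minus_L2_def uminus_L2_def)

lemma cinner_represents:
  "represents F f \<Longrightarrow> represents G g \<Longrightarrow> cinner F G = (\<integral>x. f x * cnj (g x) \<partial>mult_haar)"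
  by (auto simp: represents_def cinner.abs_eq)

lemma cinner_commute: "cinner F G = cnj (cinner G F)"
proof transfer
  fix f g :: "real \<Rightarrow> complex"
  show "(\<integral>x. f x * cnj (g x) \<partial>mult_haar) = cnj (\<integral>x. g x * cnj (f x) \<partial>mult_haar)"
    by (subst Bochner_Integration.integral_cnj[symmetric]) (simp add: mult.commute)
qed

lemma cinner_scaleC_left: "cinner (scaleC c F) G = c * cinner F G"
  by transfer (simp add: mult.assoc)

lemma cinner_scaleC_right: "cinner F (scaleC c G) = cnj c * cinner F G"
  by (metis cinner_commute cinner_scaleC_left complex_cnj_mult)

lemma scaleC_scaleC [simp]: "scaleC a (scaleC b F) = scaleC (a * b) F"
proof -
  obtain f where "represents F f" using represents_ex by blast
  then show ?thesis
    using represents_eq_iff[OF represents_scaleC[OF represents_scaleC] represents_scaleC, of F f F f]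
    by (simp add: mult.assoc)
qed

lemma scaleC_one [simp]: "scaleC 1 F = F"
  using scaleR_one[of F] by (simp add: scaleR_L2_def)

lemma scaleC_add_right: "scaleC c (F + G) = scaleC c F + scaleC c G"
proof -
  obtain f g where "represents F f" "represents G g" using represents_ex by metis
  note * = represents_scaleC[OF represents_add[OF this], of c]
    represents_add[OF this[THEN represents_scaleC[of _ _ c]]]
  show ?thesis using represents_eq_iff[OF *] by (simp add: distrib_left)
qed

lemma scaleC_add_left: "scaleC (a + b) F = scaleC a F + scaleC b F"
proof -
  obtain f where f: "represents F f" using represents_ex by metis
  note * = represents_scaleC[OF f, of "a + b"]
    represents_add[OF represents_scaleC[OF f, of a] represents_scaleC[OF f, of b]]
  show ?thesis using represents_eq_iff[OF *] by (simp add: distrib_right)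
qed

lemma inner_scaleC_commute: "scaleC c F \<bullet> G = F \<bullet> scaleC (cnj c) G"
  by (simp add: inner_L2_def cinner_scaleC_left cinner_scaleC_right)

lemma cinner_self: "cinner F F = of_real ((norm F)\<^sup>2)"
proof -
  have "cnj (cinner F F) = cinner F F" using cinner_commute[of F F] by simp
  then have "cinner F F = of_real (F \<bullet> F)"
    by (simp add: complex_eq_iff inner_L2_def)
  then show ?thesis by (simp add: power2_norm_eq_inner)
qed

text \<open>The type class instance supplies the real inner product only. Conjugate linearity in the
  second argument turns \<open>\<i>\<close> into \<open>- \<i>\<close>, and the real part of
  \<open>- \<i> * c\<close> is the imaginary part of \<open>c\<close>; this lets real Hilbert space
  arguments yield complex conclusions.\<close>

lemma cinner_eq_inner: "cinner F G = Complex (F \<bullet> G) (F \<bullet> scaleC \<i> G)"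
  by (simp add: complex_eq_iff inner_L2_def cinner_scaleC_right)

lemma norm_scaleC: "norm (scaleC c F) = cmod c * norm F"
proof -
  have "of_real ((norm (scaleC c F))\<^sup>2) = (of_real ((cmod c * norm F)\<^sup>2) :: complex)"
    unfolding cinner_self[symmetric] cinner_scaleC_left cinner_scaleC_right
    using complex_norm_square[of c] by (simp add: cinner_self power_mult_distrib mult_ac)
  then have "(norm (scaleC c F))\<^sup>2 = (cmod c * norm F)\<^sup>2"
    using of_real_eq_iff by blast
  then show ?thesis
    by (simp add: power2_eq_iff_nonneg)
qed

lemma bounded_linear_scaleC: "bounded_linear (scaleC c)"
proof (rule bounded_linear_intro)
  fix F G :: L2 and r :: real
  show "scaleC c (F + G) = scaleC c F + scaleC c G" by (rule scaleC_add_right)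
  show "scaleC c (r *\<^sub>R F) = r *\<^sub>R scaleC c F"
    by (simp add: scaleR_L2_def mult.commute)
  show "norm (scaleC c F) \<le> norm F * cmod c" by (simp add: norm_scaleC mult.commute)
qed

lemma continuous_on_scaleC [continuous_intros]:
  assumes "continuous_on S f" "continuous_on S g"
  shows "continuous_on S (\<lambda>x. scaleC (f x) (g x))"
proof -
  have "bounded_bilinear scaleC"
  proof
    fix c c' :: complex and F G :: L2 and r :: real
    show "scaleC (c + c') F = scaleC c F + scaleC c' F" by (rule scaleC_add_left)
    show "scaleC c (F + G) = scaleC c F + scaleC c G" by (rule scaleC_add_right)
    show "scaleC (r *\<^sub>R c) F = r *\<^sub>R scaleC c F"
      by (simp add: scaleR_L2_def scaleR_conv_of_real)
    show "scaleC c (r *\<^sub>R F) = r *\<^sub>R scaleC c F"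
      by (simp add: scaleR_L2_def mult.commute)
    show "\<exists>K. \<forall>c F. norm (scaleC c F) \<le> norm c * norm F * K"
      by (rule exI[of _ 1]) (simp add: norm_scaleC)
  qed
  from bounded_bilinear.continuous_on[OF this assms] show ?thesis .
qed

lemma norm_represents: "represents F f \<Longrightarrow> (norm F)\<^sup>2 = (\<integral>x. (cmod (f x))\<^sup>2 \<partial>mult_haar)"
proof -
  assume f: "represents F f"
  have "complex_of_real ((norm F)\<^sup>2) = (\<integral>x. f x * cnj (f x) \<partial>mult_haar)"
    using cinner_represents[OF f f] by (simp add: cinner_self)
  also have "\<dots> = (\<integral>x. of_real ((cmod (f x))\<^sup>2) \<partial>mult_haar)"
    by (simp only: complex_norm_square)
  finally show ?thesis by (metis integral_complex_of_real of_real_eq_iff)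
qed

text \<open>Projection theorem: \<open>y\<close> is \<open>x - l\<close>, where \<open>x\<close> is
  a point outside \<open>V\<close> and \<open>l\<close> its nearest point in \<open>V\<close>,
  obtained as the limit of a minimising sequence.\<close>

lemma exists_orthogonal_vector:
  fixes V :: "'a::{real_inner,complete_space} set"
  assumes V: "subspace V" "closed V" "V \<noteq> UNIV"
  shows "\<exists>y. y \<noteq> 0 \<and> (\<forall>v\<in>V. v \<bullet> y = 0)"
proof -
  obtain x where x: "x \<notin> V" using V(3) by auto
  define I where "I = (INF v\<in>V. (norm (x - v))\<^sup>2)"
  have ne: "V \<noteq> {}" using subspace_0[OF V(1)] by auto
  have bdd: "bdd_below ((\<lambda>v. (norm (x - v))\<^sup>2) ` V)" by (rule bdd_belowI2[where m = 0]) simp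
  have I_le: "I \<le> (norm (x - v))\<^sup>2" if "v \<in> V" for v
    unfolding I_def using bdd that by (rule cINF_lower)
  have "\<exists>v\<in>V. (norm (x - v))\<^sup>2 < I + inverse (real (Suc n))" for n
    using cINF_less_iff[OF ne bdd, of "I + inverse (real (Suc n))"] unfolding I_def by simp
  then obtain v where v: "\<And>n. v n \<in> V" "\<And>n. (norm (x - v n))\<^sup>2 < I + inverse (real (Suc n))"
    by metis
  \<comment> \<open>Parallelogram law for \<open>x - v m\<close> and \<open>x - v n\<close>: the
    midpoint of \<open>v m\<close> and \<open>v n\<close> lies in \<open>V\<close>, so its squared
    distance from \<open>x\<close> is at least \<open>I\<close>.\<close>
  have dist_v: "(norm (v m - v n))\<^sup>2 \<le> 2 * inverse (real (Suc m)) + 2 * inverse (real (Suc n))" for m n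
  proof -
    have "(1/2) *\<^sub>R (v m + v n) \<in> V"
      using V(1) v(1) by (intro subspace_scale subspace_add)
    from I_le[OF this] have "4 * I \<le> (norm (2 *\<^sub>R (x - (1/2) *\<^sub>R (v m + v n))))\<^sup>2"
      by (simp add: power_mult_distrib)
    also have "2 *\<^sub>R (x - (1/2) *\<^sub>R (v m + v n)) = (x - v m) + (x - v n)"
      by (simp add: algebra_simps scaleR_2)
    finally have "4 * I \<le> (norm ((x - v m) + (x - v n)))\<^sup>2" .
    moreover have "(norm ((x - v m) + (x - v n)))\<^sup>2 + (norm (v m - v n))\<^sup>2
        = 2 * (norm (x - v m))\<^sup>2 + 2 * (norm (x - v n))\<^sup>2"
      by (simp add: power2_norm_eq_inner inner_diff_left inner_diff_right inner_add_left
          inner_add_right inner_commute algebra_simps)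
    ultimately show ?thesis using v(2)[of m] v(2)[of n] by linarith
  qed
  have "Cauchy v"
  proof (rule metric_CauchyI)
    fix e :: real assume e: "e > 0"
    obtain N where N: "inverse (real (Suc N)) < e\<^sup>2 / 4"
      using reals_Archimedean[of "e\<^sup>2 / 4"] e by auto
    have "dist (v m) (v n) < e" if "m \<ge> N" "n \<ge> N" for m n
    proof -
      have "inverse (real (Suc m)) \<le> inverse (real (Suc N))" "inverse (real (Suc n)) \<le> inverse (real (Suc N))"
        using that by (auto intro!: le_imp_inverse_le)
      then have "(norm (v m - v n))\<^sup>2 < e\<^sup>2" using dist_v[of m n] N by linarith
      then show ?thesis using e by (simp add: dist_norm power2_less_imp_less)
    qed
    then show "\<exists>M. \<forall>m\<ge>M. \<forall>n\<ge>M. dist (v m) (v n) < e" by blast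
  qed
  then obtain l where l: "v \<longlonglongrightarrow> l" using Cauchy_convergent convergentD by blast
  have lV: "l \<in> V" using V(2) v(1) l closed_sequentially by blast
  have "(\<lambda>n. (norm (x - v n))\<^sup>2) \<longlonglongrightarrow> (norm (x - l))\<^sup>2"
    by (intro tendsto_intros l)
  moreover have "(\<lambda>n. I + inverse (real (Suc n))) \<longlonglongrightarrow> I + 0"
    by (intro tendsto_intros LIMSEQ_inverse_real_of_nat)
  ultimately have le_I: "(norm (x - l))\<^sup>2 \<le> I"
    using LIMSEQ_le[of "\<lambda>n. (norm (x - v n))\<^sup>2" _ "\<lambda>n. I + inverse (real (Suc n))" I] v(2)
    by (auto intro: less_imp_le)
  have "w \<bullet> (x - l) = 0" if w: "w \<in> V" for w
  proof (cases "w = 0")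
    case False
    \<comment> \<open>The coefficient of the projection of \<open>x - l\<close> to the line through
      \<open>w\<close>; moving \<open>l\<close> by \<open>t *\<^sub>R w\<close> would shorten the
      distance unless \<open>t = 0\<close>.\<close>
    define t where "t = (w \<bullet> (x - l)) / (w \<bullet> w)"
    have "l + t *\<^sub>R w \<in> V" using V(1) lV w by (intro subspace_add subspace_scale)
    from I_le[OF this] le_I have "(norm (x - l))\<^sup>2 \<le> (norm ((x - l) - t *\<^sub>R w))\<^sup>2"
      by (metis diff_diff_add order_trans)
    also have "\<dots> = (norm (x - l))\<^sup>2 - 2 * t * (w \<bullet> (x - l)) + t\<^sup>2 * (w \<bullet> w)"
      unfolding power2_norm_eq_inner
      by (simp add: inner_diff_left inner_diff_right inner_commute power2_eq_square algebra_simps)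
    finally have "2 * t * (w \<bullet> (x - l)) \<le> t\<^sup>2 * (w \<bullet> w)" by linarith
    moreover have "w \<bullet> (x - l) = t * (w \<bullet> w)" using False by (simp add: t_def)
    ultimately have "t\<^sup>2 * (w \<bullet> w) \<le> 0" by (simp add: power2_eq_square)
    moreover have "w \<bullet> w > 0" using False by simp
    ultimately have "t = 0" by (simp add: mult_le_0_iff)
    then show ?thesis using \<open>w \<bullet> (x - l) = t * (w \<bullet> w)\<close> by simp
  qed simp
  moreover have "x - l \<noteq> 0" using x lV by auto
  ultimately show ?thesis by blast
qed

section \<open>Completeness (Riesz-Fischer)\<close>

lemma nn_integral_represents:
  assumes "represents F f"
  shows "(\<integral>\<^sup>+x. ennreal ((cmod (f x))\<^sup>2) \<partial>mult_haar) = ennreal ((norm F)\<^sup>2)"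
  unfolding norm_represents[OF assms]
  using assms by (intro nn_integral_eq_integral) (auto simp: represents_def sq_integrable_def)

lemma sq_integrableI_nn:
  assumes [measurable]: "f \<in> borel_measurable mult_haar"
    and "(\<integral>\<^sup>+x. ennreal ((cmod (f x))\<^sup>2) \<partial>mult_haar) < \<infinity>"
  shows "sq_integrable f"
  unfolding sq_integrable_def using assms by (auto intro!: integrableI_nonneg)

text \<open>Along a subsequence whose increments have norm below \<open>4\<^sup>-\<^sup>n\<close>, the sum of
  \<open>4\<^sup>n |f\<^sub>n\<^sub>+\<^sub>1 - f\<^sub>n|\<^sup>2\<close> is integrable, which forces pointwise convergence almost everywhere.\<close>

lemma L2_convergent_of_fast_Cauchy:
  fixes X :: "nat \<Rightarrow> L2"
  assumes fast: "\<And>n. norm (X (Suc n) - X n) \<le> (1/4) ^ n" and C: "Cauchy X"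
  shows "\<exists>L. X \<longlonglongrightarrow> L"
proof -
  have "\<forall>n. \<exists>f. represents (X n) f" using represents_ex by blast
  then obtain f where f: "\<And>n. represents (X n) (f n)" by metis
  have meas [measurable]: "f n \<in> borel_measurable mult_haar" for n
    using f by (auto simp: represents_def sq_integrable_def)
  define g where "g n x = (cmod (f (Suc n) x - f n x))\<^sup>2" for n x
  have [measurable]: "g n \<in> borel_measurable mult_haar" for n
    unfolding g_def by measurable
  \<comment> \<open>The weight \<open>4 ^ n\<close> consumes only half of the decay, since the
    squared norm is at most \<open>(1/16) ^ n\<close>; what remains is still summable.\<close>
  have int_g: "(\<integral>\<^sup>+x. ennreal (4 ^ n * g n x) \<partial>mult_haar) \<le> ennreal ((1/4) ^ n)" for n
  proof -
    have "(\<integral>\<^sup>+x. ennreal (4 ^ n * g n x) \<partial>mult_haar) = ennreal (4 ^ n) * ennreal ((norm (X (Suc n) - X n))\<^sup>2)"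
      unfolding nn_integral_represents[OF represents_diff[OF f f], symmetric]
      by (subst nn_integral_cmult[symmetric]) (auto simp: g_def ennreal_mult)
    also have "\<dots> = ennreal (4 ^ n * (norm (X (Suc n) - X n))\<^sup>2)"
      by (simp add: ennreal_mult)
    also have "4 ^ n * (norm (X (Suc n) - X n))\<^sup>2 \<le> 4 ^ n * ((1/4) ^ n)\<^sup>2"
      by (intro mult_left_mono power_mono fast) auto
    also have "\<dots> = (1/4) ^ n" by (simp add: power2_eq_square field_simps)
    finally show ?thesis by (simp add: ennreal_leI)
  qed
  have "(\<integral>\<^sup>+x. (\<Sum>n. ennreal (4 ^ n * g n x)) \<partial>mult_haar) = (\<Sum>n. \<integral>\<^sup>+x. ennreal (4 ^ n * g n x) \<partial>mult_haar)"
    by (rule nn_integral_suminf) measurable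
  also have "\<dots> \<le> (\<Sum>n. ennreal ((1/4) ^ n))"
    by (intro suminf_le int_g) auto
  also have "\<dots> = ennreal (\<Sum>n. (1/4) ^ n)"
    by (rule suminf_ennreal2) (auto intro: summable_geometric)
  also have "\<dots> < \<infinity>" by simp
  finally have "AE x in mult_haar. (\<Sum>n. ennreal (4 ^ n * g n x)) \<noteq> \<infinity>"
    by (intro nn_integral_PInf_AE) (auto simp: less_top[symmetric])
  then have AE_conv: "AE x in mult_haar. convergent (\<lambda>n. f n x)"
  proof eventually_elim
    case (elim x)
    obtain c where c: "(\<Sum>n. ennreal (4 ^ n * g n x)) = ennreal c" "c \<ge> 0"
      using elim by (cases "\<Sum>n. ennreal (4 ^ n * g n x)") auto
    \<comment> \<open>Each term of the finite sum of nonnegative terms is at most \<open>c\<close>;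
      its square root gives increments dominated by a geometric series.\<close>
    have "norm (f (Suc n) x - f n x) \<le> sqrt c * (1/2) ^ n" for n
    proof -
      have "(\<Sum>i\<in>{n}. ennreal (4 ^ i * g i x)) \<le> (\<Sum>n. ennreal (4 ^ n * g n x))"
        by (rule sum_le_suminf) auto
      then have "4 ^ n * g n x \<le> c" using c by simp
      then have "(2 ^ n * cmod (f (Suc n) x - f n x))\<^sup>2 \<le> c"
        by (simp add: g_def power_mult_distrib power2_eq_square[of "2^n"] power_mult_distrib[symmetric])
      then have "2 ^ n * cmod (f (Suc n) x - f n x) \<le> sqrt c"
        by (rule real_le_rsqrt)
      then show ?thesis by (simp add: field_simps power_one_over)
    qed
    then have "summable (\<lambda>n. f (Suc n) x - f n x)"
      by (rule summable_comparison_test'[where N = 0, OF summable_mult[OF summable_geometric], rotated]) auto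
    then have "(\<lambda>n. \<Sum>i<n. f (Suc i) x - f i x) \<longlonglongrightarrow> (\<Sum>n. f (Suc n) x - f n x)"
      by (rule summable_LIMSEQ)
    then have "(\<lambda>n. f n x - f 0 x) \<longlonglongrightarrow> (\<Sum>n. f (Suc n) x - f n x)"
      by (simp add: sum_lessThan_telescope[of "\<lambda>i. f i x"])
    from tendsto_add[OF this tendsto_const[of "f 0 x"]] show "convergent (\<lambda>n. f n x)"
      by (auto simp: convergent_def)
  qed
  define h where "h x = lim (\<lambda>n. f n x)" for x
  have h_meas [measurable]: "h \<in> borel_measurable mult_haar"
    unfolding h_def by (rule borel_measurable_lim_metric) measurable
  have AE_lim: "AE x in mult_haar. (\<lambda>n. f n x) \<longlonglongrightarrow> h x"
    using AE_conv by eventually_elim (simp add: h_def convergent_LIMSEQ_iff)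
  \<comment> \<open>Fatou's lemma serves twice: with \<open>e = 1\<close> it shows that the
    pointwise limit is square-integrable, with small \<open>e\<close> that it is the limit in
    norm.\<close>
  have fatou: "(\<integral>\<^sup>+x. ennreal ((cmod (h x - f n x))\<^sup>2) \<partial>mult_haar) \<le> ennreal (e\<^sup>2)"
    if "\<And>m. m \<ge> n \<Longrightarrow> norm (X m - X n) \<le> e" for n e
  proof -
    have "(\<integral>\<^sup>+x. ennreal ((cmod (h x - f n x))\<^sup>2) \<partial>mult_haar)
        = (\<integral>\<^sup>+x. liminf (\<lambda>m. ennreal ((cmod (f m x - f n x))\<^sup>2)) \<partial>mult_haar)"
    proof (rule nn_integral_cong_AE, use AE_lim in eventually_elim)
      case (elim x)
      have "(\<lambda>m. ennreal ((cmod (f m x - f n x))\<^sup>2)) \<longlonglongrightarrow> ennreal ((cmod (h x - f n x))\<^sup>2)"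
        by (intro tendsto_intros tendsto_ennrealI elim)
      then show ?case by (intro lim_imp_Liminf[symmetric]) auto
    qed
    also have "\<dots> \<le> liminf (\<lambda>m. \<integral>\<^sup>+x. ennreal ((cmod (f m x - f n x))\<^sup>2) \<partial>mult_haar)"
      by (rule nn_integral_liminf) measurable
    also have "\<dots> = liminf (\<lambda>m. ennreal ((norm (X m - X n))\<^sup>2))"
      by (simp only: nn_integral_represents[OF represents_diff[OF f f]])
    also have "\<dots> \<le> liminf (\<lambda>m. ennreal (e\<^sup>2))"
      using that by (intro Liminf_mono eventually_sequentiallyI[of n]) (auto intro!: ennreal_leI power_mono)
    also have "\<dots> = ennreal (e\<^sup>2)" by (simp add: Liminf_const)
    finally show ?thesis .
  qed
  have tail: "\<exists>N. \<forall>n\<ge>N. \<forall>m\<ge>n. norm (X m - X n) \<le> e" if "e > 0" for e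
    using metric_CauchyD[OF C that] by (metis dist_norm less_imp_le order_trans)
  obtain N where "\<forall>n\<ge>N. \<forall>m\<ge>n. norm (X m - X n) \<le> 1" using tail[of 1] by auto
  then have "sq_integrable (\<lambda>x. h x - f N x)"
    using fatou[of N 1] by (intro sq_integrableI_nn) (auto intro: le_less_trans)
  from sq_integrable_add[OF this represents_sq_integrable[OF f[of N]]]
  have h: "represents (class_L2 h) h" by (intro represents_class_L2) simp
  have "X \<longlonglongrightarrow> class_L2 h"
  proof (rule LIMSEQ_I)
    fix r :: real assume "r > 0"
    then obtain N where N: "\<forall>n\<ge>N. \<forall>m\<ge>n. norm (X m - X n) \<le> r / 2" using tail[of "r/2"] by auto
    have "norm (X n - class_L2 h) < r" if "n \<ge> N" for n
    proof -
      have "ennreal ((norm (class_L2 h - X n))\<^sup>2) \<le> ennreal ((r/2)\<^sup>2)"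
        using fatou[of n "r/2"] N that
        unfolding nn_integral_represents[OF represents_diff[OF h f], symmetric] by simp
      then have "(norm (class_L2 h - X n))\<^sup>2 \<le> (r/2)\<^sup>2" by (subst (asm) ennreal_le_iff) simp_all
      then have "norm (class_L2 h - X n) \<le> r / 2"
        by (rule power2_le_imp_le) (use \<open>r > 0\<close> in simp)
      then show ?thesis using \<open>r > 0\<close> by (simp add: norm_minus_commute)
    qed
    then show "\<exists>no. \<forall>n\<ge>no. norm (X n - class_L2 h) < r" by blast
  qed
  then show ?thesis by blast
qed

instance L2 :: complete_space
proof
  fix X :: "nat \<Rightarrow> L2" assume X: "Cauchy X"
  have "\<exists>N. \<forall>m\<ge>N. \<forall>k\<ge>N. norm (X m - X k) \<le> (1/4) ^ n" for n :: nat
    using metric_CauchyD[OF X, of "(1/4)^n"] by (auto simp: dist_norm intro: less_imp_le)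
  then obtain N where N: "\<And>n m k. m \<ge> N n \<Longrightarrow> k \<ge> N n \<Longrightarrow> norm (X m - X k) \<le> (1/4) ^ n" by metis
  define r where "r = rec_nat (N 0) (\<lambda>n k. max (Suc k) (N (Suc n)))"
  have r: "r (Suc n) > r n" "r n \<ge> N n" for n
    by (simp add: r_def) (cases n; simp add: r_def)
  then have mono: "strict_mono r" by (simp add: strict_mono_Suc_iff)
  have "norm ((X \<circ> r) (Suc n) - (X \<circ> r) n) \<le> (1/4) ^ n" for n
    using N[of n "r (Suc n)" "r n"] r(2)[of n] r(1)[of n] by simp
  moreover have "Cauchy (X \<circ> r)" using X mono by (rule Cauchy_subseq_Cauchy)
  ultimately obtain L where "(X \<circ> r) \<longlonglongrightarrow> L"
    using L2_convergent_of_fast_Cauchy by blast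
  then show "convergent X"
    using Cauchy_converges_subseq[OF X mono] by (auto simp: convergent_def)
qed

section \<open>Total families and the operators they determine\<close>

lemma subspace_closure:
  fixes S :: "'a::real_normed_vector set"
  assumes "subspace S"
  shows "subspace (closure S)"
  unfolding subspace_def
proof (intro conjI ballI allI)
  show "0 \<in> closure S" using assms subspace_0 closure_subset by blast
next
  fix x y assume "x \<in> closure S" "y \<in> closure S"
  then obtain f g where "\<And>n. f n \<in> S" "f \<longlonglongrightarrow> x" "\<And>n. g n \<in> S" "g \<longlonglongrightarrow> y"
    unfolding closure_sequential by blast
  then show "x + y \<in> closure S"
    unfolding closure_sequential using subspace_add[OF assms]
    by (intro exI[of _ "\<lambda>n. f n + g n"]) (simp add: tendsto_add)
next
  fix x and c :: real assume "x \<in> closure S"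
  then obtain f where "\<And>n. f n \<in> S" "f \<longlonglongrightarrow> x"
    unfolding closure_sequential by blast
  then show "c *\<^sub>R x \<in> closure S"
    unfolding closure_sequential using subspace_scale[OF assms]
    by (intro exI[of _ "\<lambda>n. c *\<^sub>R f n"]) (simp add: tendsto_scaleR)
qed

text \<open>A proper \<open>V\<close> would have a nonzero orthogonal vector, which totality rules
  out. \<open>V\<close> is a real subspace; complex multiples are asked for on the family alone, and
  pairing with both \<open>\<Phi> z\<close> and \<open>scaleC \<i> (\<Phi> z)\<close> upgrades real
  to complex orthogonality.\<close>

lemma total_closed_subspace:
  assumes total: "\<And>F. (\<And>z. z \<in> A \<Longrightarrow> cinner F (\<Phi> z) = 0) \<Longrightarrow> F = 0"
    and V: "subspace V" "closed V" "\<And>c z. z \<in> A \<Longrightarrow> scaleC c (\<Phi> z) \<in> V"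
  shows "V = UNIV"
proof (rule ccontr)
  assume "V \<noteq> UNIV"
  then obtain y where y: "y \<noteq> 0" "\<And>v. v \<in> V \<Longrightarrow> v \<bullet> y = 0"
    using exists_orthogonal_vector[OF V(1,2)] by blast
  have "cinner y (\<Phi> z) = 0" if "z \<in> A" for z
    using y(2)[OF V(3)[OF that, of 1]] y(2)[OF V(3)[OF that, of \<i>]]
    by (simp add: cinner_eq_inner inner_commute complex_eq_iff)
  then have "y = 0" by (rule total)
  with y show False by simp
qed

lemma bounded_clinear_eq_on_total:
  assumes total: "\<And>F. (\<And>z. z \<in> A \<Longrightarrow> cinner F (\<Phi> z) = 0) \<Longrightarrow> F = 0"
    and S: "bounded_linear S" "\<And>c F. S (scaleC c F) = scaleC c (S F)"
    and T: "bounded_linear T" "\<And>c F. T (scaleC c F) = scaleC c (T F)"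
    and eq: "\<And>z. z \<in> A \<Longrightarrow> S (\<Phi> z) = T (\<Phi> z)"
  shows "S = T"
proof -
  have "{F. S F = T F} = UNIV"
  proof (rule total_closed_subspace[OF total])
    show "subspace {F. S F = T F}"
      using S(1) T(1) by (auto simp: subspace_def linear_simps bounded_linear.linear)
    show "closed {F. S F = T F}"
      using S(1) T(1) by (intro closed_Collect_eq) (auto intro: linear_continuous_on)
    show "scaleC c (\<Phi> z) \<in> {F. S F = T F}" if "z \<in> A" for c z
      using S(2) T(2) eq[OF that] by simp
  qed auto
  then show ?thesis by (auto simp: fun_eq_iff)
qed

text \<open>The operator is read off from its graph: on the closed span of the prescribed pairs both
  components have equal norm, so the graph is single-valued and its domain is closed.\<close>

lemma isometric_extension:
  fixes \<Phi> \<Psi> :: "'i \<Rightarrow> L2"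
  assumes total: "\<And>F. (\<And>z. z \<in> A \<Longrightarrow> cinner F (\<Phi> z) = 0) \<Longrightarrow> F = 0"
    and iso: "\<And>z w. z \<in> A \<Longrightarrow> w \<in> A \<Longrightarrow> cinner (\<Psi> z) (\<Psi> w) = cinner (\<Phi> z) (\<Phi> w)"
  shows "\<exists>T. bounded_linear T \<and> (\<forall>c F. T (scaleC c F) = scaleC c (T F)) \<and>
    (\<forall>F G. cinner (T F) (T G) = cinner F G) \<and> (\<forall>z\<in>A. T (\<Phi> z) = \<Psi> z)"
proof -
  define B where "B = {(scaleC c (\<Phi> z), scaleC c (\<Psi> z)) | c z. z \<in> A}"
  \<comment> \<open>Complex scalars act on both components of a pair at once. This preserves
    \<open>B\<close> and hence its closed span, which is what makes the operator complex
    linear.\<close>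
  define m where "m c p = (scaleC c (fst p), scaleC c (snd p))" for c and p :: "L2 \<times> L2"
  have m_bl: "bounded_linear (m c)" for c
    unfolding m_def
    by (intro bounded_linear_Pair bounded_linear_compose[OF bounded_linear_scaleC]
        bounded_linear_fst bounded_linear_snd)
  define \<Gamma> where "\<Gamma> = closure (span B)"
  have sub: "subspace \<Gamma>" unfolding \<Gamma>_def by (intro subspace_closure subspace_span)
  have "m c ` B \<subseteq> B" for c unfolding m_def B_def by fastforce
  then have "m c ` span B \<subseteq> span B" for c
    using linear_span_image[OF bounded_linear.linear[OF m_bl]] span_mono by metis
  then have "m c ` \<Gamma> \<subseteq> \<Gamma>" for c
    unfolding \<Gamma>_def
    by (intro image_closure_subset linear_continuous_on m_bl closed_closure)
      (meson closure_subset order_trans)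
  then have \<Gamma>_scaleC: "(scaleC c a, scaleC c b) \<in> \<Gamma>" if "(a, b) \<in> \<Gamma>" for a b c
    using that by (force simp: m_def)
  have 1: "fst p \<bullet> fst q = snd p \<bullet> snd q" if "p \<in> B" "q \<in> B" for p q
    using that iso by (auto simp: B_def inner_L2_def cinner_scaleC_left cinner_scaleC_right)
  \<comment> \<open>Real bilinearity extends the equality of inner products from \<open>B\<close> to
    its span in one argument at a time.\<close>
  have 2: "fst p \<bullet> fst q = snd p \<bullet> snd q" if "p \<in> span B" "q \<in> B" for p q
    using that(1)
    by (induction rule: span_induct)
      (use 1 that(2) in \<open>auto simp: subspace_def inner_add_left\<close>)
  have 3: "fst p \<bullet> fst q = snd p \<bullet> snd q" if "p \<in> span B" "q \<in> span B" for p q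
    using that(2)
    by (induction rule: span_induct)
      (use 2 that(1) in \<open>auto simp: subspace_def inner_add_right\<close>)
  have "\<Gamma> \<subseteq> {p. norm (fst p) = norm (snd p)}"
    unfolding \<Gamma>_def
  proof (rule closure_minimal)
    show "span B \<subseteq> {p. norm (fst p) = norm (snd p)}"
      using 3 by (auto simp: norm_eq_sqrt_inner)
    show "closed {p :: L2 \<times> L2. norm (fst p) = norm (snd p)}"
      by (intro closed_Collect_eq continuous_intros)
  qed
  then have norm_eq: "norm a = norm b" if "(a, b) \<in> \<Gamma>" for a b using that by auto
  have diff: "(a - a', b - b') \<in> \<Gamma>" if "(a, b) \<in> \<Gamma>" "(a', b') \<in> \<Gamma>" for a b a' b'
    using subspace_diff[OF sub that] by simp
  have single: "b = b'" if "(a, b) \<in> \<Gamma>" "(a, b') \<in> \<Gamma>" for a b b'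
    using norm_eq[OF diff[OF that]] by simp
  have B_in: "(scaleC c (\<Phi> z), scaleC c (\<Psi> z)) \<in> \<Gamma>" if "z \<in> A" for c z
    unfolding \<Gamma>_def using that
    by (intro subsetD[OF closure_subset] span_base) (auto simp: B_def)
  have "fst ` \<Gamma> = UNIV"
  proof (rule total_closed_subspace[OF total])
    show "subspace (fst ` \<Gamma>)"
      using sub by (intro linear_subspace_image linear_fst)
    show "closed (fst ` \<Gamma>)"
      unfolding closed_sequential_limits
    proof (intro allI impI)
      fix a l assume a: "(\<forall>n. a n \<in> fst ` \<Gamma>) \<and> a \<longlonglongrightarrow> l"
      then have "\<forall>n. \<exists>b. (a n, b) \<in> \<Gamma>" by force
      then obtain b where b: "\<And>n. (a n, b n) \<in> \<Gamma>" by metis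
      have "dist (b m) (b n) = dist (a m) (a n)" for m n
        using norm_eq[OF diff[OF b b]] by (simp add: dist_norm)
      then have "Cauchy b"
        using a LIMSEQ_imp_Cauchy[of a l] by (simp add: Cauchy_def)
      then obtain b' where "b \<longlonglongrightarrow> b'" using Cauchy_convergent convergentD by blast
      then have "(\<lambda>n. (a n, b n)) \<longlonglongrightarrow> (l, b')" using a by (intro tendsto_Pair) auto
      then have "(l, b') \<in> \<Gamma>"
        unfolding \<Gamma>_def
        by (rule closed_sequentially[OF closed_closure, rotated]) (use b \<Gamma>_def in blast)
      then show "l \<in> fst ` \<Gamma>" by force
    qed
    show "scaleC c (\<Phi> z) \<in> fst ` \<Gamma>" if "z \<in> A" for c z
      using B_in[OF that] by force
  qed auto
  then have "\<forall>a. \<exists>b. (a, b) \<in> \<Gamma>" by force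
  then obtain T where T: "\<And>a. (a, T a) \<in> \<Gamma>" by metis
  have T_add: "T (a + b) = T a + T b" for a b
    using single[OF T] subspace_add[OF sub T T, of a b] by force
  have T_scaleC: "T (scaleC c a) = scaleC c (T a)" for c a
    using single[OF T \<Gamma>_scaleC[OF T]] .
  have "bounded_linear T"
    by (rule bounded_linear_intro[where K = 1])
      (use T_add T_scaleC norm_eq[OF T] in \<open>auto simp: scaleR_L2_def\<close>)
  \<comment> \<open>Polarisation: an additive map that preserves norms preserves real inner
    products. Commuting with \<open>\<i>\<close> then gives the complex ones.\<close>
  moreover have "T a \<bullet> T b = a \<bullet> b" for a b
    using norm_eq[OF T] T_add by (metis dot_norm)
  then have "cinner (T F) (T G) = cinner F G" for F G
    by (simp add: cinner_eq_inner T_scaleC[symmetric])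
  moreover have "T (\<Phi> z) = \<Psi> z" if "z \<in> A" for z
    using single[OF T B_in[OF that, of 1, simplified]] by simp
  ultimately show ?thesis using T_scaleC by blast
qed

subsection \<open>Uniqueness for Fourier integrals\<close>

text \<open>The positive and negative parts of \<open>g\<close> have equal transforms, and at
  \<open>t = 0\<close> equal mass \<open>p\<close>. If \<open>p > 0\<close>, division by
  \<open>p\<close> makes them probability densities with the same characteristic function, and
  Levy's uniqueness theorem identifies them.\<close>

lemma fourier_uniqueness_real:
  fixes g :: "real \<Rightarrow> real"
  assumes int: "integrable lborel g"
    and zero: "\<And>t. (\<integral>x. iexp (t * x) * of_real (g x) \<partial>lborel) = 0"
  shows "AE x in lborel. g x = 0"
proof -
  have [measurable]: "g \<in> borel_measurable borel" using int by auto
  define u where "u x = max 0 (g x)" for x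
  define v where "v x = max 0 (- g x)" for x
  have uv: "g x = u x - v x" "u x \<ge> 0" "v x \<ge> 0" for x by (auto simp: u_def v_def max_def)
  have [measurable]: "u \<in> borel_measurable borel" "v \<in> borel_measurable borel"
    unfolding u_def v_def by measurable
  have iu: "integrable lborel u" and iv: "integrable lborel v"
    unfolding u_def v_def using int by (intro integrable_max integrable_zero integrable_minus; simp)+
  have ic: "integrable lborel (\<lambda>x. iexp (t * x) * of_real (w x))" if "integrable lborel w" for w :: "real \<Rightarrow> real" and t
    using integrable_of_real[where ?'a = complex, OF that] that
    by (intro Bochner_Integration.integrable_bound[OF that]) (auto simp: norm_mult)
  have eq: "(\<integral>x. iexp (t * x) * of_real (u x) \<partial>lborel) = (\<integral>x. iexp (t * x) * of_real (v x) \<partial>lborel)" for t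
  proof -
    have "(\<integral>x. iexp (t * x) * of_real (g x) \<partial>lborel)
        = (\<integral>x. iexp (t * x) * of_real (u x) - iexp (t * x) * of_real (v x) \<partial>lborel)"
      by (simp add: uv(1) algebra_simps)
    also have "\<dots> = (\<integral>x. iexp (t * x) * of_real (u x) \<partial>lborel) - (\<integral>x. iexp (t * x) * of_real (v x) \<partial>lborel)"
      by (intro Bochner_Integration.integral_diff ic iu iv)
    finally show ?thesis using zero by simp
  qed
  define p where "p = integral\<^sup>L lborel u"
  have p_v: "p = integral\<^sup>L lborel v" using eq[of 0] by (simp add: p_def)
  have "p \<ge> 0" unfolding p_def by (intro integral_nonneg_AE) (simp add: uv)
  show ?thesis
  proof (cases "p = 0")
    case True
    then have "AE x in lborel. u x = 0" "AE x in lborel. v x = 0"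
      using integral_nonneg_eq_0_iff_AE[OF iu] integral_nonneg_eq_0_iff_AE[OF iv] uv p_v p_def by auto
    then show ?thesis by eventually_elim (simp add: uv)
  next
    case False
    then have p: "p > 0" using \<open>p \<ge> 0\<close> by simp
    define D where "D w = density lborel (\<lambda>x. ennreal (w x / p))" for w :: "real \<Rightarrow> real"
    have D: "real_distribution (D w)" "char (D w) t = (\<integral>x. iexp (t * x) * of_real (w x) \<partial>lborel) / p"
      if [measurable]: "w \<in> borel_measurable borel" and w: "\<And>x. w x \<ge> 0" "integrable lborel w" "integral\<^sup>L lborel w = p" for w t
    proof -
      have "(\<integral>\<^sup>+x. ennreal (w x / p) \<partial>lborel) = ennreal (\<integral>x. w x / p \<partial>lborel)"
        using w p by (intro nn_integral_eq_integral) auto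
      then have "emeasure (D w) (space (D w)) = 1"
        using w(3) p by (simp add: D_def emeasure_density)
      then have "prob_space (D w)" by (rule prob_spaceI)
      then show "real_distribution (D w)"
        unfolding real_distribution_def real_distribution_axioms_def by (simp add: D_def)
      show "char (D w) t = (\<integral>x. iexp (t * x) * of_real (w x) \<partial>lborel) / p"
        unfolding char_def D_def using w(1) p
        by (subst integral_density) (auto simp: scaleR_conv_of_real mult_ac)
    qed
    have "char (D u) = char (D v)"
      using D(2)[of u] D(2)[of v] uv iu iv p_def p_v eq by (auto simp: fun_eq_iff)
    then have "D u = D v"
      using D(1)[of u] D(1)[of v] uv iu iv p_def p_v by (intro Levy_uniqueness) auto
    moreover have "(\<integral>\<^sup>+x. ennreal (u x / p) \<partial>lborel) = ennreal (\<integral>x. u x / p \<partial>lborel)"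
      using uv iu p by (intro nn_integral_eq_integral) auto
    ultimately have "AE x in lborel. ennreal (u x / p) = ennreal (v x / p)"
      unfolding D_def by (subst (asm) finite_density_unique) auto
    then show ?thesis
      by eventually_elim (use p uv in auto)
  qed
qed

text \<open>The transform of the real part at \<open>t\<close> is the mean of the transform at
  \<open>t\<close> and the conjugate of the transform at \<open>- t\<close>, so it vanishes too. The
  imaginary part of \<open>g\<close> is the real part of \<open>- \<i> * g\<close>.\<close>

lemma fourier_uniqueness:
  fixes g :: "real \<Rightarrow> complex"
  assumes int: "integrable lborel g"
    and zero: "\<And>t. (\<integral>x. iexp (t * x) * g x \<partial>lborel) = 0"
  shows "AE x in lborel. g x = 0"
proof -
  have Re_zero: "AE x in lborel. Re (h x) = 0"
    if h: "integrable lborel h" "\<And>t. (\<integral>x. iexp (t * x) * h x \<partial>lborel) = 0" for h :: "real \<Rightarrow> complex"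
  proof (rule fourier_uniqueness_real)
    show "integrable lborel (\<lambda>x. Re (h x))" using h(1) by auto
    fix t
    have ic: "integrable lborel (\<lambda>x. iexp (s * x) * h x)" for s
      using h(1) by (intro Bochner_Integration.integrable_bound[OF h(1)]) (auto simp: norm_mult)
    have c: "iexp (t * x) * cnj (h x) = cnj (iexp (- t * x) * h x)" for x
      by (simp add: exp_cnj)
    have "iexp (t * x) * of_real (Re (h x)) = (1/2) * (iexp (t * x) * h x + cnj (iexp (- t * x) * h x))" for x
      unfolding c[symmetric] by (simp add: complex_add_cnj distrib_left[symmetric])
    then have "(\<integral>x. iexp (t * x) * of_real (Re (h x)) \<partial>lborel)
        = (1/2) * (\<integral>x. iexp (t * x) * h x + cnj (iexp (- t * x) * h x) \<partial>lborel)"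
      by (simp only: integral_mult_right_zero)
    also have "\<dots> = (1/2) * ((\<integral>x. iexp (t * x) * h x \<partial>lborel) + (\<integral>x. cnj (iexp (- t * x) * h x) \<partial>lborel))"
      by (subst Bochner_Integration.integral_add) (use ic integrable_cnj[OF ic[of "- t"]] in auto)
    also have "(\<integral>x. cnj (iexp (- t * x) * h x) \<partial>lborel) = cnj (\<integral>x. iexp (- t * x) * h x \<partial>lborel)"
      by (rule Bochner_Integration.integral_cnj)
    finally show "(\<integral>x. iexp (t * x) * of_real (Re (h x)) \<partial>lborel) = 0"
      unfolding h(2) by simp
  qed
  have "(\<integral>x. iexp (t * x) * (- \<i> * g x) \<partial>lborel) = - \<i> * (\<integral>x. iexp (t * x) * g x \<partial>lborel)" for t
    by (subst integral_mult_right_zero[symmetric]) (simp add: mult_ac)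
  then have "AE x in lborel. Re (- \<i> * g x) = 0"
    using zero int by (intro Re_zero) auto
  then show ?thesis using Re_zero[OF int zero] by eventually_elim (simp add: complex_eq_iff)
qed

subsection \<open>Integration against \<open>dx/|x|\<close>\<close>

lemma AE_mult_haar: "(AE x in mult_haar. P x) \<longleftrightarrow> (AE x in lborel. P x)"
proof -
  have "(AE x in mult_haar. P x) \<longleftrightarrow> (AE x in lborel. x \<noteq> 0 \<longrightarrow> P x)"
    unfolding mult_haar_def by (subst AE_density) auto
  also have "\<dots> \<longleftrightarrow> (AE x in lborel. P x)"
    using AE_lborel_singleton[of "0::real"] by (auto elim: eventually_elim2)
  finally show ?thesis .
qed

lemma integrable_mult_haar:
  fixes f :: "real \<Rightarrow> complex"
  assumes "f \<in> borel_measurable borel"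
  shows "integrable mult_haar f \<longleftrightarrow> integrable lborel (\<lambda>x. f x / of_real \<bar>x\<bar>)"
  unfolding mult_haar_def using assms
  by (subst integrable_density) (auto simp: scaleR_conv_of_real divide_inverse mult.commute)

lemma integral_mult_haar:
  fixes f :: "real \<Rightarrow> complex"
  assumes "f \<in> borel_measurable borel"
  shows "integral\<^sup>L mult_haar f = (\<integral>x. f x / of_real \<bar>x\<bar> \<partial>lborel)"
  unfolding mult_haar_def using assms
  by (subst integral_density) (auto simp: scaleR_conv_of_real divide_inverse mult.commute)

text \<open>The Jacobian \<open>\<bar>a\<bar>\<close> of Lebesgue measure cancels against the
  density: the measure is Haar measure of the multiplicative group.\<close>

lemma nn_integral_mult_haar_scale:
  assumes [measurable]: "h \<in> borel_measurable borel" and a: "a \<noteq> 0"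
  shows "(\<integral>\<^sup>+x. h (a * x) \<partial>mult_haar) = (\<integral>\<^sup>+x. h x \<partial>mult_haar)"
proof -
  have "(\<integral>\<^sup>+x. h x \<partial>mult_haar) = (\<integral>\<^sup>+x. ennreal (1 / \<bar>x\<bar>) * h x \<partial>lborel)"
    unfolding mult_haar_def by (subst nn_integral_density) auto
  also have "\<dots> = ennreal \<bar>a\<bar> * (\<integral>\<^sup>+x. ennreal (1 / \<bar>0 + a * x\<bar>) * h (0 + a * x) \<partial>lborel)"
    using a by (intro nn_integral_real_affine) auto
  also have "\<dots> = (\<integral>\<^sup>+x. (ennreal \<bar>a\<bar> * ennreal (1 / \<bar>a * x\<bar>)) * h (a * x) \<partial>lborel)"
    by (subst nn_integral_cmult[symmetric]) (auto simp: mult.assoc)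
  also have "\<dots> = (\<integral>\<^sup>+x. ennreal (1 / \<bar>x\<bar>) * h (a * x) \<partial>lborel)"
    using a by (intro nn_integral_cong) (simp add: ennreal_mult[symmetric] abs_mult)
  also have "\<dots> = (\<integral>\<^sup>+x. h (a * x) \<partial>mult_haar)"
    unfolding mult_haar_def by (subst nn_integral_density) auto
  finally show ?thesis by simp
qed

lemma integral_mult_haar_scale:
  fixes f :: "real \<Rightarrow> complex"
  assumes [measurable]: "f \<in> borel_measurable borel" and a: "a \<noteq> 0"
  shows "(\<integral>x. f (a * x) \<partial>mult_haar) = (\<integral>x. f x \<partial>mult_haar)"
proof -
  have "(\<integral>x. f x \<partial>mult_haar) = \<bar>a\<bar> *\<^sub>R (\<integral>x. f (0 + a * x) / of_real \<bar>0 + a * x\<bar> \<partial>lborel)"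
    unfolding integral_mult_haar[OF assms(1)] using a by (rule lborel_integral_real_affine)
  also have "\<dots> = (\<integral>x. \<bar>a\<bar> *\<^sub>R (f (a * x) / of_real \<bar>a * x\<bar>) \<partial>lborel)"
    by simp
  also have "\<dots> = (\<integral>x. f (a * x) / of_real \<bar>x\<bar> \<partial>lborel)"
    using a by (intro Bochner_Integration.integral_cong) (auto simp: scaleR_conv_of_real abs_mult)
  also have "\<dots> = (\<integral>x. f (a * x) \<partial>mult_haar)"
    by (subst integral_mult_haar) auto
  finally show ?thesis by simp
qed

lemma sq_integrable_scale:
  assumes f: "sq_integrable f" and a: "a \<noteq> 0"
  shows "sq_integrable (\<lambda>x. f (a * x))"
proof -
  have [measurable]: "f \<in> borel_measurable borel"
    using f by (simp add: sq_integrable_def cong: measurable_cong_sets)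
  have "(\<integral>\<^sup>+x. ennreal ((cmod (f (a * x)))\<^sup>2) \<partial>mult_haar) = (\<integral>\<^sup>+x. ennreal ((cmod (f x))\<^sup>2) \<partial>mult_haar)"
    using a by (intro nn_integral_mult_haar_scale[where h = "\<lambda>x. ennreal ((cmod (f x))\<^sup>2)"]) auto
  moreover have "(\<integral>\<^sup>+x. ennreal ((cmod (f x))\<^sup>2) \<partial>mult_haar) < \<infinity>"
    using f by (auto simp: sq_integrable_def integrable_iff_bounded)
  ultimately show ?thesis
    unfolding sq_integrable_def by (auto intro!: integrableI_nonneg cong: measurable_cong_sets)
qed

subsection \<open>Laplace integrals\<close>

text \<open>The modulus depends on \<open>Re p\<close> only, and rescaling by \<open>Re p\<close>
  reduces it to the Gamma integral.\<close>

lemma integrable_power_times_exp: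
  fixes p :: complex
  assumes "Re p > 0"
  shows "integrable lborel (\<lambda>x. indicator {0<..} x *\<^sub>R (of_real (x ^ n) * exp (- p * of_real x)))"
proof -
  define r where "r = Re p"
  have r: "r > 0" using assms r_def by simp
  have "(\<integral>\<^sup>+x. ennreal (x ^ n * exp (- x) * indicator {0..} x) \<partial>lborel) = real (fact n)"
    unfolding nn_intergal_power_times_exp_Ici[of n, symmetric]
    by (intro nn_integral_cong) (simp add: indicator_def)
  then have "integrable lborel (\<lambda>x::real. x ^ n * exp (- x) * indicator {0..} x)"
    by (intro integrableI_nonneg) (auto simp: indicator_def)
  from lborel_integrable_real_affine[OF this, of r 0] r
  have "integrable lborel (\<lambda>x::real. (r * x) ^ n * exp (- (r * x)) * indicator {0..} (r * x))"
    by simp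
  from integrable_mult_right[OF this, of "1 / r ^ n"]
  have int: "integrable lborel (\<lambda>x::real. 1 / r ^ n * ((r * x) ^ n * exp (- (r * x)) * indicator {0..} (r * x)))"
    by simp
  show ?thesis
  proof (rule Bochner_Integration.integrable_bound[OF int])
    show "AE x in lborel. norm (indicator {0<..} x *\<^sub>R (of_real (x ^ n) * exp (- p * of_real x)))
        \<le> norm (1 / r ^ n * ((r * x) ^ n * exp (- (r * x)) * indicator {0..} (r * x)))"
      using r by (intro AE_I2)
        (auto simp: indicator_def norm_mult norm_power power_mult_distrib r_def abs_mult power_abs zero_le_mult_iff)
  qed measurable
qed

text \<open>Integration by parts lowers the power. It is carried out by integrating an exact
  derivative whose primitive tends to zero at infinity.\<close>

lemma laplace_power:
  fixes p :: complex
  assumes p: "Re p > 0"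
  shows "(\<integral>x. indicator {0<..} x *\<^sub>R (of_real (x ^ n) * exp (- p * of_real x)) \<partial>lborel)
    = fact n / p ^ Suc n"
proof (induction n)
  have p0: "p \<noteq> 0" using p by auto
  have lim: "((\<lambda>x. of_real (x ^ n) * exp (- p * of_real x)) \<longlongrightarrow> 0) at_top" for n
  proof (rule tendsto_norm_zero_cancel)
    have "((\<lambda>x::real. x ^ n / exp (Re p * x)) \<longlongrightarrow> 0) at_top"
    proof -
      have "filterlim (\<lambda>x. Re p * x) at_top at_top"
        using p by (intro filterlim_tendsto_pos_mult_at_top[OF tendsto_const] filterlim_ident)
      from tendsto_mult[OF filterlim_compose[OF tendsto_power_div_exp_0[of n] this] tendsto_const[of "1 / Re p ^ n"]]
      show ?thesis using p by (simp add: power_mult_distrib)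
    qed
    moreover have "eventually (\<lambda>x::real. x ^ n / exp (Re p * x) = norm (complex_of_real (x ^ n) * exp (- p * of_real x))) at_top"
      using eventually_ge_at_top[of 0]
      by eventually_elim (simp add: norm_mult norm_power exp_minus divide_inverse norm_inverse)
    ultimately show "((\<lambda>x. norm (of_real (x ^ n) * exp (- p * of_real x))) \<longlongrightarrow> 0) at_top"
      by (rule Lim_transform_eventually)
  qed
  have ftc: "(\<integral>x. indicator {0<..} x *\<^sub>R f x \<partial>lborel) = - F 0"
    if "\<And>x. (F has_vector_derivative f x) (at x)" "continuous_on UNIV f"
      "integrable lborel (\<lambda>x. indicator {0<..} x *\<^sub>R f x)" "(F \<longlongrightarrow> 0) at_top" for f F :: "real \<Rightarrow> complex"
  proof -
    have "(LBINT x=ereal 0..\<infinity>. f x) = 0 - F 0"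
    proof (rule interval_integral_FTC_integrable)
      show "set_integrable lborel (einterval (ereal 0) \<infinity>) f"
        using that(3) by (simp add: set_integrable_def einterval_def greaterThan_def)
      show "((F \<circ> real_of_ereal) \<longlongrightarrow> F 0) (at_right (ereal 0))"
        unfolding ereal_tendsto_simps
        using has_vector_derivative_continuous[OF that(1)[of 0]]
        by (auto simp: continuous_at intro: tendsto_within_subset)
      show "((F \<circ> real_of_ereal) \<longlongrightarrow> 0) (at_left \<infinity>)"
        unfolding ereal_tendsto_simps by (rule that(4))
    qed (use that in \<open>auto simp: continuous_on_eq_continuous_at\<close>)
    moreover have "(LBINT x=ereal 0..\<infinity>. f x) = (\<integral>x. indicator {0<..} x *\<^sub>R f x \<partial>lborel)"
      using interval_integral_to_infinity_eq[where M = lborel and a = 0 and f = f]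
      by (simp add: set_lebesgue_integral_def)
    ultimately show ?thesis by simp
  qed
  {
    case 0
    have "(\<integral>x. indicator {0<..} x *\<^sub>R (of_real (x ^ 0) * exp (- p * of_real x)) \<partial>lborel)
      = - (- exp (- p * of_real 0) / p)"
    proof (rule ftc)
      show "((\<lambda>x. - exp (- p * of_real x) / p) has_vector_derivative (of_real (x ^ 0) * exp (- p * of_real x))) (at x)" for x
        using p0 by (auto intro!: derivative_eq_intros has_vector_derivative_real_field)
      show "((\<lambda>x. - exp (- p * complex_of_real x) / p) \<longlongrightarrow> 0) at_top"
        using tendsto_minus[OF tendsto_divide[OF lim[of 0] tendsto_const[of p] p0]] by simp
    qed (use integrable_power_times_exp[OF p, of 0] in \<open>auto intro!: continuous_intros\<close>)
    then show ?case by simp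
  next
    case (Suc n)
    define J where "J n x = indicator {0<..} x *\<^sub>R (complex_of_real (x ^ n) * exp (- p * of_real x))" for n x
    have intJ: "integrable lborel (J n)" for n
      unfolding J_def by (rule integrable_power_times_exp[OF p])
    \<comment> \<open>The left side is the derivative of \<open>x ^ Suc n * exp (- p * x)\<close> on
      the half-line. This primitive vanishes at both ends, so the two integrals on the right
      balance.\<close>
    have eq: "indicator {0<..} x *\<^sub>R ((of_nat (Suc n) * of_real (x ^ n) - p * of_real (x ^ Suc n)) * exp (- p * of_real x))
        = of_nat (Suc n) * J n x - p * J (Suc n) x" for x
      by (simp add: J_def algebra_simps indicator_def)
    have "(\<integral>x. indicator {0<..} x *\<^sub>R ((of_nat (Suc n) * of_real (x ^ n) - p * of_real (x ^ Suc n)) * exp (- p * of_real x)) \<partial>lborel)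
        = - (of_real (0 ^ Suc n) * exp (- p * of_real 0))"
    proof (rule ftc)
      show "((\<lambda>x. of_real (x ^ Suc n) * exp (- p * of_real x)) has_vector_derivative
          ((of_nat (Suc n) * of_real (x ^ n) - p * of_real (x ^ Suc n)) * exp (- p * of_real x))) (at x)" for x :: real
      proof -
        let ?z = "complex_of_real x"
        have 1: "((\<lambda>z. z ^ Suc n) has_field_derivative of_nat (Suc n) * ?z ^ n) (at ?z)"
          by (rule DERIV_cong[OF DERIV_power[OF DERIV_ident]]) simp
        have 2: "((\<lambda>z. exp (- p * z)) has_field_derivative exp (- p * ?z) * (- p)) (at ?z)"
          by (auto intro!: derivative_eq_intros)
        show ?thesis
          using has_vector_derivative_real_field[OF DERIV_mult[OF 1 2]]
          by (simp add: algebra_simps)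
      qed
      show "integrable lborel (\<lambda>x. indicator {0<..} x *\<^sub>R ((of_nat (Suc n) * of_real (x ^ n) - p * of_real (x ^ Suc n)) * exp (- p * of_real x)))"
        unfolding eq using intJ by auto
    qed (use lim[of "Suc n"] in \<open>auto intro!: continuous_intros\<close>)
    then have "of_nat (Suc n) * integral\<^sup>L lborel (J n) - p * integral\<^sup>L lborel (J (Suc n)) = 0"
      unfolding eq using intJ by simp
    then have "integral\<^sup>L lborel (J (Suc n)) = of_nat (Suc n) / p * integral\<^sup>L lborel (J n)"
      using p0 by (simp add: field_simps)
    also have "integral\<^sup>L lborel (J n) = fact n / p ^ Suc n" using Suc.IH unfolding J_def .
    finally show ?case unfolding J_def using p0 by (simp add: field_simps)
  }
qed

subsection \<open>The Bessel kernel\<close>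

definition bessel_coeff :: "nat \<Rightarrow> nat \<Rightarrow> real" where
  "bessel_coeff d k = (-1) ^ k / (fact k * fact (k + d))"

text \<open>Dividing \<open>J_d(2 sqrt u)\<close> by \<open>sqrt u ^ d\<close> leaves this entire
  function of \<open>u\<close>, which is free of square roots; up to the factor
  \<open>1 / fact d\<close> it is the hypergeometric function 0F1 with parameter
  \<open>d + 1\<close> at \<open>- u\<close>.\<close>

definition bessel_entire :: "nat \<Rightarrow> real \<Rightarrow> real" where
  "bessel_entire d u = (\<Sum>k. bessel_coeff d k * u ^ k)"

lemma summable_bessel: "summable (\<lambda>k. \<bar>bessel_coeff d k\<bar> * \<bar>u\<bar> ^ k)"
proof (rule summable_comparison_test')
  show "summable (\<lambda>k. \<bar>u\<bar> ^ k /\<^sub>R fact k)" by (rule summable_exp_generic)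
  fix k
  have "1 \<le> (fact (k + d) :: real)" by (simp add: fact_ge_1)
  then have "1 / (fact k * fact (k + d)) \<le> 1 / (fact k :: real)"
    by (simp add: field_simps)
  then have "\<bar>bessel_coeff d k\<bar> \<le> 1 / fact k"
    by (simp add: bessel_coeff_def abs_mult power_abs)
  then show "norm (\<bar>bessel_coeff d k\<bar> * \<bar>u\<bar> ^ k) \<le> \<bar>u\<bar> ^ k /\<^sub>R fact k"
    using mult_right_mono[of "\<bar>bessel_coeff d k\<bar>" "1 / fact k" "\<bar>u\<bar> ^ k"]
    by (simp add: abs_mult power_abs divide_inverse mult.commute)
qed

lemma summable_bessel': "summable (\<lambda>k. bessel_coeff d k * u ^ k)"
  by (rule summable_norm_cancel) (use summable_bessel[of d u] in \<open>simp add: abs_mult power_abs\<close>)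

lemma bessel_entire_deriv: "(bessel_entire d has_real_derivative - bessel_entire (Suc d) u) (at u)"
proof -
  have "diffs (bessel_coeff d) = (\<lambda>k. - bessel_coeff (Suc d) k)"
    by (rule ext) (simp add: diffs_def bessel_coeff_def field_simps del: of_nat_Suc)
  then have "(\<Sum>k. diffs (bessel_coeff d) k * u ^ k) = - bessel_entire (Suc d) u"
    unfolding bessel_entire_def using suminf_minus[OF summable_bessel'[of "Suc d" u]] by simp
  with termdiffs_strong_converges_everywhere[OF summable_bessel', of d u] show ?thesis
    unfolding bessel_entire_def[abs_def] by simp
qed

text \<open>The three-term recurrence of Bessel functions, compared coefficient by coefficient. As
  differentiation raises the index with a sign, it is also the Bessel differential equation.\<close>

lemma bessel_entire_recurrence:
  "bessel_entire d u = (real d + 1) * bessel_entire (Suc d) u - u * bessel_entire (Suc (Suc d)) u"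
proof -
  have c0: "bessel_coeff d 0 = (real d + 1) * bessel_coeff (Suc d) 0"
  proof -
    have *: "fact (Suc d) = (real d + 1) * fact d" by simp
    show ?thesis unfolding bessel_coeff_def add_0 * by simp
  qed
  \<comment> \<open>The recurrence for one coefficient, with the factorials as free variables:
    \<open>K = k + 1\<close> and \<open>L = k + d + 2\<close>, so that
    \<open>L - K = d + 1\<close>.\<close>
  have alg: "- 1 / ((K * a) * b) = D * (- 1 / ((K * a) * (L * b))) - 1 / (a * (L * b))"
    if "K > 0" "L > 0" "a > 0" "b > 0" "D = L - K" for K L a b D :: real
    using that by (simp add: field_simps)
  have c: "bessel_coeff d (Suc k) = (real d + 1) * bessel_coeff (Suc d) (Suc k) - bessel_coeff (Suc (Suc d)) k" for k
  proof -
    have f: "fact (Suc k) = (real k + 1) * fact k"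
      "fact (Suc k + Suc d) = (real k + real d + 2) * fact (Suc k + d)"
      "fact (k + Suc (Suc d)) = (real k + real d + 2) * fact (Suc k + d)"
      by simp_all
    have "bessel_coeff d (Suc k) = (-1) ^ k * (- 1 / (((real k + 1) * fact k) * fact (Suc k + d)))"
      unfolding bessel_coeff_def f by simp
    also have "- 1 / (((real k + 1) * fact k) * fact (Suc k + d))
      = (real d + 1) * (- 1 / (((real k + 1) * fact k) * ((real k + real d + 2) * fact (Suc k + d))))
        - 1 / (fact k * ((real k + real d + 2) * fact (Suc k + d)))"
      by (rule alg) auto
    also have "(-1) ^ k * \<dots> = (real d + 1) * bessel_coeff (Suc d) (Suc k) - bessel_coeff (Suc (Suc d)) k"
      unfolding bessel_coeff_def f by (simp add: right_diff_distrib)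
    finally show ?thesis .
  qed
  have s: "summable (\<lambda>k. bessel_coeff e (Suc k) * u ^ Suc k)" for e
    using summable_bessel'[of e u] by (subst summable_Suc_iff)
  have "bessel_entire d u = bessel_coeff d 0 + (\<Sum>k. bessel_coeff d (Suc k) * u ^ Suc k)"
    unfolding bessel_entire_def by (subst suminf_split_head[OF summable_bessel']) simp
  also have "(\<Sum>k. bessel_coeff d (Suc k) * u ^ Suc k)
      = (\<Sum>k. (real d + 1) * (bessel_coeff (Suc d) (Suc k) * u ^ Suc k) - u * (bessel_coeff (Suc (Suc d)) k * u ^ k))"
    unfolding c by (simp add: algebra_simps)
  also have "\<dots> = (\<Sum>k. (real d + 1) * (bessel_coeff (Suc d) (Suc k) * u ^ Suc k))
      - (\<Sum>k. u * (bessel_coeff (Suc (Suc d)) k * u ^ k))"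
    using summable_mult[OF s] summable_mult[OF summable_bessel'] by (intro suminf_diff[symmetric])
  also have "\<dots> = (real d + 1) * (\<Sum>k. bessel_coeff (Suc d) (Suc k) * u ^ Suc k) - u * bessel_entire (Suc (Suc d)) u"
    unfolding suminf_mult[OF s] suminf_mult[OF summable_bessel'] bessel_entire_def ..
  also have "(\<Sum>k. bessel_coeff (Suc d) (Suc k) * u ^ Suc k) = bessel_entire (Suc d) u - bessel_coeff (Suc d) 0"
    unfolding bessel_entire_def by (subst suminf_split_head[OF summable_bessel']) simp
  finally show ?thesis unfolding c0 by (simp add: algebra_simps)
qed

text \<open>\<open>G\<^sub>d\<^sup>2 + u G\<^sub>d'\<^sup>2\<close> is a decreasing energy for the differential equation
  \<open>u G\<^sub>d'' + (d + 1) G\<^sub>d' + G\<^sub>d = 0\<close> on \<open>[0,\<infinity>)\<close>.\<close>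

lemma abs_bessel_entire_le:
  assumes "u \<ge> 0"
  shows "\<bar>bessel_entire d u\<bar> \<le> 1"
proof -
  define E where "E x = (bessel_entire d x)\<^sup>2 + x * (bessel_entire (Suc d) x)\<^sup>2" for x
  have *: "(E has_real_derivative - (2 * real d + 1) * (bessel_entire (Suc d) x)\<^sup>2) (at x)" for x
  proof -
    let ?a = "bessel_entire d x" and ?b = "bessel_entire (Suc d) x" and ?c = "bessel_entire (Suc (Suc d)) x"
    have "(E has_real_derivative (2 * ?a * (- ?b) + (?b\<^sup>2 + x * (2 * ?b * (- ?c))))) (at x)"
      unfolding E_def
      by (auto intro!: derivative_eq_intros bessel_entire_deriv)
    \<comment> \<open>Replacing \<open>?a\<close> by the recurrence cancels the products
      \<open>?b * ?c\<close> and leaves a multiple of a square.\<close>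
    moreover have "2 * ?a * (- ?b) + (?b\<^sup>2 + x * (2 * ?b * (- ?c))) = - (2 * real d + 1) * ?b\<^sup>2"
      unfolding bessel_entire_recurrence[of d x] by (simp add: algebra_simps power2_eq_square)
    ultimately show ?thesis by simp
  qed
  have "E u \<le> E 0"
  proof (rule DERIV_nonpos_imp_nonincreasing[OF assms])
    fix x
    have "0 \<le> (2 * real d + 1) * (bessel_entire (Suc d) x)\<^sup>2" by simp
    then have "- (2 * real d + 1) * (bessel_entire (Suc d) x)\<^sup>2 \<le> 0" by linarith
    with * show "\<exists>y. (E has_real_derivative y) (at x) \<and> y \<le> 0" by blast
  qed
  moreover have "bessel_entire d 0 = 1 / fact d"
    unfolding bessel_entire_def powser_zero by (simp add: bessel_coeff_def)
  moreover have "(1 / fact d)\<^sup>2 \<le> (1::real)\<^sup>2"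
    by (rule power_mono) (simp_all add: fact_ge_1)
  ultimately have "(bessel_entire d u)\<^sup>2 + u * (bessel_entire (Suc d) u)\<^sup>2 \<le> (1 / fact d)\<^sup>2"
    "(1 / fact d)\<^sup>2 \<le> (1::real)\<^sup>2"
    unfolding E_def by auto
  moreover have "0 \<le> u * (bessel_entire (Suc d) u)\<^sup>2" using assms by simp
  ultimately have "(bessel_entire d u)\<^sup>2 \<le> 1" by simp
  then show ?thesis by (simp add: abs_square_le_1)
qed

lemma borel_measurable_bessel_entire [measurable]: "bessel_entire d \<in> borel_measurable borel"
  by (intro borel_measurable_continuous_onI DERIV_continuous_on) (auto intro: DERIV_subset bessel_entire_deriv)

text \<open>The power \<open>sqrt x ^ Suc d\<close> is split off because \<open>coherent_fun\<close>
  carries the same one: in their product only integral powers of the integration variable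
  remain.\<close>

lemma j_kernel_eq:
  "j_kernel d x = (if x > 0 then of_real (sqrt x ^ Suc d * bessel_entire d x) / \<i> ^ Suc d else 0)"
proof (cases "x > 0")
  case True
  have "Bessel_J d (2 * sqrt x) = (\<Sum>k. sqrt x ^ d * (bessel_coeff d k * x ^ k))"
    unfolding Bessel_J_def using True
    by (intro suminf_cong) (simp add: bessel_coeff_def power_add power_mult)
  also have "\<dots> = sqrt x ^ d * bessel_entire d x"
    unfolding bessel_entire_def by (rule suminf_mult[OF summable_bessel'])
  finally have J: "Bessel_J d (2 * sqrt x) = sqrt x ^ d * bessel_entire d x" .
  have "- (int d + 1) = - int (Suc d)" by simp
  then have "\<i> powi (- (int d + 1)) = 1 / \<i> ^ Suc d"
    by (simp only: power_int_minus power_int_of_nat divide_inverse mult_1)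
  then show ?thesis using True unfolding j_kernel_def J by simp
qed (simp add: j_kernel_def)

lemma borel_measurable_j_kernel [measurable]: "j_kernel d \<in> borel_measurable borel"
  unfolding j_kernel_eq[abs_def] by measurable

text \<open>Apart from the power of \<open>\<i>\<close> the kernel is real. The sign is the same as
  that by which the Weyl element differs from its inverse, as these differ by the scalar matrix
  \<open>-1\<close>.\<close>

lemma cnj_j_kernel: "cnj (j_kernel d x) = (-1) ^ Suc d * j_kernel d x"
proof -
  have "1 / (- \<i>) ^ Suc d = (-1) ^ Suc d / \<i> ^ Suc d"
    by (subst power_minus) (simp add: field_simps flip: power_mult_distrib)
  then show ?thesis unfolding j_kernel_eq
    by (simp add: field_simps)
qed

text \<open>The bound is multiplicative, so at \<open>x * y\<close> it separates the variables; this
  provides the product majorant for exchanging integrals.\<close>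

lemma norm_j_kernel_le: "norm (j_kernel d x) \<le> sqrt \<bar>x\<bar> ^ Suc d"
proof (cases "x > 0")
  case True
  have "sqrt x ^ Suc d * \<bar>bessel_entire d x\<bar> \<le> sqrt x ^ Suc d * 1"
    using True by (intro mult_left_mono abs_bessel_entire_le) auto
  then show ?thesis
    using True by (simp add: j_kernel_eq norm_mult norm_divide norm_power abs_mult)
qed (simp add: j_kernel_def)

text \<open>Integrated term by term: the Gamma integral of the \<open>k\<close>-th term contributes
  \<open>fact (k + d)\<close>, which cancels the factorial in the coefficient and leaves an
  exponential series in \<open>- y / p\<close>. The same computation with \<open>Re p\<close> and
  \<open>\<bar>y\<bar>\<close> sums the norms and justifies the exchange.\<close>

lemma laplace_bessel:
  fixes p :: complex
  assumes p: "Re p > 0"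
  shows "(\<integral>x. indicator {0<..} x *\<^sub>R (of_real (x ^ d * bessel_entire d (x * y)) * exp (- p * of_real x)) \<partial>lborel)
    = exp (- of_real y / p) / p ^ Suc d"
proof -
  have p0: "p \<noteq> 0" using p by auto
  define r where "r = Re p"
  have r: "r > 0" using p r_def by simp
  define J where "J q n x = indicator {0<..} x *\<^sub>R (complex_of_real (x ^ n) * exp (- q * of_real x))" for q n x
  have intJ: "integrable lborel (J q n)" "integral\<^sup>L lborel (J q n) = fact n / q ^ Suc n" if "Re q > 0" for q n
    unfolding J_def by (rule integrable_power_times_exp[OF that], rule laplace_power[OF that])
  define f where "f k x = of_real (bessel_coeff d k * y ^ k) * J p (k + d) x" for k x
  have intf: "integrable lborel (f k)" for k
    unfolding f_def using intJ(1)[OF p] by auto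
  have normJ: "norm (J p n x) = Re (J (of_real r) n x)" for n x
    by (auto simp: J_def norm_mult norm_power r_def indicator_def norm_exp_eq_Re exp_of_real Re_exp)
  have Re_intJ: "integral\<^sup>L lborel (\<lambda>x. norm (J p n x)) = fact n / r ^ Suc n" for n
  proof -
    have "integral\<^sup>L lborel (\<lambda>x. norm (J p n x)) = Re (integral\<^sup>L lborel (J (of_real r) n))"
      unfolding normJ using intJ(1)[of "of_real r"] r by simp
    also have "\<dots> = Re (of_real (fact n / r ^ Suc n))"
      using intJ(2)[of "of_real r" n] r by simp
    finally show ?thesis by simp
  qed
  have int_norm: "integral\<^sup>L lborel (\<lambda>x. norm (f k x)) = (\<bar>y\<bar> / r) ^ k /\<^sub>R fact k * (1 / r ^ Suc d)" for k
    unfolding f_def norm_mult integral_mult_right_zero Re_intJ norm_of_real using r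
    by (simp add: bessel_coeff_def abs_mult power_abs power_add field_simps)
  have sum_f: "(\<lambda>k. f k x) sums (indicator {0<..} x *\<^sub>R (of_real (x ^ d * bessel_entire d (x * y)) * exp (- p * of_real x)))" for x
  proof -
    have "(\<lambda>k. bessel_coeff d k * (x * y) ^ k) sums bessel_entire d (x * y)"
      unfolding bessel_entire_def by (rule summable_sums[OF summable_bessel'])
    from sums_mult[OF sums_of_real[where ?'a = complex, OF this], of "of_real (x ^ d) * exp (- p * of_real x) * indicator {0<..} x"]
    show ?thesis
      by (simp add: f_def J_def power_add power_mult_distrib mult_ac scaleR_conv_of_real of_real_indicator)
  qed
  have "(\<lambda>k. integral\<^sup>L lborel (f k)) sums (\<integral>x. (\<Sum>k. f k x) \<partial>lborel)"
  proof (rule sums_integral[OF intf])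
    show "summable (\<lambda>k. integral\<^sup>L lborel (\<lambda>x. norm (f k x)))"
      unfolding int_norm by (intro summable_mult2 summable_exp_generic)
    show "AE x in lborel. summable (\<lambda>k. norm (f k x))"
    proof (rule AE_I2)
      fix x
      have "norm (f k x) = \<bar>bessel_coeff d k\<bar> * \<bar>x * y\<bar> ^ k * norm (J p d x)" for k
        by (simp add: f_def J_def norm_mult norm_power power_add power_mult_distrib abs_mult power_abs mult_ac)
      then show "summable (\<lambda>k. norm (f k x))"
        using summable_mult2[OF summable_bessel[of d "x * y"]] by simp
    qed
  qed
  moreover have "integral\<^sup>L lborel (f k) = (- of_real y / p) ^ k /\<^sub>R fact k * (1 / p ^ Suc d)" for k
  proof -
    have "integral\<^sup>L lborel (f k) = of_real (bessel_coeff d k * y ^ k) * (fact (k + d) / p ^ Suc (k + d))"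
      unfolding f_def integral_mult_right_zero intJ(2)[OF p] ..
    also have "\<dots> = (- of_real y / p) ^ k /\<^sub>R fact k * (1 / p ^ Suc d)"
      using p0 power_minus[of "of_real y / p" k]
      by (simp add: bessel_coeff_def power_add power_divide field_simps scaleR_conv_of_real)
    finally show ?thesis .
  qed
  moreover have "(\<lambda>k. (- of_real y / p) ^ k /\<^sub>R fact k * (1 / p ^ Suc d)) sums (exp (- of_real y / p) * (1 / p ^ Suc d))"
    by (intro sums_mult2 exp_converges)
  ultimately have "(\<integral>x. (\<Sum>k. f k x) \<partial>lborel) = exp (- of_real y / p) * (1 / p ^ Suc d)"
    using sums_unique2 by auto
  then show ?thesis using sum_f by (simp add: sums_iff)
qed

subsection \<open>Coherent states\<close>

text \<open>The sign condition lets one formula serve both half-planes; for real \<open>z\<close>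
  the function is zero.\<close>

definition coherent_fun :: "nat \<Rightarrow> complex \<Rightarrow> real \<Rightarrow> complex" where
  "coherent_fun d z x =
     (if x * Im z > 0 then of_real (sqrt \<bar>x\<bar> ^ Suc d) * exp (\<i> * z * of_real x) else 0)"

definition coherent :: "nat \<Rightarrow> complex \<Rightarrow> L2" where
  "coherent d z = class_L2 (coherent_fun d z)"

text \<open>For \<open>z\<close> and \<open>w\<close> in the same half-plane the sign factor gives
  the base of the power positive real part; for different half-planes the supports are
  disjoint.\<close>

definition coherent_kernel :: "nat \<Rightarrow> complex \<Rightarrow> complex \<Rightarrow> complex" where
  "coherent_kernel d z w =
     (if Im z * Im w > 0 then fact d / (- \<i> * of_real (sgn (Im z)) * (z - cnj w)) ^ Suc d else 0)"

lemma borel_measurable_coherent_fun [measurable]: "coherent_fun d z \<in> borel_measurable borel"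
  unfolding coherent_fun_def[abs_def] by measurable

text \<open>The substitution of \<open>\<sigma> * x\<close> for \<open>x\<close> moves the support
  of a coherent state to the positive half-line, so one Laplace integral covers both
  half-planes.\<close>

lemma half_line_cases:
  fixes z :: complex assumes "Im z \<noteq> 0"
  obtains \<sigma> where "\<sigma> = 1 \<or> \<sigma> = - 1" "\<sigma> = sgn (Im z)" "\<sigma> * Im z > 0" "\<And>x. x * Im z > 0 \<longleftrightarrow> \<sigma> * x > 0"
proof -
  have "sgn (Im z) = 1 \<or> sgn (Im z) = - 1" using assms by (auto simp: sgn_if)
  moreover have "sgn (Im z) * Im z > 0" using assms by (auto simp: sgn_if)
  moreover have "x * Im z > 0 \<longleftrightarrow> sgn (Im z) * x > 0" for x
    using assms by (auto simp: sgn_if zero_less_mult_iff)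
  ultimately show thesis using that by blast
qed

lemma reflect_integral:
  fixes f :: "real \<Rightarrow> complex"
  assumes "\<sigma> = 1 \<or> \<sigma> = - 1"
  shows "integral\<^sup>L lborel f = (\<integral>x. f (\<sigma> * x) \<partial>lborel)"
  using lborel_integral_real_affine[of \<sigma> f 0] assms by auto

lemma reflect_integrable:
  fixes f :: "real \<Rightarrow> complex"
  assumes "\<sigma> = 1 \<or> \<sigma> = - 1" "integrable lborel (\<lambda>x. f (\<sigma> * x))"
  shows "integrable lborel f"
  using lborel_integrable_real_affine_iff[of \<sigma> f 0] assms by auto

lemma coherent_fun_product:
  assumes "\<sigma> = 1 \<or> \<sigma> = - 1" "\<And>x. x * Im z > 0 \<longleftrightarrow> \<sigma> * x > 0" "\<And>x. x * Im w > 0 \<longleftrightarrow> \<sigma> * x > 0"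
  shows "coherent_fun d z (\<sigma> * x) * cnj (coherent_fun d w (\<sigma> * x)) / of_real \<bar>\<sigma> * x\<bar>
    = indicator {0<..} x *\<^sub>R (of_real (x ^ d) * exp (- (- \<i> * of_real \<sigma> * (z - cnj w)) * of_real x))"
proof (cases "x > 0")
  case True
  have \<sigma>: "\<sigma> * \<sigma> = 1" "\<bar>\<sigma>\<bar> = 1" using assms(1) by auto
  have "sqrt x ^ Suc d * sqrt x ^ Suc d = x * x ^ d"
    using True by (subst power_mult_distrib[symmetric]) simp
  then have sq: "complex_of_real (sqrt x ^ Suc d) * of_real (sqrt x ^ Suc d) = of_real x * of_real (x ^ d)"
    by (simp only: of_real_mult[symmetric])
  have e: "exp (\<i> * z * of_real (\<sigma> * x)) * cnj (exp (\<i> * w * of_real (\<sigma> * x)))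
      = exp (- (- \<i> * of_real \<sigma> * (z - cnj w)) * of_real x)"
    by (simp add: exp_cnj exp_add[symmetric] algebra_simps)
  have "coherent_fun d z (\<sigma> * x) * cnj (coherent_fun d w (\<sigma> * x)) / of_real \<bar>\<sigma> * x\<bar>
      = (of_real (sqrt x ^ Suc d) * of_real (sqrt x ^ Suc d)) / of_real x
        * (exp (\<i> * z * of_real (\<sigma> * x)) * cnj (exp (\<i> * w * of_real (\<sigma> * x))))"
    unfolding coherent_fun_def assms(2,3) using True \<sigma>
    by (simp add: mult.assoc[symmetric] abs_mult del: power_Suc)
  also have "\<dots> = indicator {0<..} x *\<^sub>R (of_real (x ^ d) * exp (- (- \<i> * of_real \<sigma> * (z - cnj w)) * of_real x))"
    unfolding sq e using True by simp
  finally show ?thesis .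
next
  case False
  then have "\<not> \<sigma> * (\<sigma> * x) > 0" using assms(1) by auto
  then show ?thesis unfolding coherent_fun_def assms(2) using False by simp
qed

lemma coherent_fun_product_integral:
  shows "integrable mult_haar (\<lambda>x. coherent_fun d z x * cnj (coherent_fun d w x))"
    and "(\<integral>x. coherent_fun d z x * cnj (coherent_fun d w x) \<partial>mult_haar) = coherent_kernel d z w"
proof -
  have [measurable]: "cnj \<in> borel_measurable borel"
    by (intro borel_measurable_continuous_onI continuous_intros)
  have meas [measurable]: "(\<lambda>x. coherent_fun d z x * cnj (coherent_fun d w x)) \<in> borel_measurable borel"
    by measurable
  have "integrable mult_haar (\<lambda>x. coherent_fun d z x * cnj (coherent_fun d w x)) \<and>
    (\<integral>x. coherent_fun d z x * cnj (coherent_fun d w x) \<partial>mult_haar) = coherent_kernel d z w"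
  proof (cases "Im z * Im w > 0")
    case True
    then have "Im z \<noteq> 0" by auto
    then obtain \<sigma> where \<sigma>: "\<sigma> = 1 \<or> \<sigma> = - 1" "\<sigma> = sgn (Im z)" "\<sigma> * Im z > 0" "\<And>x. x * Im z > 0 \<longleftrightarrow> \<sigma> * x > 0"
      using half_line_cases[OF \<open>Im z \<noteq> 0\<close>] by blast
    have "Im w \<noteq> 0" using True by auto
    then obtain \<tau> where \<tau>: "\<tau> = sgn (Im w)" "\<tau> * Im w > 0" "\<And>x. x * Im w > 0 \<longleftrightarrow> \<tau> * x > 0"
      using half_line_cases[OF \<open>Im w \<noteq> 0\<close>] by blast
    have "\<tau> = \<sigma>" unfolding \<tau>(1) \<sigma>(2) using True by (auto simp: sgn_if zero_less_mult_iff)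
    then have w: "\<And>x. x * Im w > 0 \<longleftrightarrow> \<sigma> * x > 0" "\<sigma> * Im w > 0" using \<tau>(2,3) by auto
    define p where "p = - \<i> * of_real \<sigma> * (z - cnj w)"
    have p: "Re p > 0" using \<sigma>(3) w(2) by (simp add: p_def algebra_simps)
    note eq = coherent_fun_product[OF \<sigma>(1,4) w(1), of d, folded p_def]
    have "integrable lborel (\<lambda>x. coherent_fun d z x * cnj (coherent_fun d w x) / of_real \<bar>x\<bar>)"
      by (rule reflect_integrable[OF \<sigma>(1)]) (unfold eq, rule integrable_power_times_exp[OF p])
    moreover have "(\<integral>x. coherent_fun d z x * cnj (coherent_fun d w x) / of_real \<bar>x\<bar> \<partial>lborel) = fact d / p ^ Suc d"
      by (subst reflect_integral[OF \<sigma>(1)]) (unfold eq, rule laplace_power[OF p])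
    ultimately show ?thesis
      unfolding integrable_mult_haar[OF meas] integral_mult_haar[OF meas]
      using True by (simp add: coherent_kernel_def p_def \<sigma>(2))
  next
    case False
    have zero: "coherent_fun d z x * cnj (coherent_fun d w x) = 0" for x
    proof -
      have "\<not> (x * Im z > 0 \<and> x * Im w > 0)"
        using False by (auto simp: zero_less_mult_iff)
      then show ?thesis by (auto simp: coherent_fun_def)
    qed
    show ?thesis unfolding zero using False by (simp add: coherent_kernel_def)
  qed
  then show "integrable mult_haar (\<lambda>x. coherent_fun d z x * cnj (coherent_fun d w x))"
    and "(\<integral>x. coherent_fun d z x * cnj (coherent_fun d w x) \<partial>mult_haar) = coherent_kernel d z w" by auto
qed

lemma represents_coherent: "represents (coherent d z) (coherent_fun d z)"
  unfolding coherent_def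
proof (rule represents_class_L2)
  have "integrable mult_haar (\<lambda>x. norm (coherent_fun d z x * cnj (coherent_fun d z x)))"
    by (intro integrable_norm coherent_fun_product_integral)
  then show "sq_integrable (coherent_fun d z)"
    by (simp add: sq_integrable_def norm_mult power2_eq_square cong: measurable_cong_sets)
qed

lemma cinner_coherent: "cinner (coherent d z) (coherent d w) = coherent_kernel d z w"
  unfolding cinner_represents[OF represents_coherent represents_coherent]
  by (rule coherent_fun_product_integral)

text \<open>Along a horizontal line the pairing with coherent states is a Fourier transform.\<close>

lemma AE_eq_0_if_orthogonal_coherent:
  assumes [measurable]: "f \<in> borel_measurable borel"
    and int: "\<And>z. Im z \<noteq> 0 \<Longrightarrow> integrable mult_haar (\<lambda>x. f x * cnj (coherent_fun d z x))"
    and zero: "\<And>z. Im z \<noteq> 0 \<Longrightarrow> (\<integral>x. f x * cnj (coherent_fun d z x) \<partial>mult_haar) = 0"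
  shows "AE x in lborel. f x = 0"
proof -
  have [measurable]: "cnj \<in> borel_measurable borel"
    by (intro borel_measurable_continuous_onI continuous_intros)
  have half: "AE x in lborel. \<sigma> * x > 0 \<longrightarrow> f x = 0" if \<sigma>: "\<sigma> = 1 \<or> \<sigma> = - 1" for \<sigma>
  proof -
    define g where "g x = f x * cnj (coherent_fun d (\<i> * of_real \<sigma>) x) / of_real \<bar>x\<bar>" for x
    have Im_nz: "Im (\<i> * of_real \<sigma> - of_real t) \<noteq> 0" for t using \<sigma> by auto
    \<comment> \<open>The parameter moves by \<open>- t\<close> because the coherent state enters
      conjugated.\<close>
    have shift: "f x * cnj (coherent_fun d (\<i> * of_real \<sigma> - of_real t) x) / of_real \<bar>x\<bar> = iexp (t * x) * g x" for t x
    proof -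
      have "cnj (exp (\<i> * (\<i> * of_real \<sigma> - of_real t) * of_real x))
          = iexp (t * x) * cnj (exp (\<i> * (\<i> * of_real \<sigma>) * of_real x))"
        by (simp add: exp_cnj exp_add[symmetric] algebra_simps)
      then show ?thesis by (simp add: g_def coherent_fun_def del: power_Suc)
    qed
    have m: "(\<lambda>x. f x * cnj (coherent_fun d w x)) \<in> borel_measurable borel" for w by measurable
    have "AE x in lborel. g x = 0"
    proof (rule fourier_uniqueness)
      show "integrable lborel g"
        using int[OF Im_nz[of 0]] unfolding integrable_mult_haar[OF m] by (simp add: g_def[abs_def])
      show "(\<integral>x. iexp (t * x) * g x \<partial>lborel) = 0" for t
        using zero[OF Im_nz[of t]] unfolding integral_mult_haar[OF m] shift .
    qed
    then show ?thesis
      by eventually_elim (auto simp: g_def coherent_fun_def mult.commute)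
  qed
  show ?thesis
    using half[of 1] half[of "-1"] AE_lborel_singleton[of "0::real"]
    by (auto elim!: eventually_elim2 intro: linorder_neqE_linordered_idom)
qed

lemma coherent_total:
  assumes "\<And>z. Im z \<noteq> 0 \<Longrightarrow> cinner F (coherent d z) = 0"
  shows "F = 0"
proof -
  obtain f where f: "represents F f" using represents_ex by blast
  have "AE x in lborel. f x = 0"
  proof (rule AE_eq_0_if_orthogonal_coherent)
    show "f \<in> borel_measurable borel"
      using f by (simp add: represents_def sq_integrable_def cong: measurable_cong_sets)
    show "integrable mult_haar (\<lambda>x. f x * cnj (coherent_fun d z x))" for z
      using represents_sq_integrable[OF f] represents_sq_integrable[OF represents_coherent]
      by (rule sq_integrable_mult_cnj)
    show "(\<integral>x. f x * cnj (coherent_fun d z x) \<partial>mult_haar) = 0" if "Im z \<noteq> 0" for z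
      using assms[OF that] cinner_represents[OF f represents_coherent] by simp
  qed
  then show ?thesis
    using represents_eq_iff[OF f represents_zero] by (simp add: AE_mult_haar)
qed

text \<open>After reflection this is the Laplace transform of the Bessel function at
  \<open>p = - \<i> * \<sigma> * z\<close>, where \<open>- \<bar>y\<bar> / p\<close> equals
  \<open>\<i> * (- 1 / z) * y\<close>. The constant \<open>\<i> ^ Suc d\<close> of the kernel turns
  \<open>p\<close> into \<open>\<sigma> * z\<close>, and the power of \<open>\<sigma>\<close> is the
  power of \<open>sgn y\<close> on the support.\<close>

lemma weyl_coherent_fun:
  assumes "Im z \<noteq> 0"
  shows "(\<integral>x. coherent_fun d z x * j_kernel d (x * y) \<partial>mult_haar)
    = of_real (sgn y ^ Suc d) * coherent_fun d (- 1 / z) y / z ^ Suc d"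
proof -
  obtain \<sigma> where \<sigma>: "\<sigma> = 1 \<or> \<sigma> = - 1" "\<sigma> = sgn (Im z)" "\<sigma> * Im z > 0" "\<And>x. x * Im z > 0 \<longleftrightarrow> \<sigma> * x > 0"
    using half_line_cases[OF assms] by blast
  have \<sigma>2: "\<sigma> * \<sigma> = 1" "\<bar>\<sigma>\<bar> = 1" using \<sigma>(1) by auto
  have z0: "z \<noteq> 0" using assms by auto
  \<comment> \<open>The inversion preserves each half-plane, hence both coherent states live on the
    same half-line.\<close>
  have "Im (- 1 / z) = Im z / (cmod z)\<^sup>2"
    by (simp add: Im_divide cmod_power2)
  then have supp: "y * Im (- 1 / z) > 0 \<longleftrightarrow> \<sigma> * y > 0"
    using z0 \<sigma>(4)[of y] by (simp add: zero_less_divide_iff)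
  show ?thesis
  proof (cases "\<sigma> * y > 0")
    case False
    have zero: "coherent_fun d z x * j_kernel d (x * y) = 0" for x
    proof -
      have "\<not> x * y > 0" if "\<sigma> * x > 0"
        using that False \<sigma>(1) by (auto simp: zero_less_mult_iff)
      then show ?thesis unfolding coherent_fun_def \<sigma>(4) j_kernel_def by simp
    qed
    have "coherent_fun d (- 1 / z) y = 0"
      unfolding coherent_fun_def supp using False by simp
    then show ?thesis unfolding zero by simp
  next
    case True
    have sgn_y: "sgn y = \<sigma>" and y_eq: "\<bar>y\<bar> = \<sigma> * y" using True \<sigma>(1) by auto
    define p where "p = - \<i> * of_real \<sigma> * z"
    have p: "Re p > 0" using \<sigma>(3) by (simp add: p_def)
    have eq: "coherent_fun d z (\<sigma> * x) * j_kernel d (\<sigma> * x * y) / of_real \<bar>\<sigma> * x\<bar>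
      = of_real (sqrt \<bar>y\<bar> ^ Suc d) / \<i> ^ Suc d *
        (indicator {0<..} x *\<^sub>R (of_real (x ^ d * bessel_entire d (x * \<bar>y\<bar>)) * exp (- p * of_real x)))" for x
    proof (cases "x > 0")
      case x: True
      have "sqrt x ^ Suc d * sqrt (x * \<bar>y\<bar>) ^ Suc d = sqrt \<bar>y\<bar> ^ Suc d * (x * x ^ d)"
      proof -
        have "sqrt x * sqrt (x * \<bar>y\<bar>) = sqrt \<bar>y\<bar> * x"
          using x by (simp add: real_sqrt_mult mult.assoc[symmetric])
        then show ?thesis by (metis power_Suc power_mult_distrib)
      qed
      then have sq: "complex_of_real (sqrt x ^ Suc d) * of_real (sqrt (x * \<bar>y\<bar>) ^ Suc d)
          = of_real (sqrt \<bar>y\<bar> ^ Suc d) * (of_real x * of_real (x ^ d))"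
        by (simp only: of_real_mult[symmetric])
      have arg: "\<sigma> * x * y = x * \<bar>y\<bar>" by (simp add: y_eq)
      have pos: "\<sigma> * (\<sigma> * x) > 0" "x * \<bar>y\<bar> > 0" "\<bar>\<sigma> * x\<bar> = x"
      proof -
        have "y \<noteq> 0" using True by auto
        then show "\<sigma> * (\<sigma> * x) > 0" "x * \<bar>y\<bar> > 0" "\<bar>\<sigma> * x\<bar> = x"
          using \<sigma>2 x by (simp_all add: abs_mult mult.assoc[symmetric])
      qed
      have "coherent_fun d z (\<sigma> * x) * j_kernel d (\<sigma> * x * y) / of_real \<bar>\<sigma> * x\<bar>
        = (complex_of_real (sqrt x ^ Suc d) * of_real (sqrt (x * \<bar>y\<bar>) ^ Suc d))
          * (exp (- p * of_real x) * of_real (bessel_entire d (x * \<bar>y\<bar>)) / (\<i> ^ Suc d * of_real x))"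
        unfolding coherent_fun_def \<sigma>(4) j_kernel_eq arg using pos
        by (simp add: p_def mult_ac del: power_Suc)
      also have "\<dots> = of_real (sqrt \<bar>y\<bar> ^ Suc d) / \<i> ^ Suc d *
        (indicator {0<..} x *\<^sub>R (of_real (x ^ d * bessel_entire d (x * \<bar>y\<bar>)) * exp (- p * of_real x)))"
        unfolding sq using x by (simp del: power_Suc)
      finally show ?thesis .
    next
      case False
      then have "\<not> \<sigma> * (\<sigma> * x) > 0" using \<sigma>(1) by auto
      then show ?thesis unfolding coherent_fun_def \<sigma>(4) using False by simp
    qed
    have "(\<integral>x. coherent_fun d z x * j_kernel d (x * y) \<partial>mult_haar)
        = (\<integral>x. coherent_fun d z (\<sigma> * x) * j_kernel d (\<sigma> * x * y) / of_real \<bar>\<sigma> * x\<bar> \<partial>lborel)"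
      by (subst integral_mult_haar) (measurable, rule reflect_integral[OF \<sigma>(1)])
    also have "\<dots> = of_real (sqrt \<bar>y\<bar> ^ Suc d) / \<i> ^ Suc d * (exp (- of_real \<bar>y\<bar> / p) / p ^ Suc d)"
      unfolding eq integral_mult_right_zero laplace_bessel[OF p] ..
    also have "- of_real \<bar>y\<bar> / p = \<i> * (- 1 / z) * of_real y"
      using \<sigma>(1) z0 by (auto simp: p_def y_eq field_simps)
    also have "of_real (sqrt \<bar>y\<bar> ^ Suc d) / \<i> ^ Suc d * (exp (\<i> * (- 1 / z) * of_real y) / p ^ Suc d)
        = of_real (sqrt \<bar>y\<bar> ^ Suc d) * exp (\<i> * (- 1 / z) * of_real y) / (\<i> * p) ^ Suc d"
      by (simp add: power_mult_distrib del: power_Suc)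
    also have "\<i> * p = of_real \<sigma> * z" by (simp add: p_def mult.assoc[symmetric])
    also have "of_real (sqrt \<bar>y\<bar> ^ Suc d) * exp (\<i> * (- 1 / z) * of_real y) / (of_real \<sigma> * z) ^ Suc d
        = of_real (\<sigma> ^ Suc d) * (of_real (sqrt \<bar>y\<bar> ^ Suc d) * exp (\<i> * (- 1 / z) * of_real y)) / z ^ Suc d"
    proof -
      have alg: "X / (A * Z) = A * X / Z" if "A * A = 1" for A X Z :: complex
      proof -
        have "inverse A = A" using that inverse_unique by blast
        then show ?thesis by (simp add: divide_inverse mult_ac)
      qed
      have "complex_of_real (\<sigma> ^ Suc d) * of_real (\<sigma> ^ Suc d) = of_real ((\<sigma> * \<sigma>) ^ Suc d)"
        by (simp only: of_real_mult[symmetric] power_mult_distrib)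
      then have "complex_of_real (\<sigma> ^ Suc d) * of_real (\<sigma> ^ Suc d) = 1" using \<sigma>2 by simp
      from alg[OF this] show ?thesis by (simp only: power_mult_distrib of_real_power)
    qed
    finally show ?thesis unfolding coherent_fun_def supp sgn_y using True by simp
  qed
qed

subsection \<open>The action on coherent states\<close>

definition mob_denom :: "real^2^2 \<Rightarrow> complex \<Rightarrow> complex" where
  "mob_denom g z = of_real (g$2$1) * z + of_real (g$2$2)"

text \<open>The action is on the complement of the real line: matrices of negative determinant
  exchange the half-planes, so coherent states for both have to be treated together.\<close>

definition mob :: "real^2^2 \<Rightarrow> complex \<Rightarrow> complex" where
  "mob g z = (of_real (g$1$1) * z + of_real (g$1$2)) / mob_denom g z"

text \<open>Automorphy factor of weight \<open>d + 1\<close>, normalised by the determinant so that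
  positive scalar matrices have weight 1.\<close>

definition mob_weight :: "nat \<Rightarrow> real^2^2 \<Rightarrow> complex \<Rightarrow> complex" where
  "mob_weight d g z = of_real (sqrt \<bar>det g\<bar> ^ Suc d) / mob_denom g z ^ Suc d"

lemma GL2_iff: "g \<in> GL2 \<longleftrightarrow> det g \<noteq> 0"
  by (simp add: GL2_def invertible_det_nz)

lemma GL2_mult: "g \<in> GL2 \<Longrightarrow> h \<in> GL2 \<Longrightarrow> g ** h \<in> GL2"
  by (simp add: GL2_iff det_mul)

lemma mat2_entries [simp]:
  "mat2 a b c e $ 1 $ 1 = a" "mat2 a b c e $ 1 $ 2 = b" "mat2 a b c e $ 2 $ 1 = c" "mat2 a b c e $ 2 $ 2 = e"
  by (simp_all add: mat2_def)

lemma det_mat2 [simp]: "det (mat2 a b c e) = a * e - b * c"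
  by (simp add: det_2)

lemma mat2_eq_iff: "g = mat2 a b c e \<longleftrightarrow> g$1$1 = a \<and> g$1$2 = b \<and> g$2$1 = c \<and> g$2$2 = e"
  by (auto simp: vec_eq_iff forall_2)

lemma mat2_mult:
  "mat2 a b c e ** mat2 a' b' c' e' = mat2 (a * a' + b * c') (a * b' + b * e') (c * a' + e * c') (c * b' + e * e')"
  by (simp add: mat2_eq_iff matrix_matrix_mult_def sum_2)

lemma mat_1_eq_mat2: "mat 1 = mat2 1 0 0 1"
  by (simp add: mat2_eq_iff mat_def)

lemma mob_denom_nonzero:
  assumes "g \<in> GL2" "Im z \<noteq> 0"
  shows "mob_denom g z \<noteq> 0"
proof
  assume "mob_denom g z = 0"
  then have "g$2$1 = 0" "g$2$2 = 0" using assms(2) by (auto simp: mob_denom_def complex_eq_iff)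
  then show False using assms(1) by (simp add: GL2_iff det_2)
qed

text \<open>Conjugation passes through the real matrix, and in the numerator only the terms with the
  determinant survive. For \<open>w = z\<close> this gives the imaginary part; its power of order
  \<open>d + 1\<close> gives the invariance of the inner products.\<close>

lemma mob_diff:
  assumes "g \<in> GL2" "Im z \<noteq> 0" "Im w \<noteq> 0"
  shows "mob g z - cnj (mob g w) = of_real (det g) * (z - cnj w) / (mob_denom g z * cnj (mob_denom g w))"
proof -
  have nz: "mob_denom g z \<noteq> 0" "cnj (mob_denom g w) \<noteq> 0" using assms by (auto simp: mob_denom_nonzero)
  have "mob g z - cnj (mob g w) =
      ((of_real (g$1$1) * z + of_real (g$1$2)) * cnj (mob_denom g w)
       - (of_real (g$1$1) * cnj w + of_real (g$1$2)) * mob_denom g z) / (mob_denom g z * cnj (mob_denom g w))"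
    unfolding mob_def using nz by (simp add: diff_frac_eq)
  also have "(of_real (g$1$1) * z + of_real (g$1$2)) * cnj (mob_denom g w)
       - (of_real (g$1$1) * cnj w + of_real (g$1$2)) * mob_denom g z = of_real (det g) * (z - cnj w)"
    by (simp add: mob_denom_def det_2 algebra_simps)
  finally show ?thesis .
qed

lemma Im_mob:
  assumes "g \<in> GL2" "Im z \<noteq> 0"
  shows "Im (mob g z) = det g * Im z / (cmod (mob_denom g z))\<^sup>2"
proof -
  have "mob g z - cnj (mob g z) = of_real (det g) * (z - cnj z) / of_real ((cmod (mob_denom g z))\<^sup>2)"
    unfolding mob_diff[OF assms assms(2)] complex_norm_square ..
  then have "complex_of_real (2 * Im (mob g z)) * \<i>
      = of_real (det g * (2 * Im z) / (cmod (mob_denom g z))\<^sup>2) * \<i>"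
    by (simp add: complex_diff_cnj)
  then have "2 * Im (mob g z) = det g * (2 * Im z) / (cmod (mob_denom g z))\<^sup>2"
    unfolding mult_right_cancel[OF complex_i_not_zero] of_real_eq_iff .
  also have "\<dots> = 2 * (det g * Im z / (cmod (mob_denom g z))\<^sup>2)" by simp
  finally show ?thesis by linarith
qed

lemma Im_mob_nonzero: "g \<in> GL2 \<Longrightarrow> Im z \<noteq> 0 \<Longrightarrow> Im (mob g z) \<noteq> 0"
  using mob_denom_nonzero[of g z] by (simp add: Im_mob GL2_iff)

lemma mob_mult:
  assumes "h \<in> GL2" "Im z \<noteq> 0"
  shows "mob_denom (g ** h) z = mob_denom g (mob h z) * mob_denom h z"
    and "mob (g ** h) z = mob g (mob h z)"
proof -
  have nz: "mob_denom h z \<noteq> 0" using assms by (rule mob_denom_nonzero)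
  show 1: "mob_denom (g ** h) z = mob_denom g (mob h z) * mob_denom h z"
    using nz by (simp add: mob_def mob_denom_def[of "g ** h"] mob_denom_def[of g] distrib_right)
      (simp add: matrix_matrix_mult_def sum_2 mob_denom_def algebra_simps)
  have 2: "of_real ((g ** h)$1$1) * z + of_real ((g ** h)$1$2)
      = (of_real (g$1$1) * mob h z + of_real (g$1$2)) * mob_denom h z"
    using nz by (simp add: mob_def distrib_right)
      (simp add: matrix_matrix_mult_def sum_2 mob_denom_def algebra_simps)
  show "mob (g ** h) z = mob g (mob h z)"
    unfolding mob_def[of "g ** h"] mob_def[of g] 1 2 using nz by simp
qed

lemma mob_weight_mult:
  assumes "h \<in> GL2" "Im z \<noteq> 0"
  shows "mob_weight d (g ** h) z = mob_weight d g (mob h z) * mob_weight d h z"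
  unfolding mob_weight_def mob_mult(1)[OF assms]
  by (simp add: det_mul abs_mult real_sqrt_mult power_mult_distrib del: power_Suc)

text \<open>By \<open>mob_diff\<close> the base of the kernel is multiplied by the determinant over
  the two denominators, which the weights undo up to the sign of \<open>det g\<close>. That sign is
  absorbed by \<open>sgn (Im z)\<close>, since the action multiplies it by
  \<open>sgn (det g)\<close>.\<close>

lemma coherent_kernel_mob:
  assumes g: "g \<in> GL2" and z: "Im z \<noteq> 0" and w: "Im w \<noteq> 0"
  shows "mob_weight d g z * cnj (mob_weight d g w) * coherent_kernel d (mob g z) (mob g w) = coherent_kernel d z w"
proof -
  let ?jz = "mob_denom g z" and ?jw = "mob_denom g w"
  have nz: "?jz \<noteq> 0" "?jw \<noteq> 0" using assms by (auto simp: mob_denom_nonzero)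
  have det: "det g \<noteq> 0" using g by (simp add: GL2_iff)
  have "Im (mob g z) * Im (mob g w) = (det g)\<^sup>2 / ((cmod ?jz)\<^sup>2 * (cmod ?jw)\<^sup>2) * (Im z * Im w)"
    unfolding Im_mob[OF g z] Im_mob[OF g w] by (simp add: power2_eq_square)
  moreover have "(det g)\<^sup>2 / ((cmod ?jz)\<^sup>2 * (cmod ?jw)\<^sup>2) > 0" using det nz by simp
  ultimately have sign: "Im (mob g z) * Im (mob g w) > 0 \<longleftrightarrow> Im z * Im w > 0"
    by (metis mult_pos_pos zero_less_mult_pos)
  have "sgn (Im (mob g z)) = sgn (det g) * sgn (Im z)"
    unfolding Im_mob[OF g z] using nz by (simp add: sgn_divide sgn_mult)
  then have "- \<i> * of_real (sgn (Im (mob g z))) * (mob g z - cnj (mob g w))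
      = - \<i> * of_real (sgn (det g) * sgn (Im z)) * (of_real (det g) * (z - cnj w) / (?jz * cnj ?jw))"
    unfolding mob_diff[OF assms] by simp
  also have "\<dots> = of_real (sgn (det g) * det g) * (- \<i> * of_real (sgn (Im z)) * (z - cnj w)) / (?jz * cnj ?jw)"
    by simp
  also have "sgn (det g) * det g = \<bar>det g\<bar>" by (simp add: abs_sgn)
  finally have base: "- \<i> * of_real (sgn (Im (mob g z))) * (mob g z - cnj (mob g w))
      = of_real \<bar>det g\<bar> * (- \<i> * of_real (sgn (Im z)) * (z - cnj w)) / (?jz * cnj ?jw)" .
  have "sqrt \<bar>det g\<bar> ^ Suc d * sqrt \<bar>det g\<bar> ^ Suc d = \<bar>det g\<bar> ^ Suc d"
    by (subst power_mult_distrib[symmetric]) simp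
  then have W: "mob_weight d g z * cnj (mob_weight d g w) = of_real \<bar>det g\<bar> ^ Suc d / (?jz * cnj ?jw) ^ Suc d"
    by (simp add: mob_weight_def power_mult_distrib del: power_Suc flip: of_real_mult of_real_power)
  have alg: "D ^ n / J ^ n * (F / (D * P / J) ^ n) = F / P ^ n"
    if "D \<noteq> 0" "J \<noteq> 0" for D J F P :: complex and n
    using that by (simp add: power_mult_distrib power_divide)
  have A: "of_real \<bar>det g\<bar> ^ Suc d / (?jz * cnj ?jw) ^ Suc d *
      (fact d / (of_real \<bar>det g\<bar> * P / (?jz * cnj ?jw)) ^ Suc d) = fact d / P ^ Suc d" for P
    by (rule alg) (use det nz in auto)
  show ?thesis
    unfolding coherent_kernel_def sign base W
    by (cases "Im z * Im w > 0") (simp_all only: if_True if_False mult_zero_right A)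
qed

text \<open>The discrete series of lowest weight \<open>d + 1\<close>, realised on the two
  half-lines. For invertible \<open>g\<close> totality of the coherent states leaves only one choice
  of \<open>T\<close>.\<close>

definition discrete_op :: "nat \<Rightarrow> real^2^2 \<Rightarrow> L2 \<Rightarrow> L2" where
  "discrete_op d g = (SOME T. bounded_linear T \<and> (\<forall>c F. T (scaleC c F) = scaleC c (T F)) \<and>
    (\<forall>F G. cinner (T F) (T G) = cinner F G) \<and>
    (\<forall>z\<in>{z. Im z \<noteq> 0}. T (coherent d z) = scaleC (mob_weight d g z) (coherent d (mob g z))))"

lemma discrete_op:
  assumes g: "g \<in> GL2"
  shows bounded_linear_discrete_op: "bounded_linear (discrete_op d g)"
    and discrete_op_scaleC: "discrete_op d g (scaleC c F) = scaleC c (discrete_op d g F)"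
    and cinner_discrete_op: "cinner (discrete_op d g F) (discrete_op d g G) = cinner F G"
    and discrete_op_coherent:
      "Im z \<noteq> 0 \<Longrightarrow> discrete_op d g (coherent d z) = scaleC (mob_weight d g z) (coherent d (mob g z))"
proof -
  have "\<exists>T. bounded_linear T \<and> (\<forall>c F. T (scaleC c F) = scaleC c (T F)) \<and>
    (\<forall>F G. cinner (T F) (T G) = cinner F G) \<and>
    (\<forall>z\<in>{z. Im z \<noteq> 0}. T (coherent d z) = scaleC (mob_weight d g z) (coherent d (mob g z)))"
  proof (rule isometric_extension)
    show "F = 0" if "\<And>z. z \<in> {z. Im z \<noteq> 0} \<Longrightarrow> cinner F (coherent d z) = 0" for F
      using that by (intro coherent_total) auto
    show "cinner (scaleC (mob_weight d g z) (coherent d (mob g z))) (scaleC (mob_weight d g w) (coherent d (mob g w)))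
      = cinner (coherent d z) (coherent d w)" if "z \<in> {z. Im z \<noteq> 0}" "w \<in> {z. Im z \<noteq> 0}" for z w
      using coherent_kernel_mob[OF g, of z w d] that
      by (simp add: cinner_scaleC_left cinner_scaleC_right cinner_coherent mult_ac)
  qed
  from someI_ex[OF this, folded discrete_op_def]
  show "bounded_linear (discrete_op d g)"
    "discrete_op d g (scaleC c F) = scaleC c (discrete_op d g F)"
    "cinner (discrete_op d g F) (discrete_op d g G) = cinner F G"
    "Im z \<noteq> 0 \<Longrightarrow> discrete_op d g (coherent d z) = scaleC (mob_weight d g z) (coherent d (mob g z))"
    by blast+
qed

lemma eq_on_coherent:
  assumes "bounded_linear S" "\<And>c F. S (scaleC c F) = scaleC c (S F)"
    and "bounded_linear T" "\<And>c F. T (scaleC c F) = scaleC c (T F)"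
    and "\<And>z. Im z \<noteq> 0 \<Longrightarrow> S (coherent d z) = T (coherent d z)"
  shows "S = T"
  using assms coherent_total[of _ d]
  by (intro bounded_clinear_eq_on_total[where A = "{z. Im z \<noteq> 0}" and \<Phi> = "coherent d"]) auto

lemma discrete_op_mult:
  assumes g: "g \<in> GL2" and h: "h \<in> GL2"
  shows "discrete_op d (g ** h) = discrete_op d g \<circ> discrete_op d h"
proof (rule eq_on_coherent)
  note gh = GL2_mult[OF g h]
  show "bounded_linear (discrete_op d g \<circ> discrete_op d h)"
    unfolding o_def by (intro bounded_linear_compose[OF bounded_linear_discrete_op] bounded_linear_discrete_op g h)
  show "discrete_op d (g ** h) (coherent d z) = (discrete_op d g \<circ> discrete_op d h) (coherent d z)"
    if z: "Im z \<noteq> 0" for z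
    by (simp add: discrete_op_coherent[OF gh z] discrete_op_coherent[OF h z] discrete_op_scaleC[OF g]
        discrete_op_coherent[OF g Im_mob_nonzero[OF h z]] mob_weight_mult[OF h z] mob_mult[OF h z] mult.commute)
qed (simp_all add: bounded_linear_discrete_op discrete_op_scaleC GL2_mult g h)

lemma discrete_op_one: "discrete_op d (mat 1) = id"
proof (rule eq_on_coherent)
  have 1: "mat 1 \<in> GL2" by (simp add: GL2_iff)
  show "bounded_linear (discrete_op d (mat 1))" using 1 by (rule bounded_linear_discrete_op)
  show "discrete_op d (mat 1) (scaleC c F) = scaleC c (discrete_op d (mat 1) F)" for c F
    using 1 by (rule discrete_op_scaleC)
  show "bounded_linear (id :: L2 \<Rightarrow> L2)" by (simp add: id_def)
  show "discrete_op d (mat 1) (coherent d z) = id (coherent d z)" if "Im z \<noteq> 0" for z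
    unfolding discrete_op_coherent[OF 1 that]
    by (simp add: mob_weight_def mob_def mob_denom_def mat_1_eq_mat2)
qed simp

text \<open>With an inverse at hand isometry becomes adjointness: the group element moves to the
  other argument, where a coherent state makes its action explicit.\<close>

lemma cinner_discrete_op_left:
  assumes "g \<in> GL2" "h \<in> GL2" "g ** h = mat 1"
  shows "cinner (discrete_op d g F) G = cinner F (discrete_op d h G)"
proof -
  have "discrete_op d g (discrete_op d h G) = G"
    using discrete_op_mult[OF assms(1,2), of d] by (simp add: assms(3) discrete_op_one fun_eq_iff)
  then show ?thesis using cinner_discrete_op[OF assms(1), of d F "discrete_op d h G"] by simp
qed

lemma norm_discrete_op: "g \<in> GL2 \<Longrightarrow> norm (discrete_op d g F) = norm F"
  by (simp add: norm_L2_def inner_L2_def cinner_discrete_op)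

section \<open>Strong continuity\<close>

lemma isCont_coherent:
  assumes w: "Im w \<noteq> 0"
  shows "isCont (coherent d) w"
proof -
  \<comment> \<open>The kernel with its sign frozen at that of \<open>Im w\<close>: it agrees with
    \<open>coherent_kernel\<close> near \<open>w\<close> and is a continuous expression
    there.\<close>
  define Q where "Q z z' = fact d / (- \<i> * of_real (sgn (Im w)) * (z - cnj z')) ^ Suc d" for z z'
  have ev: "\<forall>\<^sub>F z in at w. Im z * Im w > 0"
  proof (rule order_tendstoD(1))
    show "((\<lambda>z. Im z * Im w) \<longlongrightarrow> Im w * Im w) (at w)" by (intro tendsto_intros)
    show "0 < Im w * Im w" using w not_real_square_gt_zero by blast
  qed
  have "\<forall>\<^sub>F z in at w. Re (Q z z + Q w w - 2 * Q z w) = (norm (coherent d z - coherent d w))\<^sup>2"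
    using ev
  proof eventually_elim
    case (elim z)
    have s: "sgn (Im z) = sgn (Im w)" "Im z * Im z > 0" "Im w * Im w > 0"
      using elim w by (auto simp: sgn_if zero_less_mult_iff)
    have "(norm (coherent d z - coherent d w))\<^sup>2
        = Re (coherent_kernel d z z + coherent_kernel d w w - 2 * coherent_kernel d z w)"
      unfolding power2_norm_eq_inner cinner_coherent[symmetric]
      by (simp add: inner_diff_left inner_diff_right inner_L2_def[symmetric] inner_commute[of "coherent d w" "coherent d z"])
    then show ?case
      unfolding coherent_kernel_def Q_def using s elim by simp
  qed
  moreover have "((\<lambda>z. Re (Q z z + Q w w - 2 * Q z w)) \<longlongrightarrow> Re (Q w w + Q w w - 2 * Q w w)) (at w)"
  proof -
    have "- \<i> * of_real (sgn (Im w)) * (w - cnj w) \<noteq> 0"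
      using w by (simp add: complex_diff_cnj sgn_if)
    then show ?thesis unfolding Q_def by (intro tendsto_intros) auto
  qed
  ultimately have "((\<lambda>z. (norm (coherent d z - coherent d w))\<^sup>2) \<longlongrightarrow> Re (Q w w + Q w w - 2 * Q w w)) (at w)"
    by (rule Lim_transform_eventually[rotated])
  then have "((\<lambda>z. (norm (coherent d z - coherent d w))\<^sup>2) \<longlongrightarrow> 0) (at w)" by simp
  then have "((\<lambda>z. sqrt ((norm (coherent d z - coherent d w))\<^sup>2)) \<longlongrightarrow> sqrt 0) (at w)"
    by (rule tendsto_real_sqrt)
  then have "((\<lambda>z. coherent d z - coherent d w) \<longlongrightarrow> 0) (at w)"
    by (simp add: tendsto_norm_zero_iff)
  then show ?thesis unfolding isCont_def by (rule LIM_zero_cancel)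
qed

text \<open>Since all operators are isometric, convergence of vectors makes the orbit maps converge
  uniformly in \<open>g\<close>; vectors with continuous orbit map thus form a closed subspace, and
  coherent states belong to it.\<close>

lemma continuous_on_discrete_op: "continuous_on GL2 (\<lambda>g. discrete_op d g F)"
proof -
  have "{F. continuous_on GL2 (\<lambda>g. discrete_op d g F)} = UNIV"
  proof (rule total_closed_subspace[where A = "{z. Im z \<noteq> 0}" and \<Phi> = "coherent d"])
    show "F = 0" if "\<And>z. z \<in> {z. Im z \<noteq> 0} \<Longrightarrow> cinner F (coherent d z) = 0" for F
      using that by (intro coherent_total) auto
    have lin: "discrete_op d g (F + G) = discrete_op d g F + discrete_op d g G"
      "discrete_op d g (r *\<^sub>R F) = r *\<^sub>R discrete_op d g F" "discrete_op d g 0 = 0"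
      "discrete_op d g (F - G) = discrete_op d g F - discrete_op d g G"
      if "g \<in> GL2" for g F G r
      using bounded_linear_discrete_op[OF that, of d] by (simp_all add: linear_simps)
    show "subspace {F. continuous_on GL2 (\<lambda>g. discrete_op d g F)}"
      unfolding subspace_def
      by (auto simp: lin intro!: continuous_intros cong: continuous_on_cong)
    show "closed {F. continuous_on GL2 (\<lambda>g. discrete_op d g F)}"
      unfolding closed_sequential_limits
    proof (intro allI impI)
      fix X L assume X: "(\<forall>n. X n \<in> {F. continuous_on GL2 (\<lambda>g. discrete_op d g F)}) \<and> X \<longlonglongrightarrow> L"
      have "uniform_limit GL2 (\<lambda>n g. discrete_op d g (X n)) (\<lambda>g. discrete_op d g L) sequentially"
      proof (rule uniform_limitI)
        fix e :: real assume "e > 0"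
        then have "\<forall>\<^sub>F n in sequentially. dist (X n) L < e" using X tendstoD by blast
        then show "\<forall>\<^sub>F n in sequentially. \<forall>g\<in>GL2. dist (discrete_op d g (X n)) (discrete_op d g L) < e"
          by eventually_elim (simp add: dist_norm lin[symmetric] norm_discrete_op)
      qed
      then have "continuous_on GL2 (\<lambda>g. discrete_op d g L)"
        by (rule uniform_limit_theorem[rotated]) (use X in auto)
      then show "L \<in> {F. continuous_on GL2 (\<lambda>g. discrete_op d g F)}" by simp
    qed
    show "scaleC c (coherent d z) \<in> {F. continuous_on GL2 (\<lambda>g. discrete_op d g F)}" if "z \<in> {z. Im z \<noteq> 0}" for c z
    proof -
      have z: "Im z \<noteq> 0" using that by simp
      have cd: "continuous_on GL2 (\<lambda>g. mob_denom g z)"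
        unfolding mob_denom_def by (intro continuous_intros)
      have cm: "continuous_on GL2 (\<lambda>g. mob g z)"
        unfolding mob_def using mob_denom_nonzero[OF _ z] by (intro continuous_intros cd) auto
      have cw: "continuous_on GL2 (\<lambda>g. mob_weight d g z)"
        unfolding mob_weight_def det_2 using mob_denom_nonzero[OF _ z] by (intro continuous_intros cd) auto
      have "continuous_on {z. Im z \<noteq> 0} (coherent d)"
        using isCont_coherent by (intro continuous_at_imp_continuous_on) auto
      then have "continuous_on GL2 (\<lambda>g. coherent d (mob g z))"
        by (rule continuous_on_compose2[OF _ cm]) (use Im_mob_nonzero[OF _ z] in auto)
      then have "continuous_on GL2 (\<lambda>g. scaleC (c * mob_weight d g z) (coherent d (mob g z)))"
        by (intro continuous_intros cw)
      then show ?thesis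
        by (simp add: discrete_op_scaleC discrete_op_coherent z cong: continuous_on_cong)
    qed
  qed
  then show ?thesis by auto
qed

subsection \<open>The operators on functions\<close>

lemma Fubini_dominated:
  fixes G :: "real \<Rightarrow> real \<Rightarrow> complex"
  assumes G [measurable]: "case_prod G \<in> borel_measurable (borel \<Otimes>\<^sub>M borel)"
    and q: "integrable lborel q" and r: "integrable lborel r"
    and le: "\<And>x y. norm (G x y) \<le> q x * (r y :: real)" and pos: "\<And>x. q x \<ge> 0" "\<And>y. r y \<ge> 0"
  shows "integrable lborel (\<lambda>y. \<integral>x. G x y \<partial>lborel)"
    and "(\<integral>y. (\<integral>x. G x y \<partial>lborel) \<partial>lborel) = (\<integral>x. (\<integral>y. G x y \<partial>lborel) \<partial>lborel)"
proof -
  have G': "case_prod G \<in> borel_measurable (lborel \<Otimes>\<^sub>M lborel)"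
    by measurable
  have 1: "integrable lborel (\<lambda>y. G x y)" for x
  proof (rule Bochner_Integration.integrable_bound)
    show "integrable lborel (\<lambda>y. q x * r y)" using r by auto
    show "AE y in lborel. norm (G x y) \<le> norm (q x * r y)"
      using le pos by (intro AE_I2) (simp add: abs_mult)
  qed measurable
  have "integrable (lborel \<Otimes>\<^sub>M lborel) (case_prod G)"
  proof (rule lborel_pair.Fubini_integrable[OF G'])
    show "integrable lborel (\<lambda>x. \<integral>y. norm (case_prod G (x, y)) \<partial>lborel)"
    proof (rule Bochner_Integration.integrable_bound)
      show "integrable lborel (\<lambda>x. q x * integral\<^sup>L lborel r)" using q by auto
      have "(\<integral>y. norm (G x y) \<partial>lborel) \<le> (\<integral>y. q x * r y \<partial>lborel)" for x
        using 1 r le by (intro integral_mono) auto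
      then show "AE x in lborel. norm (\<integral>y. norm (case_prod G (x, y)) \<partial>lborel) \<le> norm (q x * integral\<^sup>L lborel r)"
        using pos by (intro AE_I2) (simp add: integral_nonneg_AE abs_mult)
    qed measurable
  qed (use 1 in auto)
  then show "integrable lborel (\<lambda>y. \<integral>x. G x y \<partial>lborel)"
    and "(\<integral>y. (\<integral>x. G x y \<partial>lborel) \<partial>lborel) = (\<integral>x. (\<integral>y. G x y \<partial>lborel) \<partial>lborel)"
    by (auto intro: lborel_pair.integrable_snd lborel_pair.Fubini_integral)
qed

lemma represents_borel: "represents F f \<Longrightarrow> f \<in> borel_measurable borel"
  by (simp add: represents_def sq_integrable_def cong: measurable_cong_sets)

lemma borel_measurable_cnj [measurable]: "f \<in> borel_measurable M \<Longrightarrow> (\<lambda>x. cnj (f x)) \<in> borel_measurable M"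
  by (rule measurable_compose[of f M borel cnj])
    (auto intro!: borel_measurable_continuous_onI continuous_intros)

text \<open>Square integrability of \<open>m\<close> is an outcome: the difference from a
  representative of \<open>F\<close> is orthogonal to all coherent states and so vanishes almost
  everywhere. This identifies the Weyl integral, of which only pairings are computed.\<close>

lemma represents_if_pairing:
  assumes m [measurable]: "m \<in> borel_measurable borel"
    and int: "\<And>z. Im z \<noteq> 0 \<Longrightarrow> integrable mult_haar (\<lambda>x. m x * cnj (coherent_fun d z x))"
    and eq: "\<And>z. Im z \<noteq> 0 \<Longrightarrow> (\<integral>x. m x * cnj (coherent_fun d z x) \<partial>mult_haar) = cinner F (coherent d z)"
  shows "represents F m"
proof -
  obtain f where f: "represents F f" using represents_ex by blast
  note [measurable] = represents_borel[OF f]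
  have int_f: "integrable mult_haar (\<lambda>x. f x * cnj (coherent_fun d z x))" for z
    using represents_sq_integrable[OF f] represents_sq_integrable[OF represents_coherent]
    by (rule sq_integrable_mult_cnj)
  have "AE x in lborel. f x - m x = 0"
  proof (rule AE_eq_0_if_orthogonal_coherent)
    fix z :: complex assume z: "Im z \<noteq> 0"
    show "integrable mult_haar (\<lambda>x. (f x - m x) * cnj (coherent_fun d z x))"
      using int_f int[OF z] by (simp add: left_diff_distrib)
    show "(\<integral>x. (f x - m x) * cnj (coherent_fun d z x) \<partial>mult_haar) = 0"
      using int_f int[OF z] eq[OF z] cinner_represents[OF f represents_coherent]
      by (simp add: left_diff_distrib)
  qed measurable
  then have "AE x in mult_haar. f x = m x" by (simp add: AE_mult_haar)
  with f m show ?thesis by (rule represents_cong_AE)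
qed

lemma represents_discrete_op:
  assumes gh: "g \<in> GL2" "h \<in> GL2" "g ** h = mat 1" and f: "represents F f"
    and m: "m \<in> borel_measurable borel"
    and int: "\<And>z. Im z \<noteq> 0 \<Longrightarrow> integrable mult_haar (\<lambda>x. m x * cnj (coherent_fun d z x))"
    and eq: "\<And>z. Im z \<noteq> 0 \<Longrightarrow> (\<integral>x. m x * cnj (coherent_fun d z x) \<partial>mult_haar)
      = (\<integral>x. f x * cnj (mob_weight d h z * coherent_fun d (mob h z) x) \<partial>mult_haar)"
  shows "represents (discrete_op d g F) m"
proof (rule represents_if_pairing[OF m int])
  fix z :: complex assume z: "Im z \<noteq> 0"
  show "(\<integral>x. m x * cnj (coherent_fun d z x) \<partial>mult_haar) = cinner (discrete_op d g F) (coherent d z)"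
    unfolding cinner_discrete_op_left[OF gh] discrete_op_coherent[OF gh(2) z]
      cinner_represents[OF f represents_scaleC[OF represents_coherent]] by (rule eq[OF z])
qed

section \<open>The generators acting on functions\<close>

lemma represents_discrete_op_unipotent:
  assumes f: "represents F f"
  shows "represents (discrete_op d (mat2 1 y 0 1) F) (\<lambda>x. exp (\<i> * of_real (y * x)) * f x)"
proof (rule represents_discrete_op[where h = "mat2 1 (- y) 0 1", OF _ _ _ f])
  note [measurable] = represents_borel[OF f]
  show m: "(\<lambda>x. exp (\<i> * of_real (y * x)) * f x) \<in> borel_measurable borel" by measurable
  have "sq_integrable (\<lambda>x. exp (\<i> * of_real (y * x)) * f x)"
    using represents_sq_integrable[OF f] m
    by (simp add: sq_integrable_def norm_mult cong: measurable_cong_sets)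
  then show "integrable mult_haar (\<lambda>x. exp (\<i> * of_real (y * x)) * f x * cnj (coherent_fun d z x))" for z
    using represents_sq_integrable[OF represents_coherent] by (rule sq_integrable_mult_cnj)
  show "(\<integral>x. exp (\<i> * of_real (y * x)) * f x * cnj (coherent_fun d z x) \<partial>mult_haar)
    = (\<integral>x. f x * cnj (mob_weight d (mat2 1 (- y) 0 1) z * coherent_fun d (mob (mat2 1 (- y) 0 1) z) x) \<partial>mult_haar)" for z
  proof (rule arg_cong[where f = "integral\<^sup>L mult_haar"], rule ext)
    fix x
    have "cnj (exp (\<i> * (z - of_real y) * of_real x)) = exp (\<i> * of_real (y * x)) * cnj (exp (\<i> * z * of_real x))"
      by (simp add: exp_cnj exp_add[symmetric] algebra_simps)
    then show "exp (\<i> * of_real (y * x)) * f x * cnj (coherent_fun d z x)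
      = f x * cnj (mob_weight d (mat2 1 (- y) 0 1) z * coherent_fun d (mob (mat2 1 (- y) 0 1) z) x)"
      by (simp add: mob_weight_def mob_def mob_denom_def coherent_fun_def del: power_Suc)
  qed
qed (auto simp: GL2_iff mat2_mult mat_1_eq_mat2)

lemma represents_discrete_op_diagonal:
  assumes f: "represents F f" and a: "a \<noteq> 0"
  shows "represents (discrete_op d (mat2 a 0 0 1) F) (\<lambda>x. f (a * x))"
proof (rule represents_discrete_op[where h = "mat2 (1 / a) 0 0 1", OF _ _ _ f])
  note [measurable] = represents_borel[OF f]
  show m: "(\<lambda>x. f (a * x)) \<in> borel_measurable borel" by measurable
  show "integrable mult_haar (\<lambda>x. f (a * x) * cnj (coherent_fun d z x))" for z
    using sq_integrable_scale[OF represents_sq_integrable[OF f] a] represents_sq_integrable[OF represents_coherent]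
    by (rule sq_integrable_mult_cnj)
  fix z :: complex
  have "coherent_fun d z (x / a) = mob_weight d (mat2 (1 / a) 0 0 1) z * coherent_fun d (mob (mat2 (1 / a) 0 0 1) z) x" for x
    by (simp add: mob_weight_def mob_def mob_denom_def coherent_fun_def real_sqrt_divide power_divide mult.commute
        del: power_Suc)
  then have "(\<integral>x. f x * cnj (mob_weight d (mat2 (1 / a) 0 0 1) z * coherent_fun d (mob (mat2 (1 / a) 0 0 1) z) x) \<partial>mult_haar)
    = (\<integral>x. f x * cnj (coherent_fun d z (x / a)) \<partial>mult_haar)" by simp
  also have "\<dots> = (\<integral>x. f (a * x) * cnj (coherent_fun d z (a * x / a)) \<partial>mult_haar)"
    by (rule integral_mult_haar_scale[symmetric, OF _ a]) measurable
  finally show "(\<integral>x. f (a * x) * cnj (coherent_fun d z x) \<partial>mult_haar)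
    = (\<integral>x. f x * cnj (mob_weight d (mat2 (1 / a) 0 0 1) z * coherent_fun d (mob (mat2 (1 / a) 0 0 1) z) x) \<partial>mult_haar)"
    using a by simp
qed (use a in \<open>auto simp: GL2_iff mat2_mult mat_1_eq_mat2\<close>)

text \<open>Scalar matrices fix every \<open>z\<close>, so only the weight
  \<open>(\<bar>b\<bar> / b) ^ Suc d\<close> remains; here the parity of \<open>d + 1\<close> enters
  the central character.\<close>

lemma discrete_op_scalar:
  assumes b: "b \<noteq> 0"
  shows "discrete_op d (mat2 b 0 0 b) = scaleC (of_real (sgn b ^ Suc d))"
proof (rule eq_on_coherent)
  have g: "mat2 b 0 0 b \<in> GL2" using b by (simp add: GL2_iff)
  show "bounded_linear (discrete_op d (mat2 b 0 0 b))" using g by (rule bounded_linear_discrete_op)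
  show "discrete_op d (mat2 b 0 0 b) (scaleC c F) = scaleC c (discrete_op d (mat2 b 0 0 b) F)" for c F
    using g by (rule discrete_op_scaleC)
  show "bounded_linear (scaleC (of_real (sgn b ^ Suc d)))" by (rule bounded_linear_scaleC)
  show "discrete_op d (mat2 b 0 0 b) (coherent d z) = scaleC (of_real (sgn b ^ Suc d)) (coherent d z)" if z: "Im z \<noteq> 0" for z
  proof -
    have "sqrt (b * b) = \<bar>b\<bar>" by (metis power2_eq_square real_sqrt_abs)
    moreover have "\<bar>b\<bar> / b = sgn b" using b by (simp add: sgn_if)
    ultimately have "mob_weight d (mat2 b 0 0 b) z = of_real (sgn b ^ Suc d)"
      using b by (simp add: mob_weight_def mob_denom_def power_divide[symmetric] del: power_Suc
          flip: of_real_divide of_real_power)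
    moreover have "mob (mat2 b 0 0 b) z = z" using b by (simp add: mob_def mob_denom_def)
    ultimately show ?thesis using discrete_op_coherent[OF g z, of d] by simp
  qed
qed (simp add: mult.commute)

text \<open>The weight is the growth of the Bessel kernel against \<open>dx/|x|\<close>. Near the
  origin \<open>f\<close> contributes another factor \<open>\<bar>x\<bar>\<close> to the power
  \<open>(d + 1) / 2\<close>, which leaves the bounded \<open>\<bar>x\<bar> ^ d\<close>; far away
  rapid decrease wins.\<close>

lemma integrable_K_space:
  assumes f: "f \<in> K_space d" and [measurable]: "f \<in> borel_measurable borel"
  shows "integrable lborel (\<lambda>x. norm (f x) * sqrt \<bar>x\<bar> ^ Suc d / \<bar>x\<bar>)"
proof -
  define v where "v x = norm (f x) * sqrt \<bar>x\<bar> ^ Suc d / \<bar>x\<bar>" for x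
  have [measurable]: "v \<in> borel_measurable borel" unfolding v_def by measurable
  have v_nonneg: "v x \<ge> 0" for x by (simp add: v_def)
  obtain D where D: "iterated_derivs (- {0}) f D" "\<And>n. rapidly_decreasing (D n)"
    using f by (auto simp: K_space_def)
  \<comment> \<open>The exponent covers the \<open>d + 1\<close> factors
    \<open>sqrt \<bar>x\<bar> \<le> \<bar>x\<bar>\<close> of the weight and two more for the
    majorant \<open>1 / x\<^sup>2\<close>.\<close>
  have "((\<lambda>x. of_real (x ^ (d + 3)) * D 0 x) \<longlongrightarrow> 0) at_infinity"
    using D(2)[of 0] by (simp add: rapidly_decreasing_def)
  then have "\<forall>\<^sub>F x in at_infinity. dist (of_real (x ^ (d + 3)) * D 0 x) 0 < 1"
    by (rule tendstoD) simp
  then obtain X where X: "\<And>x. \<bar>x\<bar> \<ge> X \<Longrightarrow> norm (of_real (x ^ (d + 3)) * D 0 x) < 1"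
    by (auto simp: eventually_at_infinity)
  define Y where "Y = max X 1"
  have far: "v x \<le> 1 / x\<^sup>2" if x: "\<bar>x\<bar> \<ge> Y" for x
  proof -
    have x1: "\<bar>x\<bar> \<ge> 1" and x0: "x \<noteq> 0" using x by (auto simp: Y_def)
    have "D 0 x = f x" using D(1) x0 by (simp add: iterated_derivs_def)
    then have lt1: "\<bar>x\<bar> ^ (d + 3) * norm (f x) < 1"
      using X[of x] x by (simp add: Y_def norm_mult norm_power)
    have "sqrt \<bar>x\<bar> \<le> \<bar>x\<bar>"
      using x1 mult_left_mono[of 1 "sqrt \<bar>x\<bar>" "sqrt \<bar>x\<bar>"] by simp
    then have "sqrt \<bar>x\<bar> ^ Suc d \<le> \<bar>x\<bar> ^ Suc d" by (intro power_mono) auto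
    then have "\<bar>x\<bar>\<^sup>2 * v x \<le> \<bar>x\<bar>\<^sup>2 * (norm (f x) * \<bar>x\<bar> ^ Suc d / \<bar>x\<bar>)"
      unfolding v_def by (intro mult_left_mono divide_right_mono) (simp_all del: power_Suc)
    also have "\<dots> = \<bar>x\<bar> ^ (d + 2) * norm (f x)"
      using x0 by (simp add: power_add power2_eq_square)
    also have "\<dots> \<le> \<bar>x\<bar> ^ (d + 3) * norm (f x)"
      using x1 by (intro mult_right_mono power_increasing) auto
    finally have "x\<^sup>2 * v x \<le> 1" using lt1 by simp
    then show ?thesis using x0 by (simp add: field_simps)
  qed
  \<comment> \<open>Smooth extension up to the origin enters only as continuity on a compact
    interval, hence boundedness; the sign \<open>\<sigma>\<close> handles both half-lines.\<close>
  have near: "\<exists>C. \<forall>x. 0 < \<sigma> * x \<and> \<sigma> * x \<le> Y \<longrightarrow> v x \<le> C"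
    if S: "smooth_on S h" "S = {x. 0 \<le> \<sigma> * x}"
      and h: "\<And>x. 0 < \<sigma> * x \<Longrightarrow> h x = of_real (\<bar>x\<bar> powr (- (real d + 1) / 2)) * f x"
      and \<sigma>: "\<sigma> = 1 \<or> \<sigma> = - 1" for S h \<sigma>
  proof -
    obtain E where E: "iterated_derivs S h E" using S(1) by (auto simp: smooth_on_def)
    have "continuous_on S (E 0)"
      unfolding continuous_on_eq_continuous_within
      using E has_vector_derivative_continuous unfolding iterated_derivs_def by blast
    then have "continuous_on S h"
      by (rule continuous_on_eq) (use E in \<open>auto simp: iterated_derivs_def\<close>)
    moreover have sub: "{x. 0 \<le> \<sigma> * x \<and> \<sigma> * x \<le> Y} \<subseteq> S" using S(2) by auto
    ultimately have "continuous_on {x. 0 \<le> \<sigma> * x \<and> \<sigma> * x \<le> Y} h"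
      by (rule continuous_on_subset)
    moreover have "{x. 0 \<le> \<sigma> * x \<and> \<sigma> * x \<le> Y} = (if \<sigma> = 1 then {0..Y} else {- Y..0})"
      using \<sigma> by auto
    then have "compact {x. 0 \<le> \<sigma> * x \<and> \<sigma> * x \<le> Y}" by (auto split: if_splits)
    ultimately have "bounded (h ` {x. 0 \<le> \<sigma> * x \<and> \<sigma> * x \<le> Y})"
      by (intro compact_imp_bounded compact_continuous_image)
    then obtain B where B: "\<And>x. 0 \<le> \<sigma> * x \<Longrightarrow> \<sigma> * x \<le> Y \<Longrightarrow> norm (h x) \<le> B"
      unfolding bounded_iff by blast
    have "v x \<le> B * Y ^ d" if x: "0 < \<sigma> * x" "\<sigma> * x \<le> Y" for x
    proof -
      have ax: "\<bar>x\<bar> > 0" "\<bar>x\<bar> \<le> Y" using x \<sigma> by auto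
      have e1: "\<bar>x\<bar> powr ((real d + 1) / 2) = sqrt \<bar>x\<bar> ^ Suc d"
      proof -
        have "sqrt \<bar>x\<bar> ^ Suc d = (\<bar>x\<bar> powr (1 / 2)) powr real (Suc d)"
          using ax by (subst powr_realpow) (simp_all add: powr_half_sqrt)
        also have "\<dots> = \<bar>x\<bar> powr ((real d + 1) / 2)"
          by (simp add: powr_powr add.commute)
        finally show ?thesis by simp
      qed
      have e2: "- (real d + 1) / 2 = - ((real d + 1) / 2)" by (rule minus_divide_left[symmetric])
      have "h x = f x / of_real (sqrt \<bar>x\<bar> ^ Suc d)"
        unfolding h[OF x(1)] e2 powr_minus e1 by (simp add: divide_inverse mult.commute del: power_Suc)
      then have "norm (f x) = norm (h x) * sqrt \<bar>x\<bar> ^ Suc d"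
        using ax by (simp add: norm_divide norm_power del: power_Suc of_real_power)
      then have "v x = norm (h x) * ((sqrt \<bar>x\<bar> ^ Suc d * sqrt \<bar>x\<bar> ^ Suc d) / \<bar>x\<bar>)"
        unfolding v_def by simp
      also have "sqrt \<bar>x\<bar> ^ Suc d * sqrt \<bar>x\<bar> ^ Suc d = \<bar>x\<bar> ^ Suc d"
        by (subst power_mult_distrib[symmetric]) simp
      also have "\<bar>x\<bar> ^ Suc d / \<bar>x\<bar> = \<bar>x\<bar> ^ d" using ax by simp
      also have "norm (h x) * \<bar>x\<bar> ^ d \<le> B * Y ^ d"
      proof (intro mult_mono power_mono)
        show "norm (h x) \<le> B" using B x by simp
        then show "0 \<le> B" using norm_ge_zero[of "h x"] by linarith
      qed (use ax in auto)
      finally show ?thesis .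
    qed
    then show ?thesis by blast
  qed
  obtain h1 where h1: "smooth_on {0..} h1" "\<forall>x>0. h1 x = of_real (\<bar>x\<bar> powr (- (real d + 1) / 2)) * f x"
    using f by (auto simp: K_space_def)
  obtain h2 where h2: "smooth_on {..0} h2" "\<forall>x<0. h2 x = of_real (\<bar>x\<bar> powr (- (real d + 1) / 2)) * f x"
    using f by (auto simp: K_space_def)
  obtain C1 where C1: "\<forall>x. 0 < 1 * x \<and> 1 * x \<le> Y \<longrightarrow> v x \<le> C1"
    using near[OF h1(1), of 1] h1(2) by (auto simp: atLeast_def)
  obtain C2 where C2: "\<forall>x. 0 < - 1 * x \<and> - 1 * x \<le> Y \<longrightarrow> v x \<le> C2"
    using near[OF h2(1), of "- 1"] h2(2) by (auto simp: atMost_def)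
  define C where "C = max 0 (max C1 C2)"
  have v0: "v 0 = 0" by (simp add: v_def)
  have C: "v x \<le> C" if "\<bar>x\<bar> \<le> Y" for x
    using C1[rule_format, of x] C2[rule_format, of x] that v0 unfolding C_def
    by (cases x "0::real" rule: linorder_cases) auto
  have Y1: "Y \<ge> 1" by (simp add: Y_def)
  \<comment> \<open>One integrable majorant for both ranges: \<open>C * (1 + Y\<^sup>2)\<close>
    serves for \<open>\<bar>x\<bar> \<le> Y\<close>, and the summand 2 outside, where
    \<open>1 / x\<^sup>2 \<le> 2 / (1 + x\<^sup>2)\<close>.\<close>
  have bound: "v x \<le> (C * (1 + Y\<^sup>2) + 2) * inverse (1 + x\<^sup>2)" for x
  proof (cases "\<bar>x\<bar> \<le> Y")
    case True
    then have "x\<^sup>2 \<le> Y\<^sup>2" using Y1 by (simp add: abs_le_square_iff[symmetric])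
    then have "v x * (1 + x\<^sup>2) \<le> C * (1 + Y\<^sup>2)"
      using C[OF True] v_nonneg by (intro mult_mono) (auto simp: C_def)
    moreover have "1 + x\<^sup>2 > 0" by (simp add: add_pos_nonneg)
    ultimately show ?thesis by (simp add: field_simps)
  next
    case False
    then have x: "\<bar>x\<bar> \<ge> Y" "x\<^sup>2 \<ge> 1" using Y1 abs_le_square_iff[of 1 x] by auto
    have *: "1 / s \<le> 2 * inverse (1 + s)" if "s \<ge> 1" for s :: real
      using that by (simp add: field_simps)
    have "v x \<le> 1 / x\<^sup>2" using far[OF x(1)] .
    also have "\<dots> \<le> 2 * inverse (1 + x\<^sup>2)" using *[OF x(2)] .
    also have "\<dots> \<le> (C * (1 + Y\<^sup>2) + 2) * inverse (1 + x\<^sup>2)"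
    proof (intro mult_right_mono)
      have "0 \<le> C * (1 + Y\<^sup>2)" by (intro mult_nonneg_nonneg) (simp_all add: C_def)
      then show "2 \<le> C * (1 + Y\<^sup>2) + 2" by simp
    qed simp
    finally show ?thesis .
  qed
  have "integrable lborel (\<lambda>x::real. inverse (1 + x\<^sup>2))"
    using integrable_inverse_1_plus_square by (simp add: set_integrable_def)
  then have "integrable lborel (\<lambda>x::real. (C * (1 + Y\<^sup>2) + 2) * inverse (1 + x\<^sup>2))" by simp
  then have "integrable lborel v"
  proof (rule Bochner_Integration.integrable_bound)
    have "norm (v x) \<le> norm ((C * (1 + Y\<^sup>2) + 2) * inverse (1 + x\<^sup>2))" for x
      using bound[of x] v_nonneg[of x] unfolding real_norm_def by linarith
    then show "AE x in lborel. norm (v x) \<le> norm ((C * (1 + Y\<^sup>2) + 2) * inverse (1 + x\<^sup>2))"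
      by simp
  qed measurable
  then show ?thesis by (simp add: v_def[abs_def])
qed

text \<open>Multiplying by the extra power gives the square of the coherent function with parameter
  \<open>z / 2\<close>, so the claim is square integrability of another coherent state.\<close>

lemma integrable_coherent_weighted:
  "integrable lborel (\<lambda>x. norm (coherent_fun d z x) * sqrt \<bar>x\<bar> ^ Suc d / \<bar>x\<bar>)"
proof -
  have prod: "coherent_fun d z x * of_real (sqrt \<bar>x\<bar> ^ Suc d) = coherent_fun d (z / 2) x * coherent_fun d (z / 2) x" for x
  proof -
    have "exp (\<i> * z * of_real x) = exp (\<i> * (z / 2) * of_real x) * exp (\<i> * (z / 2) * of_real x)"
      by (simp add: exp_add[symmetric] mult.assoc)
    then show ?thesis by (simp add: coherent_fun_def mult_ac del: power_Suc)
  qed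
  have eq: "norm (coherent_fun d z x) * sqrt \<bar>x\<bar> ^ Suc d / \<bar>x\<bar>
      = norm (coherent_fun d (z / 2) x * cnj (coherent_fun d (z / 2) x) / of_real \<bar>x\<bar>)" for x
  proof -
    have "norm (coherent_fun d z x) * sqrt \<bar>x\<bar> ^ Suc d = norm (coherent_fun d z x * of_real (sqrt \<bar>x\<bar> ^ Suc d))"
      by (simp add: norm_mult del: power_Suc of_real_power)
    then show ?thesis unfolding prod by (simp add: norm_mult norm_divide)
  qed
  have m: "(\<lambda>x. coherent_fun d (z / 2) x * cnj (coherent_fun d (z / 2) x)) \<in> borel_measurable borel"
    by measurable
  show ?thesis
    unfolding eq
    using coherent_fun_product_integral(1)[of d "z / 2" "z / 2"] unfolding integrable_mult_haar[OF m]
    by (rule integrable_norm)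
qed

text \<open>In the pairing with a coherent state, Fubini moves the Bessel integral from
  \<open>f\<close> to the coherent state, where \<open>weyl_coherent_fun\<close> evaluates it.
  Conjugating the kernel costs \<open>(-1) ^ Suc d\<close>, the sign by which the weight of the
  inverse Weyl element differs from \<open>1 / z ^ Suc d\<close>.\<close>

lemma represents_discrete_op_weyl:
  assumes F: "represents F f" and K: "f \<in> K_space d"
  shows "represents (discrete_op d (mat2 0 (-1) 1 0) F)
    (\<lambda>y. of_real (sgn y ^ Suc d) * (\<integral>x. f x * j_kernel d (x * y) \<partial>mult_haar))"
proof (rule represents_discrete_op[where h = "mat2 0 1 (-1) 0", OF _ _ _ F])
  show "mat2 0 (- 1) 1 0 \<in> GL2" "mat2 0 1 (- 1) 0 \<in> GL2" "mat2 0 (- 1) 1 0 ** mat2 0 1 (- 1) 0 = mat 1"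
    by (auto simp: GL2_iff mat2_mult mat_1_eq_mat2)
  note [measurable] = represents_borel[OF F]
  have eq: "(\<integral>x. f x * j_kernel d (x * y) \<partial>mult_haar) = (\<integral>x. f x * j_kernel d (x * y) / of_real \<bar>x\<bar> \<partial>lborel)" for y
    by (rule integral_mult_haar) measurable
  show m [measurable]: "(\<lambda>y. of_real (sgn y ^ Suc d) * (\<integral>x. f x * j_kernel d (x * y) \<partial>mult_haar)) \<in> borel_measurable borel"
    unfolding eq by measurable
  fix z :: complex assume z: "Im z \<noteq> 0"
  define G where "G x y = f x * j_kernel d (x * y) / of_real \<bar>x\<bar> *
    (of_real (sgn y ^ Suc d) * cnj (coherent_fun d z y) / of_real \<bar>y\<bar>)" for x y
  have G_meas [measurable]: "case_prod G \<in> borel_measurable (borel \<Otimes>\<^sub>M borel)"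
    unfolding G_def by measurable
  have G_le: "norm (G x y) \<le> (norm (f x) * sqrt \<bar>x\<bar> ^ Suc d / \<bar>x\<bar>) * (norm (coherent_fun d z y) * sqrt \<bar>y\<bar> ^ Suc d / \<bar>y\<bar>)" for x y
  proof -
    have "\<bar>sgn y ^ Suc d\<bar> \<le> 1" unfolding power_abs by (intro power_le_one) (auto simp: sgn_if)
    then have "norm (G x y) \<le> norm (f x) * sqrt \<bar>x * y\<bar> ^ Suc d / \<bar>x\<bar> * (1 * norm (coherent_fun d z y) / \<bar>y\<bar>)"
      unfolding G_def norm_mult norm_divide complex_mod_cnj norm_of_real abs_idempotent
      by (intro mult_mono divide_right_mono norm_j_kernel_le) (auto intro!: mult_nonneg_nonneg divide_nonneg_nonneg)
    also have "\<dots> = (norm (f x) * sqrt \<bar>x\<bar> ^ Suc d / \<bar>x\<bar>) * (norm (coherent_fun d z y) * sqrt \<bar>y\<bar> ^ Suc d / \<bar>y\<bar>)"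
      by (simp add: abs_mult real_sqrt_mult power_mult_distrib del: power_Suc)
    finally show ?thesis .
  qed
  have fub: "integrable lborel (\<lambda>y. \<integral>x. G x y \<partial>lborel)"
    "(\<integral>y. (\<integral>x. G x y \<partial>lborel) \<partial>lborel) = (\<integral>x. (\<integral>y. G x y \<partial>lborel) \<partial>lborel)"
    by (rule Fubini_dominated[OF G_meas integrable_K_space[OF K] integrable_coherent_weighted G_le]; simp)+
  have m_meas: "(\<lambda>y. of_real (sgn y ^ Suc d) * (\<integral>x. f x * j_kernel d (x * y) \<partial>mult_haar) * cnj (coherent_fun d z y))
      \<in> borel_measurable borel" by measurable
  have m_eq: "of_real (sgn y ^ Suc d) * (\<integral>x. f x * j_kernel d (x * y) \<partial>mult_haar) * cnj (coherent_fun d z y) / of_real \<bar>y\<bar>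
      = (\<integral>x. G x y \<partial>lborel)" for y
    unfolding eq G_def integral_mult_left_zero by (simp del: power_Suc)
  show "integrable mult_haar (\<lambda>y. of_real (sgn y ^ Suc d) * (\<integral>x. f x * j_kernel d (x * y) \<partial>mult_haar) * cnj (coherent_fun d z y))"
    unfolding integrable_mult_haar[OF m_meas] m_eq by (rule fub)
  have inner: "(\<integral>y. G x y \<partial>lborel)
      = f x * cnj (mob_weight d (mat2 0 1 (- 1) 0) z * coherent_fun d (mob (mat2 0 1 (- 1) 0) z) x) / of_real \<bar>x\<bar>" for x
  proof -
    \<comment> \<open>On the support of the kernel \<open>x\<close> and \<open>y\<close> have the
      same sign, so the power of \<open>sgn y\<close> leaves the inner integral as a power of
      \<open>sgn x\<close>.\<close>
    have "G x y = f x / of_real \<bar>x\<bar> * (of_real (sgn x ^ Suc d) * ((-1) ^ Suc d *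
        cnj (coherent_fun d z y * j_kernel d (y * x) / of_real \<bar>y\<bar>)))" for y
    proof (cases "x * y > 0")
      case True
      then have "sgn y = sgn x" by (auto simp: zero_less_mult_iff)
      moreover have "(-1) ^ Suc d * ((-1) ^ Suc d * w) = w" for w :: complex
        by (simp add: mult.assoc[symmetric] flip: power_mult_distrib)
      ultimately show ?thesis
        by (simp add: G_def cnj_j_kernel mult.commute[of y x] mult_ac del: power_Suc)
    qed (simp add: G_def j_kernel_def mult.commute[of y x])
    then have "(\<integral>y. G x y \<partial>lborel) = f x / of_real \<bar>x\<bar> * (of_real (sgn x ^ Suc d) * ((-1) ^ Suc d *
        cnj (\<integral>y. coherent_fun d z y * j_kernel d (y * x) / of_real \<bar>y\<bar> \<partial>lborel)))"
      by (simp only: integral_mult_right_zero Bochner_Integration.integral_cnj)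
    also have "(\<integral>y. coherent_fun d z y * j_kernel d (y * x) / of_real \<bar>y\<bar> \<partial>lborel)
        = (\<integral>y. coherent_fun d z y * j_kernel d (y * x) \<partial>mult_haar)"
      by (rule integral_mult_haar[symmetric]) measurable
    also have "\<dots> = of_real (sgn x ^ Suc d) * coherent_fun d (- 1 / z) x / z ^ Suc d"
      by (rule weyl_coherent_fun[OF z])
    \<comment> \<open>The two powers of \<open>sgn x\<close> cancel; at \<open>x = 0\<close>, where
      they vanish, so does the coherent function.\<close>
    also have "of_real (sgn x ^ Suc d) * ((-1) ^ Suc d *
        cnj (of_real (sgn x ^ Suc d) * coherent_fun d (- 1 / z) x / z ^ Suc d))
        = cnj ((-1) ^ Suc d / z ^ Suc d * coherent_fun d (- 1 / z) x)"
    proof (cases "x = 0")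
      case False
      then have "sgn x ^ Suc d * sgn x ^ Suc d = 1"
        by (subst power_mult_distrib[symmetric]) (simp add: sgn_if)
      then have "complex_of_real (sgn x ^ Suc d) * of_real (sgn x ^ Suc d) = 1"
        by (simp only: of_real_mult[symmetric] of_real_1)
      then have "of_real (sgn x ^ Suc d) * (of_real (sgn x ^ Suc d) * w) = w" for w :: complex
        by (simp only: mult.assoc[symmetric] mult_1)
      then show ?thesis by (simp add: mult_ac del: power_Suc)
    qed (simp add: coherent_fun_def)
    also have "(-1) ^ Suc d / z ^ Suc d = mob_weight d (mat2 0 1 (- 1) 0) z"
      by (simp add: mob_weight_def mob_denom_def power_minus[of z] divide_inverse power_inverse[symmetric] del: power_Suc)
    also have "- 1 / z = mob (mat2 0 1 (- 1) 0) z"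
      by (simp add: mob_def mob_denom_def)
    finally show ?thesis by simp
  qed
  show "(\<integral>y. of_real (sgn y ^ Suc d) * (\<integral>x. f x * j_kernel d (x * y) \<partial>mult_haar) * cnj (coherent_fun d z y) \<partial>mult_haar)
    = (\<integral>x. f x * cnj (mob_weight d (mat2 0 1 (- 1) 0) z * coherent_fun d (mob (mat2 0 1 (- 1) 0) z) x) \<partial>mult_haar)"
    unfolding integral_mult_haar[OF m_meas] m_eq fub(2) inner
    by (rule integral_mult_haar[symmetric]; measurable)
qed

subsection \<open>Coherent states lie in the Schwartz-type space\<close>

text \<open>The \<open>n\<close>-th derivative of \<open>|x|\<^sup>\<alpha> e\<^bsup>izx\<^esup>\<close> is \<open>|x|\<^sup>\<alpha> p\<^sub>n(1/x) e\<^bsup>izx\<^esup>\<close>.\<close>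

primrec deriv_poly :: "complex \<Rightarrow> complex \<Rightarrow> nat \<Rightarrow> complex poly" where
  "deriv_poly z \<alpha> 0 = 1"
| "deriv_poly z \<alpha> (Suc n) = [:\<i> * z, \<alpha>:] * deriv_poly z \<alpha> n - [:0, 0, 1:] * pderiv (deriv_poly z \<alpha> n)"

lemma sqrt_abs_power_deriv:
  assumes "x \<noteq> 0"
  shows "((\<lambda>x. sqrt \<bar>x\<bar> ^ Suc d) has_real_derivative (real d + 1) / 2 / x * sqrt \<bar>x\<bar> ^ Suc d) (at x)"
proof -
  have s: "((\<lambda>x. sqrt \<bar>x\<bar>) has_real_derivative sqrt \<bar>x\<bar> / (2 * x)) (at x)"
  proof (cases "x > 0")
    case True
    have "((\<lambda>x. sqrt \<bar>x\<bar>) has_real_derivative inverse (sqrt x) / 2) (at x)"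
    proof (rule has_field_derivative_transform_within_open[OF DERIV_real_sqrt[OF True]])
      show "open {0::real<..}" by simp
    qed (use True in auto)
    moreover have "inverse (sqrt x) / 2 = sqrt \<bar>x\<bar> / (2 * x)"
      using True by (simp add: field_simps)
    ultimately show ?thesis by simp
  next
    case False
    then have neg: "x < 0" using assms by simp
    have "((\<lambda>x. sqrt (- x)) has_real_derivative inverse (sqrt (- x)) / 2 * (- 1)) (at x)"
      using neg by (intro DERIV_chain2[OF DERIV_real_sqrt]) (auto intro!: derivative_eq_intros)
    then have "((\<lambda>x. sqrt \<bar>x\<bar>) has_real_derivative inverse (sqrt (- x)) / 2 * (- 1)) (at x)"
    proof (rule has_field_derivative_transform_within_open)
      show "open {..<0::real}" by simp
    qed (use neg in auto)
    moreover have "inverse (sqrt (- x)) / 2 * (- 1) = sqrt \<bar>x\<bar> / (2 * x)"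
    proof -
      have "sqrt (- x) * sqrt (- x) = - x" using neg by simp
      then show ?thesis using neg by (simp add: field_simps)
    qed
    ultimately show ?thesis by simp
  qed
  have "((\<lambda>x. sqrt \<bar>x\<bar> ^ Suc d) has_real_derivative of_nat (Suc d) * (sqrt \<bar>x\<bar> / (2 * x) * sqrt \<bar>x\<bar> ^ d)) (at x)"
    by (rule DERIV_cong[OF DERIV_power[OF s]]) simp
  then show ?thesis by (rule DERIV_cong) (simp add: field_simps)
qed

text \<open>Dividing out the power at the origin leaves a pure exponential on one half-line and zero
  on the other, and exponential decay beats every power. Membership makes the Weyl formula
  applicable to a total family.\<close>

lemma coherent_fun_in_K_space:
  assumes z: "Im z \<noteq> 0"
  shows "coherent_fun d z \<in> K_space d"
proof -
  obtain \<sigma> where \<sigma>: "\<sigma> = 1 \<or> \<sigma> = - 1" "\<sigma> * Im z > 0" "\<And>x. x * Im z > 0 \<longleftrightarrow> \<sigma> * x > 0"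
    using half_line_cases[OF z] by blast
  define \<alpha> where "\<alpha> = (of_nat d + 1) / (2 :: complex)"
  define P where "P = deriv_poly z \<alpha>"
  define D where "D n x = (if \<sigma> * x > 0
    then of_real (sqrt \<bar>x\<bar> ^ Suc d) * (poly (P n) (inverse (of_real x)) * exp (\<i> * z * of_real x)) else 0)" for n x
  have deriv: "(D n has_vector_derivative D (Suc n) x) (at x)" if x0: "x \<noteq> 0" for n x
  proof (cases "\<sigma> * x > 0")
    case True
    have open_half: "open {x. \<sigma> * x > 0}" by (intro open_Collect_less continuous_intros)
    have "((\<lambda>x. complex_of_real (sqrt \<bar>x\<bar> ^ Suc d)) has_vector_derivative of_real ((real d + 1) / 2 / x * sqrt \<bar>x\<bar> ^ Suc d)) (at x)"
      using sqrt_abs_power_deriv[OF x0, of d]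
      by (intro has_vector_derivative_of_real) (simp add: has_real_derivative_iff_has_vector_derivative)
    moreover have "((\<lambda>x. poly (P n) (inverse (of_real x)) * exp (\<i> * z * of_real x)) has_vector_derivative
      (poly (pderiv (P n)) (inverse (of_real x)) * (- (inverse (of_real x) * inverse (of_real x))) * exp (\<i> * z * of_real x)
        + exp (\<i> * z * of_real x) * (\<i> * z) * poly (P n) (inverse (of_real x)))) (at x)"
    proof (rule has_vector_derivative_real_field)
      have 1: "((\<lambda>u. poly (P n) (inverse u)) has_field_derivative
          poly (pderiv (P n)) (inverse (of_real x)) * (- (inverse (of_real x) * inverse (of_real x)))) (at (complex_of_real x))"
        using x0 by (intro DERIV_chain2[OF poly_DERIV]) (auto intro!: derivative_eq_intros)
      have 2: "((\<lambda>u. exp (\<i> * z * u)) has_field_derivative exp (\<i> * z * of_real x) * (\<i> * z)) (at (complex_of_real x))"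
        by (auto intro!: derivative_eq_intros)
      show "((\<lambda>u. poly (P n) (inverse u) * exp (\<i> * z * u)) has_field_derivative
        (poly (pderiv (P n)) (inverse (of_real x)) * (- (inverse (of_real x) * inverse (of_real x))) * exp (\<i> * z * of_real x)
        + exp (\<i> * z * of_real x) * (\<i> * z) * poly (P n) (inverse (of_real x)))) (at (of_real x))"
        by (rule DERIV_mult[OF 1 2])
    qed
    ultimately have "((\<lambda>x. of_real (sqrt \<bar>x\<bar> ^ Suc d) * (poly (P n) (inverse (of_real x)) * exp (\<i> * z * of_real x)))
        has_vector_derivative
        (of_real (sqrt \<bar>x\<bar> ^ Suc d) *
          (poly (pderiv (P n)) (inverse (of_real x)) * (- (inverse (of_real x) * inverse (of_real x))) * exp (\<i> * z * of_real x)
            + exp (\<i> * z * of_real x) * (\<i> * z) * poly (P n) (inverse (of_real x)))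
         + of_real ((real d + 1) / 2 / x * sqrt \<bar>x\<bar> ^ Suc d) * (poly (P n) (inverse (of_real x)) * exp (\<i> * z * of_real x)))) (at x)"
      by (rule has_vector_derivative_mult)
    also have "(of_real (sqrt \<bar>x\<bar> ^ Suc d) *
          (poly (pderiv (P n)) (inverse (of_real x)) * (- (inverse (of_real x) * inverse (of_real x))) * exp (\<i> * z * of_real x)
            + exp (\<i> * z * of_real x) * (\<i> * z) * poly (P n) (inverse (of_real x)))
         + of_real ((real d + 1) / 2 / x * sqrt \<bar>x\<bar> ^ Suc d) * (poly (P n) (inverse (of_real x)) * exp (\<i> * z * of_real x)))
      = of_real (sqrt \<bar>x\<bar> ^ Suc d) * (poly (P (Suc n)) (inverse (of_real x)) * exp (\<i> * z * of_real x))"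
    proof -
      let ?I = "inverse (complex_of_real x)"
      \<comment> \<open>Product rule with \<open>I\<close> for \<open>1 / x\<close>,
        \<open>J\<close> for \<open>\<i> * z\<close> and \<open>A\<close> for
        \<open>\<alpha>\<close>; the bracket on the right is the recursion of
        \<open>deriv_poly\<close>.\<close>
      have alg: "S * (p' * (- (I * I)) * E + E * J * p) + A * I * S * (p * E)
          = S * (((J + I * A) * p - I * I * p') * E)" for S p p' I E J A :: complex
        by (simp add: algebra_simps)
      have P_Suc: "poly (P (Suc n)) ?I = (\<i> * z + ?I * \<alpha>) * poly (P n) ?I - ?I * ?I * poly (pderiv (P n)) ?I"
        by (simp add: P_def distrib_right mult.assoc)
      have c: "complex_of_real ((real d + 1) / 2 / x * sqrt \<bar>x\<bar> ^ Suc d) = \<alpha> * ?I * of_real (sqrt \<bar>x\<bar> ^ Suc d)"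
        by (simp only: \<alpha>_def of_real_mult of_real_divide of_real_add of_real_of_nat_eq of_real_1
            of_real_numeral of_real_inverse divide_inverse)
      show ?thesis unfolding P_Suc c by (rule alg)
    qed
    finally have "((\<lambda>x. of_real (sqrt \<bar>x\<bar> ^ Suc d) * (poly (P n) (inverse (of_real x)) * exp (\<i> * z * of_real x)))
        has_vector_derivative D (Suc n) x) (at x)"
      using True by (simp add: D_def del: power_Suc)
    then show ?thesis
      by (rule has_vector_derivative_transform_within_open[OF _ open_half]) (use True in \<open>auto simp: D_def\<close>)
  next
    case False
    then have neg: "\<sigma> * x < 0" using x0 \<sigma>(1) by auto
    have open_half: "open {x. \<sigma> * x < 0}" by (intro open_Collect_less continuous_intros)
    have "((\<lambda>_. 0) has_vector_derivative D (Suc n) x) (at x)" using False by (simp add: D_def)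
    then show ?thesis
      by (rule has_vector_derivative_transform_within_open[OF _ open_half]) (use neg in \<open>auto simp: D_def\<close>)
  qed
  have "iterated_derivs (- {0}) (coherent_fun d z) D"
    unfolding iterated_derivs_def
  proof (intro conjI ballI allI)
    show "D 0 x = coherent_fun d z x" for x
      by (simp add: D_def coherent_fun_def \<sigma>(3) P_def mult_ac del: power_Suc)
    show "(D n has_vector_derivative D (Suc n) x) (at x within - {0})" if "x \<in> - {0}" for n x
      by (rule has_vector_derivative_at_within, rule deriv) (use that in simp)
  qed
  moreover have "rapidly_decreasing (D n)" for n
    unfolding rapidly_decreasing_def
  proof (intro allI)
    fix N
    define c where "c = \<bar>Im z\<bar>"
    have c: "c > 0" using z by (simp add: c_def)
    \<comment> \<open>For \<open>\<bar>x\<bar> \<ge> 1\<close> the argument \<open>1 / x\<close>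
      stays in the unit disc, where the polynomial is bounded.\<close>
    have "bounded (poly (P n) ` cball 0 1)"
      by (intro compact_imp_bounded compact_continuous_image continuous_intros compact_cball)
    then obtain B where "\<forall>w\<in>poly (P n) ` cball 0 1. norm w \<le> B"
      unfolding bounded_iff by blast
    then have B: "norm (poly (P n) u) \<le> B" if "norm u \<le> 1" for u using that by simp
    have B0: "B \<ge> 0" by (rule order_trans[OF norm_ge_zero B[of 0]]) simp
    show "((\<lambda>x. of_real (x ^ N) * D n x) \<longlongrightarrow> 0) at_infinity"
    proof (rule Lim_null_comparison)
      have "\<forall>\<^sub>F x::real in at_infinity. norm x \<ge> 1"
        unfolding eventually_at_infinity by (rule exI[of _ 1]) simp
      then show "\<forall>\<^sub>F x in at_infinity. norm (of_real (x ^ N) * D n x)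
          \<le> B / c ^ (N + Suc d) * ((c * norm x) ^ (N + Suc d) / exp (c * norm x))"
      proof eventually_elim
        case (elim x)
        show ?case
        proof (cases "\<sigma> * x > 0")
          case True
          have ax: "\<bar>x\<bar> \<ge> 1" using elim by simp
          have "x * Im z > 0" using True \<sigma>(3) by simp
          then have "x * Im z = \<bar>x * Im z\<bar>" by simp
          then have xz: "x * Im z = c * \<bar>x\<bar>" by (simp add: c_def abs_mult mult.commute)
          have "norm (exp (\<i> * z * of_real x)) = exp (- (x * Im z))"
            by (simp add: norm_exp_eq_Re mult.commute)
          then have e: "norm (exp (\<i> * z * of_real x)) = 1 / exp (c * \<bar>x\<bar>)"
            unfolding xz by (simp add: exp_minus inverse_eq_divide)
          have "sqrt \<bar>x\<bar> \<le> \<bar>x\<bar>"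
            using ax mult_left_mono[of 1 "sqrt \<bar>x\<bar>" "sqrt \<bar>x\<bar>"] by simp
          then have s: "sqrt \<bar>x\<bar> ^ Suc d \<le> \<bar>x\<bar> ^ Suc d" by (intro power_mono) auto
          have p: "norm (poly (P n) (inverse (of_real x))) \<le> B"
            by (rule B) (use ax in \<open>simp add: norm_inverse inverse_le_1_iff\<close>)
          have "norm (of_real (x ^ N) * D n x)
              = \<bar>x\<bar> ^ N * (sqrt \<bar>x\<bar> ^ Suc d * (norm (poly (P n) (inverse (of_real x))) * (1 / exp (c * \<bar>x\<bar>))))"
            using True unfolding D_def norm_mult e[symmetric]
            by (simp add: norm_mult norm_power power_abs del: power_Suc)
          also have "\<dots> \<le> \<bar>x\<bar> ^ N * (\<bar>x\<bar> ^ Suc d * (B * (1 / exp (c * \<bar>x\<bar>))))"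
            using s p B0 by (intro mult_left_mono mult_mono mult_right_mono) auto
          also have "\<dots> = B / c ^ (N + Suc d) * ((c * norm x) ^ (N + Suc d) / exp (c * norm x))"
            using c by (simp add: power_mult_distrib power_add mult_ac)
          finally show ?thesis .
        qed (use B0 c in \<open>simp add: D_def\<close>)
      qed
      have "filterlim (\<lambda>x::real. c * norm x) at_top at_infinity"
        using c by (intro filterlim_tendsto_pos_mult_at_top[OF tendsto_const] filterlim_norm_at_top)
      from tendsto_mult[OF tendsto_const[of "B / c ^ (N + Suc d)"]
          filterlim_compose[OF tendsto_power_div_exp_0[of "N + Suc d"] this]]
      show "((\<lambda>x::real. B / c ^ (N + Suc d) * ((c * norm x) ^ (N + Suc d) / exp (c * norm x))) \<longlongrightarrow> 0) at_infinity"
        by simp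
    qed
  qed
  moreover have "\<exists>h. smooth_on S h \<and> (\<forall>x. 0 < \<tau> * x \<longrightarrow> h x = of_real (\<bar>x\<bar> powr (- (real d + 1) / 2)) * coherent_fun d z x)"
    if \<tau>: "\<tau> = 1 \<or> \<tau> = - 1" for \<tau> and S :: "real set"
  proof (intro exI conjI allI impI)
    \<comment> \<open>Exponential on the supporting half-line, zero on the other: either extension
      is smooth on the whole line, so \<open>S\<close> can be arbitrary.\<close>
    define c where "c = (if \<tau> = \<sigma> then 1 else 0 :: complex)"
    show "smooth_on S (\<lambda>x. c * exp (\<i> * z * of_real x))"
      unfolding smooth_on_def iterated_derivs_def
    proof (intro exI conjI ballI allI)
      fix n x
      have "((\<lambda>u. c * (\<i> * z) ^ n * exp (\<i> * z * u)) has_field_derivative c * (\<i> * z) ^ Suc n * exp (\<i> * z * of_real x)) (at (complex_of_real x))"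
        by (auto intro!: derivative_eq_intros)
      then show "((\<lambda>x. c * (\<i> * z) ^ n * exp (\<i> * z * of_real x)) has_vector_derivative c * (\<i> * z) ^ Suc n * exp (\<i> * z * of_real x)) (at x within S)"
        by (rule has_vector_derivative_at_within[OF has_vector_derivative_real_field])
    qed simp
    fix x assume x: "0 < \<tau> * x"
    show "c * exp (\<i> * z * of_real x) = of_real (\<bar>x\<bar> powr (- (real d + 1) / 2)) * coherent_fun d z x"
    proof (cases "\<tau> = \<sigma>")
      case True
      have ax: "\<bar>x\<bar> > 0" using x by auto
      have e1: "sqrt \<bar>x\<bar> ^ Suc d = \<bar>x\<bar> powr ((real d + 1) / 2)"
      proof -
        have "sqrt \<bar>x\<bar> ^ Suc d = (\<bar>x\<bar> powr (1 / 2)) powr real (Suc d)"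
          using ax by (subst powr_realpow) (simp_all add: powr_half_sqrt)
        then show ?thesis by (simp add: powr_powr add.commute)
      qed
      have e2: "- (real d + 1) / 2 = - ((real d + 1) / 2)" by (rule minus_divide_left[symmetric])
      have "\<bar>x\<bar> powr (- (real d + 1) / 2) * sqrt \<bar>x\<bar> ^ Suc d = 1"
        unfolding e1 e2 powr_minus using ax by simp
      then have "complex_of_real (\<bar>x\<bar> powr (- (real d + 1) / 2)) * of_real (sqrt \<bar>x\<bar> ^ Suc d) = 1"
        by (simp only: of_real_mult[symmetric] of_real_1)
      then show ?thesis
        using True x unfolding coherent_fun_def \<sigma>(3) c_def by (simp add: mult.assoc[symmetric] del: power_Suc)
    next
      case False
      then have "\<not> \<sigma> * x > 0" using \<tau> \<sigma>(1) x by auto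
      then show ?thesis using False unfolding coherent_fun_def \<sigma>(3) c_def by simp
    qed
  qed
  from this[of 1 "{0..}"] this[of "- 1" "{..0}"]
  have "\<exists>h. smooth_on {0..} h \<and> (\<forall>x>0. h x = of_real (\<bar>x\<bar> powr (- (real d + 1) / 2)) * coherent_fun d z x)"
    "\<exists>h. smooth_on {..0} h \<and> (\<forall>x<0. h x = of_real (\<bar>x\<bar> powr (- (real d + 1) / 2)) * coherent_fun d z x)"
    by auto
  ultimately show ?thesis unfolding K_space_def by blast
qed

subsection \<open>Irreducibility\<close>

interpretation mult_haar: sigma_finite_measure mult_haar
  unfolding mult_haar_def
  by (subst sigma_finite_measure.sigma_finite_iff_density_finite[OF sigma_finite_lborel]) auto

interpretation mult_haar_pair: pair_sigma_finite mult_haar mult_haar ..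

text \<open>The integral of the product over all dilations is the product of the integrals.\<close>

lemma dilation_orthogonal:
  assumes [measurable]: "u \<in> borel_measurable borel" "v \<in> borel_measurable borel"
    and zero: "\<And>a. a \<noteq> 0 \<Longrightarrow> AE x in lborel. u (a * x) * v x = (0 :: ennreal)"
  shows "(\<integral>\<^sup>+x. u x \<partial>mult_haar) * (\<integral>\<^sup>+x. v x \<partial>mult_haar) = 0"
proof -
  have "(\<integral>\<^sup>+x. (\<integral>\<^sup>+a. u (a * x) * v x \<partial>mult_haar) \<partial>mult_haar) = (\<integral>\<^sup>+x. (\<integral>\<^sup>+a. u a \<partial>mult_haar) * v x \<partial>mult_haar)"
  proof (rule nn_integral_cong_AE)
    have "AE x in mult_haar. x \<noteq> 0"
      unfolding AE_mult_haar by (rule AE_lborel_singleton)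
    then show "AE x in mult_haar. (\<integral>\<^sup>+a. u (a * x) * v x \<partial>mult_haar) = (\<integral>\<^sup>+a. u a \<partial>mult_haar) * v x"
    proof eventually_elim
      case (elim x)
      have "(\<integral>\<^sup>+a. u (a * x) * v x \<partial>mult_haar) = (\<integral>\<^sup>+a. u (x * a) \<partial>mult_haar) * v x"
        by (subst nn_integral_multc) (auto simp: mult.commute)
      also have "(\<integral>\<^sup>+a. u (x * a) \<partial>mult_haar) = (\<integral>\<^sup>+a. u a \<partial>mult_haar)"
        using elim by (intro nn_integral_mult_haar_scale) auto
      finally show ?case .
    qed
  qed
  also have "\<dots> = (\<integral>\<^sup>+a. u a \<partial>mult_haar) * (\<integral>\<^sup>+x. v x \<partial>mult_haar)"
    by (rule nn_integral_cmult) measurable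
  finally have "(\<integral>\<^sup>+a. u a \<partial>mult_haar) * (\<integral>\<^sup>+x. v x \<partial>mult_haar)
      = (\<integral>\<^sup>+x. (\<integral>\<^sup>+a. u (a * x) * v x \<partial>mult_haar) \<partial>mult_haar)" by simp
  also have "\<dots> = (\<integral>\<^sup>+a. (\<integral>\<^sup>+x. u (a * x) * v x \<partial>mult_haar) \<partial>mult_haar)"
    by (rule mult_haar_pair.Fubini'[symmetric]) measurable
  also have "\<dots> = (\<integral>\<^sup>+a. 0 \<partial>mult_haar)"
  proof (rule nn_integral_cong_AE)
    have "AE a in mult_haar. a \<noteq> 0"
      unfolding AE_mult_haar by (rule AE_lborel_singleton)
    then show "AE a in mult_haar. (\<integral>\<^sup>+x. u (a * x) * v x \<partial>mult_haar) = 0"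
    proof eventually_elim
      case (elim a)
      show ?case
        using zero[OF elim] by (subst nn_integral_0_iff_AE) (auto simp: AE_mult_haar)
    qed
  qed
  finally show ?thesis by simp
qed

text \<open>Unipotent elements supply the characters of a Fourier transform and thus separate
  points. The exceptional null set depends on the dilation \<open>a\<close>, so one does not argue
  pointwise; \<open>dilation_orthogonal\<close> integrates over all \<open>a\<close> and makes the
  product of the two norms vanish.\<close>

lemma irreducible_rep_if_mirabolic:
  assumes unip: "\<And>F f y. represents F f \<Longrightarrow> represents (R (mat2 1 y 0 1) F) (\<lambda>x. exp (\<i> * of_real (y * x)) * f x)"
    and diag: "\<And>F f a. represents F f \<Longrightarrow> a \<noteq> 0 \<Longrightarrow> represents (R (mat2 a 0 0 1) F) (\<lambda>x. c a * f (a * x))"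
    and c: "\<And>a. a \<noteq> 0 \<Longrightarrow> c a \<noteq> 0"
  shows "irreducible_rep R"
  unfolding irreducible_rep_def
proof (intro allI impI)
  fix V assume V: "complex_subspace V \<and> closed V \<and> (\<forall>g\<in>GL2. R g ` V \<subseteq> V)"
  have inv: "R g F \<in> V" if "g \<in> GL2" "F \<in> V" for g F using V that by blast
  have sub: "subspace V"
    using V unfolding complex_subspace_def subspace_def scaleR_L2_def by blast
  show "V = {0} \<or> V = UNIV"
  proof (rule ccontr)
    assume *: "\<not> (V = {0} \<or> V = UNIV)"
    have "0 \<in> V" using V by (simp add: complex_subspace_def)
    then obtain F where F: "F \<in> V" "F \<noteq> 0" using * by blast
    obtain G where G: "G \<noteq> 0" "\<And>H. H \<in> V \<Longrightarrow> H \<bullet> G = 0"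
      using exists_orthogonal_vector[OF sub] V * by blast
    \<comment> \<open>The projection theorem gives real orthogonality; invariance of
      \<open>V\<close> under \<open>\<i>\<close> makes it complex.\<close>
    have orth: "cinner H G = 0" if "H \<in> V" for H
    proof -
      have "scaleC (- \<i>) H \<in> V" using V that by (auto simp: complex_subspace_def)
      from G(2)[OF this] G(2)[OF that] show ?thesis
        by (simp add: cinner_eq_inner inner_scaleC_commute complex_eq_iff)
    qed
    obtain f g where f: "represents F f" and g: "represents G g" using represents_ex by metis
    note [measurable] = represents_borel[OF f] represents_borel[OF g]
    have "AE x in lborel. ennreal ((cmod (f (a * x)))\<^sup>2) * ennreal ((cmod (g x))\<^sup>2) = 0" if a: "a \<noteq> 0" for a
    proof -
      define h where "h x = f (a * x) * cnj (g x) / of_real \<bar>x\<bar>" for x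
      have m: "(\<lambda>x. exp (\<i> * of_real (y * x)) * (c a * f (a * x)) * cnj (g x)) \<in> borel_measurable borel"
        "(\<lambda>x. f (a * x) * cnj (g x)) \<in> borel_measurable borel" for y
        by measurable
      have "AE x in lborel. h x = 0"
      proof (rule fourier_uniqueness)
        have "integrable mult_haar (\<lambda>x. f (a * x) * cnj (g x))"
          using sq_integrable_scale[OF represents_sq_integrable[OF f] a] represents_sq_integrable[OF g]
          by (rule sq_integrable_mult_cnj)
        then show "integrable lborel h"
          unfolding integrable_mult_haar[OF m(2)] h_def .
        fix y
        have "R (mat2 1 y 0 1) (R (mat2 a 0 0 1) F) \<in> V"
          using F a by (intro inv) (auto simp: GL2_iff)
        from orth[OF this] have "(\<integral>x. exp (\<i> * of_real (y * x)) * (c a * f (a * x)) * cnj (g x) \<partial>mult_haar) = 0"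
          unfolding cinner_represents[OF unip[OF diag[OF f a]] g] .
        moreover have "exp (\<i> * of_real (y * x)) * (c a * f (a * x)) * cnj (g x) / of_real \<bar>x\<bar> = c a * (iexp (y * x) * h x)" for x
          by (simp add: h_def)
        ultimately have "c a * (\<integral>x. iexp (y * x) * h x \<partial>lborel) = 0"
          unfolding integral_mult_haar[OF m(1)] by simp
        then show "(\<integral>x. iexp (y * x) * h x \<partial>lborel) = 0" using c[OF a] by simp
      qed
      then show ?thesis
        using AE_lborel_singleton[of "0::real"]
        by eventually_elim (auto simp: h_def)
    qed
    then have "(\<integral>\<^sup>+x. ennreal ((cmod (f x))\<^sup>2) \<partial>mult_haar) * (\<integral>\<^sup>+x. ennreal ((cmod (g x))\<^sup>2) \<partial>mult_haar) = 0"
      by (intro dilation_orthogonal) auto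
    then show False
      using F(2) G(1) by (simp add: nn_integral_represents[OF f] nn_integral_represents[OF g])
  qed
qed

text \<open>Bruhat decomposition: a matrix is upper triangular, or a product of upper triangular
  matrices with one Weyl element between them.\<close>

lemma GL2_rep_eq_if_generators:
  assumes R: "GL2_rep R" and S: "GL2_rep S"
    and unip: "\<And>y. R (mat2 1 y 0 1) = S (mat2 1 y 0 1)"
    and diag: "\<And>a. a \<noteq> 0 \<Longrightarrow> R (mat2 a 0 0 1) = S (mat2 a 0 0 1)"
    and scal: "\<And>b. b \<noteq> 0 \<Longrightarrow> R (mat2 b 0 0 b) = S (mat2 b 0 0 b)"
    and weyl: "R (mat2 0 (-1) 1 0) = S (mat2 0 (-1) 1 0)"
    and g: "g \<in> GL2"
  shows "R g = S g"
proof -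
  have mult_eq: "g ** h \<in> GL2 \<and> R (g ** h) = S (g ** h)"
    if "g \<in> GL2 \<and> R g = S g" "h \<in> GL2 \<and> R h = S h" for g h
    using that R S GL2_mult by (simp add: GL2_rep_def)
  have u: "mat2 1 y 0 1 \<in> GL2 \<and> R (mat2 1 y 0 1) = S (mat2 1 y 0 1)" for y
    using unip by (simp add: GL2_iff)
  have t: "mat2 p 0 0 q \<in> GL2 \<and> R (mat2 p 0 0 q) = S (mat2 p 0 0 q)" if "p \<noteq> 0" "q \<noteq> 0" for p q
  proof -
    have "mat2 p 0 0 q = mat2 (p / q) 0 0 1 ** mat2 q 0 0 q" using that by (simp add: mat2_mult)
    then show ?thesis using mult_eq[of "mat2 (p / q) 0 0 1" "mat2 q 0 0 q"] diag scal that
      by (simp add: GL2_iff)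
  qed
  define a b c e where "a = g$1$1" and "b = g$1$2" and "c = g$2$1" and "e = g$2$2"
  have g_eq: "g = mat2 a b c e" by (simp add: mat2_eq_iff a_def b_def c_def e_def)
  have det: "a * e - b * c \<noteq> 0" using g unfolding g_eq GL2_iff by simp
  show ?thesis
  proof (cases "c = 0")
    case True
    then have ae: "a \<noteq> 0" "e \<noteq> 0" using det by auto
    then have "g = mat2 1 (b / e) 0 1 ** mat2 a 0 0 e"
      using True by (simp add: g_eq mat2_mult)
    then show ?thesis using mult_eq[OF u t[OF ae], of "b / e"] by simp
  next
    case False
    define p where "p = (a * e - b * c) / c"
    have p: "p \<noteq> 0" using det False by (simp add: p_def)
    have w: "mat2 0 (-1) 1 0 \<in> GL2 \<and> R (mat2 0 (-1) 1 0) = S (mat2 0 (-1) 1 0)"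
      using weyl by (simp add: GL2_iff)
    \<comment> \<open>The big cell; \<open>p\<close> is forced by the determinant, since
      \<open>p * c = det g\<close>.\<close>
    have "g = mat2 1 (a / c) 0 1 ** (mat2 p 0 0 c ** (mat2 0 (-1) 1 0 ** mat2 1 (e / c) 0 1))"
      using False by (simp add: g_eq mat2_mult p_def mat2_eq_iff field_simps)
    then show ?thesis
      using mult_eq[OF u mult_eq[OF t[OF p False] mult_eq[OF w u]], of "a / c" "e / c"] by simp
  qed
qed

subsection \<open>The twisted representation\<close>

text \<open>A continuous character on the positive reals, extended by the sign with which
  \<open>discrete_op\<close> lets \<open>-1\<close> act.\<close>

locale central_character =
  fixes d :: nat and \<omega> :: "real \<Rightarrow> complex"
  assumes mult: "\<And>a b. a > 0 \<Longrightarrow> b > 0 \<Longrightarrow> \<omega> (a * b) = \<omega> a * \<omega> b"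
    and one: "\<omega> 1 = 1"
    and cont: "continuous_on {0<..} \<omega>"
    and sign: "\<And>b. b \<noteq> 0 \<Longrightarrow> \<omega> b = \<omega> \<bar>b\<bar> * of_real (sgn b ^ Suc d)"
begin

lemma nonzero:
  assumes "b > 0"
  shows "\<omega> b \<noteq> 0"
  using mult[of b "1 / b"] one assms by auto

text \<open>The factor is a character of the group. At \<open>diag(a, 1)\<close> it is the
  prescribed \<open>\<omega> (\<bar>a\<bar> powr (1 / 2))\<close>, and at the scalar
  \<open>b\<close> it is \<open>\<omega> \<bar>b\<bar>\<close>, which the sign from
  \<open>discrete_op\<close> completes to \<open>\<omega> b\<close>.\<close>

definition model_rep :: "real^2^2 \<Rightarrow> L2 \<Rightarrow> L2" where
  "model_rep g F = scaleC (\<omega> (sqrt \<bar>det g\<bar>)) (discrete_op d g F)"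

lemma model_rep_bounded_linear: "g \<in> GL2 \<Longrightarrow> bounded_linear (model_rep g)"
  unfolding model_rep_def[abs_def]
  by (intro bounded_linear_compose[OF bounded_linear_scaleC] bounded_linear_discrete_op)

lemma model_rep_scaleC: "g \<in> GL2 \<Longrightarrow> model_rep g (scaleC c F) = scaleC c (model_rep g F)"
  by (simp add: model_rep_def discrete_op_scaleC mult.commute)

lemma model_rep_mult:
  assumes "g \<in> GL2" "h \<in> GL2"
  shows "model_rep (g ** h) = model_rep g \<circ> model_rep h"
proof
  fix F
  have "sqrt \<bar>det g\<bar> > 0" "sqrt \<bar>det h\<bar> > 0" using assms by (auto simp: GL2_iff)
  then show "model_rep (g ** h) F = (model_rep g \<circ> model_rep h) F"
    using assms
    by (simp add: model_rep_def det_mul abs_mult real_sqrt_mult mult discrete_op_mult discrete_op_scaleC)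
qed

lemma GL2_rep_model_rep: "GL2_rep model_rep"
  unfolding GL2_rep_def
proof (intro conjI ballI allI)
  show "model_rep (mat 1) = id" by (rule ext) (simp add: model_rep_def one discrete_op_one)
qed (simp_all add: model_rep_mult model_rep_bounded_linear model_rep_scaleC)

lemma model_rep_unipotent:
  "represents F f \<Longrightarrow> represents (model_rep (mat2 1 y 0 1) F) (\<lambda>x. exp (\<i> * of_real (y * x)) * f x)"
  using represents_discrete_op_unipotent by (simp add: model_rep_def one)

lemma model_rep_diagonal:
  assumes "represents F f" "a \<noteq> 0"
  shows "represents (model_rep (mat2 a 0 0 1) F) (\<lambda>x. \<omega> (\<bar>a\<bar> powr (1 / 2)) * f (a * x))"
  using represents_scaleC[OF represents_discrete_op_diagonal[OF assms]]
  by (simp add: model_rep_def powr_half_sqrt)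

lemma model_rep_scalar:
  assumes "represents F f" and b: "b \<noteq> 0"
  shows "represents (model_rep (mat2 b 0 0 b) F) (\<lambda>x. \<omega> b * f x)"
proof -
  have "sqrt (\<bar>b\<bar> * \<bar>b\<bar>) = \<bar>b\<bar>" by simp
  then have "model_rep (mat2 b 0 0 b) F = scaleC (\<omega> b) F"
    using b by (simp add: model_rep_def discrete_op_scalar sign[OF b] abs_mult del: power_Suc)
  then show ?thesis using represents_scaleC[OF assms(1)] by simp
qed

lemma Bessel_rep_model_rep: "Bessel_rep d \<omega> (d + 1) model_rep"
  unfolding Bessel_rep_def
proof (intro conjI allI impI)
  show "GL2_rep model_rep" by (rule GL2_rep_model_rep)
  show "represents (model_rep (mat2 0 (- 1) 1 0) F)
      (\<lambda>y. of_real (sgn y ^ (d + 1)) * (\<integral>x. f x * j_kernel d (x * y) \<partial>mult_haar))"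
    if "represents F f" "f \<in> K_space d" for F f
    using represents_discrete_op_weyl[OF that] by (simp add: model_rep_def one)
qed (use model_rep_unipotent model_rep_diagonal model_rep_scalar in auto)

lemma strongly_continuous_model_rep: "strongly_continuous model_rep"
  unfolding strongly_continuous_def
proof
  fix F
  have "continuous_on GL2 (\<lambda>g. \<omega> (sqrt \<bar>det g\<bar>))"
  proof (rule continuous_on_compose2[OF cont])
    show "continuous_on GL2 (\<lambda>g::real^2^2. sqrt \<bar>det g\<bar>)"
      unfolding det_2 by (intro continuous_intros)
  qed (auto simp: GL2_iff)
  then show "continuous_on GL2 (\<lambda>g. model_rep g F)"
    unfolding model_rep_def by (intro continuous_intros continuous_on_discrete_op)
qed

lemma irreducible_model_rep: "irreducible_rep model_rep"
proof (rule irreducible_rep_if_mirabolic[OF model_rep_unipotent model_rep_diagonal])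
  show "\<omega> (\<bar>a\<bar> powr (1 / 2)) \<noteq> 0" if "a \<noteq> 0" for a
    using that by (intro nonzero) simp
qed

lemma unitary_model_rep:
  assumes unit: "\<And>b. b \<noteq> 0 \<Longrightarrow> cmod (\<omega> b) = 1"
  shows "unitary_rep model_rep"
  unfolding unitary_rep_def
proof (intro ballI conjI allI)
  fix g assume g: "g \<in> GL2"
  then obtain h where h: "g ** h = mat 1" "h ** g = mat 1" by (auto simp: GL2_def invertible_def)
  then have "h \<in> GL2" by (auto simp: GL2_def invertible_def)
  then have "model_rep g (model_rep h F) = F" for F
    using model_rep_mult[OF g, of h] h GL2_rep_model_rep by (simp add: GL2_rep_def fun_eq_iff)
  then show "surj (model_rep g)" by (metis surjI)
  have "cmod (\<omega> (sqrt \<bar>det g\<bar>)) = 1" using g by (intro unit) (simp add: GL2_iff)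
  then have "\<omega> (sqrt \<bar>det g\<bar>) * cnj (\<omega> (sqrt \<bar>det g\<bar>)) = 1"
    by (simp flip: complex_norm_square)
  then show "cinner (model_rep g F) (model_rep g G) = cinner F G" for F G
    by (simp add: model_rep_def cinner_scaleC_left cinner_scaleC_right cinner_discrete_op[OF g] mult.assoc[symmetric]
        mult.commute[of "cnj (\<omega> (sqrt \<bar>det g\<bar>))"])
qed

subsection \<open>Uniqueness\<close>

text \<open>The relation \<open>w diag(-1,1) = (-I) diag(-1,1) w\<close> transports the action of \<open>w\<close> from the upper
  to the lower half-plane, so the exponent \<open>e\<close> does not matter.\<close>

lemma Bessel_rep_eq_model_rep:
  assumes R: "Bessel_rep d \<omega> e R" and g: "g \<in> GL2"
  shows "R g = model_rep g"
proof -
  have rep: "GL2_rep R" using R by (simp add: Bessel_rep_def)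
  have uniq: "F = F'" if "represents F h" "represents F' h" for F F' h
    using represents_eq_iff[OF that] by simp
  have unip: "R (mat2 1 y 0 1) = model_rep (mat2 1 y 0 1)" for y
  proof
    fix F
    obtain f where f: "represents F f" using represents_ex by blast
    then have "represents (R (mat2 1 y 0 1) F) (\<lambda>x. exp (\<i> * of_real (y * x)) * f x)"
      using R unfolding Bessel_rep_def by blast
    from uniq[OF this model_rep_unipotent[OF f]] show "R (mat2 1 y 0 1) F = model_rep (mat2 1 y 0 1) F" .
  qed
  have diag: "R (mat2 a 0 0 1) = model_rep (mat2 a 0 0 1)" if "a \<noteq> 0" for a
  proof
    fix F
    obtain f where f: "represents F f" using represents_ex by blast
    then have "represents (R (mat2 a 0 0 1) F) (\<lambda>x. \<omega> (\<bar>a\<bar> powr (1 / 2)) * f (a * x))"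
      using R that unfolding Bessel_rep_def by blast
    from uniq[OF this model_rep_diagonal[OF f that]]
    show "R (mat2 a 0 0 1) F = model_rep (mat2 a 0 0 1) F" .
  qed
  have scal: "R (mat2 b 0 0 b) = model_rep (mat2 b 0 0 b)" if "b \<noteq> 0" for b
  proof
    fix F
    obtain f where f: "represents F f" using represents_ex by blast
    then have "represents (R (mat2 b 0 0 b) F) (\<lambda>x. \<omega> b * f x)"
      using R that unfolding Bessel_rep_def by blast
    from uniq[OF this model_rep_scalar[OF f that]]
    show "R (mat2 b 0 0 b) F = model_rep (mat2 b 0 0 b) F" .
  qed
  let ?w = "mat2 0 (-1) 1 0" and ?s = "mat2 (-1) 0 0 1" and ?m = "mat2 (-1) 0 0 (-1)"
  have GL: "?w \<in> GL2" "?s \<in> GL2" "?m \<in> GL2" by (simp_all add: GL2_iff)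
  \<comment> \<open>For these \<open>z\<close> the Bessel integral vanishes unless
    \<open>y > 0\<close>, and there every power of \<open>sgn y\<close> equals 1.\<close>
  have upper: "R ?w (coherent d z) = model_rep ?w (coherent d z)" if z: "Im z > 0" for z
  proof -
    have K: "coherent_fun d z \<in> K_space d" using z by (intro coherent_fun_in_K_space) simp
    let ?I = "\<lambda>y. \<integral>x. coherent_fun d z x * j_kernel d (x * y) \<partial>mult_haar"
    have "represents (R ?w (coherent d z)) (\<lambda>y. of_real (sgn y ^ e) * ?I y)"
      using R K represents_coherent unfolding Bessel_rep_def by blast
    moreover have "represents (model_rep ?w (coherent d z)) (\<lambda>y. of_real (sgn y ^ (d + 1)) * ?I y)"
      using Bessel_rep_model_rep K represents_coherent unfolding Bessel_rep_def by blast
    moreover have "of_real (sgn y ^ e) * ?I y = of_real (sgn y ^ (d + 1)) * ?I y" for y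
    proof (cases "y > 0")
      case False
      have "coherent_fun d z x * j_kernel d (x * y) = 0" for x
        using False z by (auto simp: coherent_fun_def j_kernel_def zero_less_mult_iff)
      then have "?I y = 0" by (simp only: integral_zero)
      then show ?thesis by simp
    qed simp
    ultimately show ?thesis
      by (subst represents_eq_iff) auto
  qed
  have ws: "?w ** ?s = ?m ** (?s ** ?w)" by (simp add: mat2_mult)
  have comm: "T ?w (T ?s F) = T ?m (T ?s (T ?w F))" if "GL2_rep T" for T F
  proof -
    have "T (?w ** ?s) = T ?w \<circ> T ?s" "T (?m ** (?s ** ?w)) = T ?m \<circ> (T ?s \<circ> T ?w)"
      using that GL GL2_mult[OF GL(2,1)] by (simp_all add: GL2_rep_def)
    then show ?thesis by (metis ws comp_apply)
  qed
  have "R ?w = model_rep ?w"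
  proof (rule eq_on_coherent)
    show "R ?w (coherent d z) = model_rep ?w (coherent d z)" if "Im z \<noteq> 0" for z
    proof (cases "Im z > 0")
      case False
      then have up: "Im (- z) > 0" using that by simp
      \<comment> \<open>The element \<open>diag(-1, 1)\<close> sends \<open>- z\<close> to
        \<open>z\<close> with weight 1, exchanging the half-planes.\<close>
      have "model_rep ?s (coherent d (- z)) = coherent d z"
        using that by (simp add: model_rep_def one discrete_op_coherent[OF GL(2)] mob_weight_def mob_def mob_denom_def)
      then have "R ?w (coherent d z) = R ?w (R ?s (coherent d (- z)))" using diag by simp
      also have "\<dots> = model_rep ?w (model_rep ?s (coherent d (- z)))"
        unfolding comm[OF rep] comm[OF GL2_rep_model_rep] upper[OF up] using diag scal by simp
      also have "model_rep ?s (coherent d (- z)) = coherent d z" by fact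
      finally show ?thesis .
    qed (rule upper)
  qed (use rep GL model_rep_bounded_linear model_rep_scaleC in \<open>auto simp: GL2_rep_def\<close>)
  then show ?thesis
    using GL2_rep_eq_if_generators[OF rep GL2_rep_model_rep unip diag scal _ g] by simp
qed

end

text \<open>\<open>model_rep\<close> is the witness for the existence clause, and any
  \<open>R\<close> in the universal clause agrees with it on \<open>GL2\<close>, where all three
  properties are tested.\<close>

theorem theorem8p2:
  fixes d m1 m2 :: nat and s1 s2 :: complex and \<chi>1 \<chi>2 \<omega> :: "real \<Rightarrow> complex"
  assumes "d > 0" and "m1 \<in> {0, 1}" and "m2 \<in> {0, 1}"
    and "\<chi>1 = quasichar s1 m1" and "\<chi>2 = quasichar s2 m2"
    and "\<omega> = (\<lambda>b. \<chi>1 b * \<chi>2 b)"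
    and "\<forall>t::real. t \<noteq> 0 \<longrightarrow>
           of_real \<bar>t\<bar> powr (s1 - s2) * of_real (sgn t powi (int m1 - int m2))
             = (of_real (t ^ d * sgn t) :: complex)"
  shows "(\<forall>R. Bessel_rep d \<omega> (m2 + d + 1) R \<longrightarrow>
            strongly_continuous R \<and> irreducible_rep R \<and>
            ((\<forall>b. b \<noteq> 0 \<longrightarrow> cmod (\<omega> b) = 1) \<longrightarrow> unitary_rep R))
       \<and> (\<exists>R. Bessel_rep d \<omega> (d + 1) R \<and>
            strongly_continuous R \<and> irreducible_rep R \<and>
            ((\<forall>b. b \<noteq> 0 \<longrightarrow> cmod (\<omega> b) = 1) \<longrightarrow> unitary_rep R))"
proof -
  have \<omega>_eq: "\<omega> b = of_real \<bar>b\<bar> powr s1 * of_real \<bar>b\<bar> powr s2 * of_real (sgn b ^ (m1 + m2))" for b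
    unfolding assms(4-6) quasichar_def by (simp add: power_add)
  \<comment> \<open>The relation between the characters at \<open>t = -1\<close>, where the absolute
    value drops out, compares \<open>m1 - m2\<close> with \<open>d + 1\<close> modulo 2.\<close>
  have "complex_of_real ((- 1) powi (int m1 - int m2)) = of_real ((- 1) ^ Suc d)"
    using assms(7)[rule_format, of "-1"] by simp
  then have "(- 1 :: real) powi (int m1 - int m2) = (- 1) ^ Suc d"
    by (simp only: of_real_eq_iff)
  moreover have "(- 1 :: real) powi (int m1 - int m2) = (- 1) ^ (m1 + m2)"
    using assms(2,3) by (auto simp: power_int_minus)
  ultimately have parity: "(- 1 :: real) ^ (m1 + m2) = (- 1) ^ Suc d" by simp
  interpret central_character d \<omega>
  proof
    show "\<omega> (a * b) = \<omega> a * \<omega> b" if "a > 0" "b > 0" for a b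
      using that by (simp add: \<omega>_eq abs_mult powr_times_real)
    show "\<omega> 1 = 1" by (simp add: \<omega>_eq)
    show "continuous_on {0<..} \<omega>"
    proof (rule continuous_on_eq)
      show "continuous_on {0<..} (\<lambda>b. of_real b powr s1 * of_real b powr s2)"
        by (intro continuous_intros) auto
    qed (simp add: \<omega>_eq)
    fix b :: real assume "b \<noteq> 0"
    then have "sgn b = 1 \<or> sgn b = - 1" by (auto simp: sgn_if)
    then have "sgn b ^ (m1 + m2) = sgn b ^ Suc d" using parity by auto
    then show "\<omega> b = \<omega> \<bar>b\<bar> * of_real (sgn b ^ Suc d)"
      using \<open>b \<noteq> 0\<close> by (simp add: \<omega>_eq del: power_Suc)
  qed
  have "strongly_continuous R \<and> irreducible_rep R \<and>
      ((\<forall>b. b \<noteq> 0 \<longrightarrow> cmod (\<omega> b) = 1) \<longrightarrow> unitary_rep R)" if R: "Bessel_rep d \<omega> (m2 + d + 1) R" for R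
  proof -
    have eq: "R g = model_rep g" if "g \<in> GL2" for g
      using Bessel_rep_eq_model_rep[OF R that] .
    then show ?thesis
      using strongly_continuous_model_rep irreducible_model_rep unitary_model_rep
      by (simp add: strongly_continuous_def irreducible_rep_def unitary_rep_def cong: continuous_on_cong)
  qed
  then show ?thesis
    using Bessel_rep_model_rep strongly_continuous_model_rep irreducible_model_rep unitary_model_rep by blast
qed

end
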